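(* Let $\phi$ be a nonconstant inner function on $\mathbb{D}^2$ and let $\alpha\in\mathbb{T}$. Assume that $J_\alpha\colon K_\phi\to L^2(\sigma_\alpha)$ is surjective and that $\vartheta^1_\alpha$ is bounded on $\mathbb{D}^2$. Assume $\phi(0,z_2)\equiv0$, so that $\phi=z_1\psi$ for some inner function $\psi$ on $\mathbb{D}^2$. Then $$K_\phi=K_\psi\oplus\psi H^2_2$$ (orthogonal direct sum), and so each $f\in K_\phi$ can be written as $f=f_1+\psi f_2$ with $f_1\in K_\psi$ and $f_2\in H^2_2$. With respect to this decomposition, $U^1_\alpha$ is given by $$U^1_\alpha f=z_1f_1+\alpha f_2.$$
   Context: $\mathbb{D}$ is the open unit disk, $\mathbb{T}$ the unit circle. $H^2(\mathbb{D}^2)$ is the Hardy space of holomorphic $f=\sum_{k,l\ge0}a_{k,l}z_1^kz_2^l$ on $\mathbb{D}^2$ with $\|f\|^2=\sum|a_{k,l}|^2<\infty$, identified via boundary values with a closed subspace of $L^2=L^2(\mathbb{T}^2)$ (normalized Lebesgue measure). A function $\phi$ is inner on $\mathbb{D}^2$ if it is bounded and holomorphic on $\mathbb{D}^2$ with non-tangential boundary values of modulus $1$ a.e. on $\mathbb{T}^2$. For an inner function $\phi$ the model space is $K_\phi=H^2(\mathbb{D}^2)\ominus\phi H^2(\mathbb{D}^2)$ (and likewise $K_\psi$); $P_\phi\colon H^2(\mathbb{D}^2)\to K_\phi$ is the orthogonal projection, and $S^1_\phi f=P_\phi(z_1f)$ for $f\in K_\phi$ is the compressed shift. $k_w(z)=\frac{1}{(1-z_1\bar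 w_1)(1-z_2\bar w_2)}$, and $k_w^\phi(z)=\frac{1-\phi(z)\overline{\phi(w)}}{(1-z_1\bar w_1)(1-z_2\bar w_2)}$ is the reproducing kernel of $K_\phi$. Clark measure: for $\alpha\in\mathbb{T}$, $\sigma_\alpha$ is the positive Borel measure on $\mathbb{T}^2$ with $\frac{1-|\phi(z)|^2}{|\alpha-\phi(z)|^2}=\int_{\mathbb{T}^2}P_{z_1}(\zeta_1)P_{z_2}(\zeta_2)\,d\sigma_\alpha(\zeta)$ for all $z\in\mathbb{D}^2$, where $P_{z_j}(\zeta_j)=\frac{1-|z_j|^2}{|\zeta_j-z_j|^2}$. Clark embedding: $J_\alpha\colon K_\phi\to L^2(\sigma_\alpha)$ is the linear isometry (known to exist, not necessarily surjective) determined by $J_\alpha k_w^\phi=(1-\alpha\overline{\phi(w)})\,k_w$ for all $w\in\mathbb{D}^2$. With $(B_1f)(z)=\frac{f(z)-f(0,z_2)}{z_1}$, the holomorphic function $\vartheta^1_\alpha$ on $\mathbb{D}^2$ is $\vartheta^1_\alpha(z)=\bar\alpha\,\frac{(B_1\phi)(z)}{1-\bar\alpha\phi(0,z_2)}$. When it is bounded, $M_{\overline{\vartheta^1_\alpha}}$ is multiplication on $L^2(\mathbb{T}^2)$ by the complex conjugate of (the boundary values of) $\vartheta^1_\alpha$. $H^2_2\subset H^2(\mathbb{D}^2)$ is the one-variable Hardy space $H^2(\mathbb{D})$ in the variable $z_2$, and $P_{H^2_2}$ is the orthogonal projection of $L^2(\mathbb{T}^2)$ onto $H^2_2$. The operator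 $U^1_\alpha\colon K_\phi\to K_\phi$ is $U^1_\alpha=S^1_\phi+P_\phi P_{H^2_2}M_{\overline{\vartheta^1_\alpha}}$. *)

theory Defs
  imports "HOL-Analysis.Analysis"
begin

definition bidisk :: "(complex \<times> complex) set" where
  "bidisk = ball 0 1 \<times> ball 0 1"

definition torus :: "(complex \<times> complex) set" where
  "torus = sphere 0 1 \<times> sphere 0 1"

definition circle_measure :: "complex measure" where
  "circle_measure =
     distr (uniform_measure lborel {0..<2 * pi}) (restrict_space borel (sphere 0 1)) cis"

definition torus_measure :: "(complex \<times> complex) measure" where
  "torus_measure = circle_measure \<Otimes>\<^sub>M circle_measure"

text \<open>Elements of \<open>L\<^sup>2\<close> are represented by functions; equality in \<open>L\<^sup>2\<close> is equality
  almost everywhere.\<close>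

definition L2 :: "'a measure \<Rightarrow> ('a \<Rightarrow> complex) set" where
  "L2 M = {g \<in> borel_measurable M. integrable M (\<lambda>x. (cmod (g x))\<^sup>2)}"

text \<open>Elements of \<open>H\<^sup>2\<close> of the bidisk are total functions normalized to vanish off the bidisk,
  so that two elements are equal as soon as they agree on the bidisk.\<close>

definition has_bidisk_series ::
    "(complex \<times> complex \<Rightarrow> complex) \<Rightarrow> (nat \<times> nat \<Rightarrow> complex) \<Rightarrow> bool" where
  "has_bidisk_series f a \<longleftrightarrow>
     (\<forall>z\<in>bidisk. ((\<lambda>(k, l). a (k, l) * fst z ^ k * snd z ^ l) has_sum f z) UNIV)"

definition hardy2 :: "(complex \<times> complex \<Rightarrow> complex) set" where
  "hardy2 = {f. (\<forall>z. z \<notin> bidisk \<longrightarrow> f z = 0) \<and>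
     (\<exists>a. has_bidisk_series f a \<and> (\<lambda>p. (cmod (a p))\<^sup>2) summable_on UNIV)}"

definition bidisk_coeff :: "(complex \<times> complex \<Rightarrow> complex) \<Rightarrow> nat \<times> nat \<Rightarrow> complex" where
  "bidisk_coeff f = (THE a. has_bidisk_series f a)"

definition hardy_inner ::
    "(complex \<times> complex \<Rightarrow> complex) \<Rightarrow> (complex \<times> complex \<Rightarrow> complex) \<Rightarrow> complex" where
  "hardy_inner f g = (\<Sum>\<^sub>\<infinity>p\<in>UNIV. bidisk_coeff f p * cnj (bidisk_coeff g p))"

definition hardy_disk :: "(complex \<Rightarrow> complex) set" where
  "hardy_disk = {g. \<exists>b. summable (\<lambda>n. (cmod (b n))\<^sup>2) \<and>
     (\<forall>w\<in>ball 0 1. (\<lambda>n. b n * w ^ n) sums g w)}"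

definition hardy_z2 :: "(complex \<times> complex \<Rightarrow> complex) set" where
  "hardy_z2 = {(\<lambda>z. if z \<in> bidisk then g (snd z) else 0) | g. g \<in> hardy_disk}"

text \<open>The boundary function in \<open>L\<^sup>2\<close> of the torus of a function in \<open>H\<^sup>2\<close>: the \<open>L\<^sup>2\<close> limit of
  the dilations \<open>\<zeta> \<mapsto> f (r \<zeta>)\<close> as \<open>r\<close> increases to 1. It is determined up to a null set
  and, by Fatou's theorem, agrees almost everywhere with the non-tangential limit.\<close>

definition boundary_value ::
    "(complex \<times> complex \<Rightarrow> complex) \<Rightarrow> complex \<times> complex \<Rightarrow> complex" where
  "boundary_value f = (SOME g. g \<in> L2 torus_measure \<and>
     ((\<lambda>r. \<integral>\<^sup>+ \<zeta>. ennreal ((cmod (f (r *\<^sub>R \<zeta>) - g \<zeta>))\<^sup>2) \<partial>torus_measure) \<longlongrightarrow> 0) (at_left 1))"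

definition holomorphic_on_bidisk :: "(complex \<times> complex \<Rightarrow> complex) \<Rightarrow> bool" where
  "holomorphic_on_bidisk f \<longleftrightarrow>
     (\<forall>z\<in>bidisk. \<exists>a b. (f has_derivative (\<lambda>h. a * fst h + b * snd h)) (at z))"

text \<open>Product of two Stolz regions of aperture \<open>M\<close>; it is contained in the bidisk.\<close>

definition stolz_region :: "real \<Rightarrow> complex \<times> complex \<Rightarrow> (complex \<times> complex) set" where
  "stolz_region M \<zeta> = {z. cmod (fst z - fst \<zeta>) < M * (1 - cmod (fst z)) \<and>
                           cmod (snd z - snd \<zeta>) < M * (1 - cmod (snd z))}"

definition inner_function :: "(complex \<times> complex \<Rightarrow> complex) \<Rightarrow> bool" where
  "inner_function \<phi> \<longleftrightarrow> holomorphic_on_bidisk \<phi> \<and> bounded (\<phi> ` bidisk) \<and>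
     (AE \<zeta> in torus_measure. \<exists>c. cmod c = 1 \<and>
        (\<forall>M>1. (\<phi> \<longlongrightarrow> c) (at \<zeta> within stolz_region M \<zeta>)))"

definition model_space ::
    "(complex \<times> complex \<Rightarrow> complex) \<Rightarrow> (complex \<times> complex \<Rightarrow> complex) set" where
  "model_space \<phi> = {f \<in> hardy2. \<forall>h\<in>hardy2. hardy_inner f (\<lambda>z. \<phi> z * h z) = 0}"

definition model_proj ::
    "(complex \<times> complex \<Rightarrow> complex) \<Rightarrow> (complex \<times> complex \<Rightarrow> complex) \<Rightarrow>
     complex \<times> complex \<Rightarrow> complex" where
  "model_proj \<phi> f = (THE g. g \<in> model_space \<phi> \<and>
     (\<forall>h\<in>model_space \<phi>. hardy_inner (\<lambda>z. f z - g z) h = 0))"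

definition compressed_shift1 ::
    "(complex \<times> complex \<Rightarrow> complex) \<Rightarrow> (complex \<times> complex \<Rightarrow> complex) \<Rightarrow>
     complex \<times> complex \<Rightarrow> complex" where
  "compressed_shift1 \<phi> f = model_proj \<phi> (\<lambda>z. fst z * f z)"

definition orthogonal_direct_sum ::
    "(complex \<times> complex \<Rightarrow> complex) set \<Rightarrow> (complex \<times> complex \<Rightarrow> complex) set \<Rightarrow>
     (complex \<times> complex \<Rightarrow> complex) set \<Rightarrow> bool" where
  "orthogonal_direct_sum K A B \<longleftrightarrow>
     K = {(\<lambda>z. f z + g z) | f g. f \<in> A \<and> g \<in> B} \<and>
     (\<forall>f\<in>A. \<forall>g\<in>B. hardy_inner f g = 0)"

definition poisson :: "complex \<Rightarrow> complex \<Rightarrow> real" where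
  "poisson w \<zeta> = (1 - (cmod w)\<^sup>2) / (cmod (\<zeta> - w))\<^sup>2"

definition clark_measure ::
    "(complex \<times> complex \<Rightarrow> complex) \<Rightarrow> complex \<Rightarrow> (complex \<times> complex) measure \<Rightarrow> bool" where
  "clark_measure \<phi> \<alpha> \<sigma> \<longleftrightarrow> sets \<sigma> = sets (restrict_space borel torus) \<and>
     (\<forall>z\<in>bidisk. has_bochner_integral \<sigma>
        (\<lambda>\<zeta>. poisson (fst z) (fst \<zeta>) * poisson (snd z) (snd \<zeta>))
        ((1 - (cmod (\<phi> z))\<^sup>2) / (cmod (\<alpha> - \<phi> z))\<^sup>2))"

definition szego_kernel :: "complex \<times> complex \<Rightarrow> complex \<times> complex \<Rightarrow> complex" where
  "szego_kernel w z = 1 / ((1 - fst z * cnj (fst w)) * (1 - snd z * cnj (snd w)))"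

definition model_kernel ::
    "(complex \<times> complex \<Rightarrow> complex) \<Rightarrow> complex \<times> complex \<Rightarrow> complex \<times> complex \<Rightarrow> complex" where
  "model_kernel \<phi> w z =
     (if z \<in> bidisk then (1 - \<phi> z * cnj (\<phi> w)) * szego_kernel w z else 0)"

text \<open>These conditions determine \<open>J f\<close> up to \<open>\<sigma>\<close>-null sets, because the kernels span
  a dense subspace of the model space.\<close>

definition clark_embedding ::
    "(complex \<times> complex \<Rightarrow> complex) \<Rightarrow> complex \<Rightarrow> (complex \<times> complex) measure \<Rightarrow>
     ((complex \<times> complex \<Rightarrow> complex) \<Rightarrow> complex \<times> complex \<Rightarrow> complex) \<Rightarrow> bool" where
  "clark_embedding \<phi> \<alpha> \<sigma> J \<longleftrightarrow>
     (\<forall>f\<in>model_space \<phi>. J f \<in> L2 \<sigma>) \<and>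
     (\<forall>f\<in>model_space \<phi>. \<forall>g\<in>model_space \<phi>.
        AE \<zeta> in \<sigma>. J (\<lambda>z. f z + g z) \<zeta> = J f \<zeta> + J g \<zeta>) \<and>
     (\<forall>c. \<forall>f\<in>model_space \<phi>. AE \<zeta> in \<sigma>. J (\<lambda>z. c * f z) \<zeta> = c * J f \<zeta>) \<and>
     (\<forall>f\<in>model_space \<phi>.
        complex_of_real (LINT \<zeta>|\<sigma>. (cmod (J f \<zeta>))\<^sup>2) = hardy_inner f f) \<and>
     (\<forall>w\<in>bidisk. AE \<zeta> in \<sigma>.
        J (model_kernel \<phi> w) \<zeta> = (1 - \<alpha> * cnj (\<phi> w)) * szego_kernel w \<zeta>)"

definition clark_embedding_surj ::
    "(complex \<times> complex \<Rightarrow> complex) \<Rightarrow> (complex \<times> complex) measure \<Rightarrow>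
     ((complex \<times> complex \<Rightarrow> complex) \<Rightarrow> complex \<times> complex \<Rightarrow> complex) \<Rightarrow> bool" where
  "clark_embedding_surj \<phi> \<sigma> J \<longleftrightarrow>
     (\<forall>g\<in>L2 \<sigma>. \<exists>f\<in>model_space \<phi>. AE \<zeta> in \<sigma>. J f \<zeta> = g \<zeta>)"

text \<open>At \<open>z\<^sub>1 = 0\<close> the difference quotient is given its holomorphic extension.\<close>

definition backward_shift1 ::
    "(complex \<times> complex \<Rightarrow> complex) \<Rightarrow> complex \<times> complex \<Rightarrow> complex" where
  "backward_shift1 f z =
     (if fst z = 0 then deriv (\<lambda>w. f (w, snd z)) 0
      else (f z - f (0, snd z)) / fst z)"

definition theta1 ::
    "(complex \<times> complex \<Rightarrow> complex) \<Rightarrow> complex \<Rightarrow> complex \<times> complex \<Rightarrow> complex" where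
  "theta1 \<phi> \<alpha> z = cnj \<alpha> * (backward_shift1 \<phi> z / (1 - cnj \<alpha> * \<phi> (0, snd z)))"

text \<open>The argument is a function on the torus; the value is the corresponding function on the
  bidisk, not its boundary function.\<close>

definition proj_z2 :: "(complex \<times> complex \<Rightarrow> complex) \<Rightarrow> complex \<times> complex \<Rightarrow> complex" where
  "proj_z2 g = (THE h. h \<in> hardy_z2 \<and>
     (\<forall>u\<in>hardy_z2.
        (LINT \<zeta>|torus_measure. (g \<zeta> - boundary_value h \<zeta>) * cnj (boundary_value u \<zeta>)) = 0))"

definition U1 ::
    "(complex \<times> complex \<Rightarrow> complex) \<Rightarrow> complex \<Rightarrow> (complex \<times> complex \<Rightarrow> complex) \<Rightarrow>
     complex \<times> complex \<Rightarrow> complex" where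
  "U1 \<phi> \<alpha> f = (\<lambda>z. compressed_shift1 \<phi> f z +
     model_proj \<phi>
       (proj_z2 (\<lambda>\<zeta>. cnj (boundary_value (theta1 \<phi> \<alpha>) \<zeta>) * boundary_value f \<zeta>)) z)"

end

theory Submission
  imports Defs "HOL-Complex_Analysis.Complex_Analysis"
begin

text \<open>Multiplication by an inner function is isometric on \<open>H\<^sup>2\<close>, because boundary values are
  multiplicative and have modulus one. With \<open>\<phi> = z\<^sub>1 \<psi>\<close>, a function \<open>f\<close> in \<open>K\<^sub>\<phi>\<close> therefore splits
  as \<open>(f - \<psi> k) + \<psi> k\<close>, where \<open>k\<close> is the projection to \<open>H\<^sup>2\<close> of \<open>cnj \<psi> f\<close>; since \<open>f\<close> is orthogonal to
  \<open>z\<^sub>1 \<psi> H\<^sup>2\<close>, \<open>k\<close> is orthogonal to \<open>z\<^sub>1 H\<^sup>2\<close>, that is, a function of \<open>z\<^sub>2\<close>. Here \<open>\<vartheta> = cnj \<alpha> \<psi>\<close>,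
  so \<open>cnj \<vartheta> (f\<^sub>1 + \<psi> f\<^sub>2) = \<alpha> cnj \<psi> f\<^sub>1 + \<alpha> f\<^sub>2\<close> on the torus, and the first term is orthogonal to \<open>H\<^sup>2\<close>
  because \<open>f\<^sub>1\<close> is orthogonal to \<open>\<psi> H\<^sup>2\<close>. Finally \<open>z\<^sub>1 f\<^sub>1\<close> and \<open>f\<^sub>2\<close> lie in \<open>K\<^sub>\<phi>\<close>, while the
  compression to \<open>K\<^sub>\<phi>\<close> kills \<open>z\<^sub>1 \<psi> f\<^sub>2 = \<phi> f\<^sub>2\<close>.\<close>

section \<open>Integration over the circle and the torus\<close>

text \<open>Membership in \<open>hardy2\<close> and \<open>hardy_inner\<close> are defined by Taylor
  coefficients, whereas inner functions and \<open>proj_z2\<close> are defined by behaviour on the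
  torus. Most of the work builds the bridge \<open>hardy_inner_eq_boundary_integral\<close> between
  the two: iterated Cauchy integrals give double power series, the dilations of a function in
  \<open>H\<^sup>2\<close> converge in L2, and the Fourier coefficients of the limit are the Taylor
  coefficients. \<open>boundary_value\<close> is a choice, determined only almost everywhere, so the
  arguments run on the relation \<open>L2_boundary\<close>. \<open>model_proj\<close> and
  \<open>proj_z2\<close> are definite descriptions; their values are found by exhibiting a candidate
  and testing any competitor against the difference of the two. The candidate \<open>k\<close> for
  the second component is built from Fourier coefficients, square summable by Bessel's inequality.
  Existence of \<psi> is a separate argument: the terms of \<phi> without \<open>z\<^sub>1\<close>
  vanish by hypothesis, and the quotient by \<open>z\<^sub>1\<close> is bounded by the maximum
  principle.\<close>

lemma space_circle_measure [simp]: "space circle_measure = sphere 0 1"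
  and sets_circle_measure [measurable_cong]:
    "sets circle_measure = sets (restrict_space borel (sphere 0 1))"
  by (simp_all add: circle_measure_def space_restrict_space)

lemma measurable_cis_circle:
  "cis \<in> uniform_measure lborel A \<rightarrow>\<^sub>M restrict_space borel (sphere 0 1)"
proof (rule measurable_restrict_space2)
  have "cis \<in> borel_measurable borel"
    by (intro borel_measurable_continuous_onI continuous_intros)
  then show "cis \<in> uniform_measure lborel A \<rightarrow>\<^sub>M borel" by simp
qed auto

lemma uniform_measure_interval:
  "uniform_measure lborel {0..<2 * pi} =
   density lborel (\<lambda>x. ennreal (indicator {0..<2 * pi} x / (2 * pi)))"
  unfolding uniform_measure_def
  by (intro density_cong AE_I2) (auto simp: divide_ennreal indicator_def ennreal_1[symmetric] simp del: ennreal_1)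

lemma finite_measure_circle: "finite_measure circle_measure"
proof -
  have "emeasure circle_measure (space circle_measure) =
      emeasure (uniform_measure lborel {0..<2*pi}) (cis -` sphere 0 1)"
    unfolding circle_measure_def
    using sets.top[of "restrict_space borel (sphere 0 1 :: complex set)"]
    by (subst emeasure_distr[OF measurable_cis_circle]) (simp_all add: space_restrict_space)
  also have "cis -` sphere 0 1 = UNIV" by auto
  also have "emeasure (uniform_measure lborel {0..<2*pi}) UNIV < \<infinity>"
    by (simp add: divide_ennreal)
  finally show ?thesis by (intro finite_measureI) auto
qed

lemma circle_integral:
  fixes F :: "complex \<Rightarrow> complex"
  assumes F: "continuous_on (sphere 0 1) F"
  shows "(LINT \<zeta>|circle_measure. F \<zeta>) = integral {0..2*pi} (\<lambda>t. F (cis t)) / (2 * pi)"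
proof -
  have Fm: "F \<in> borel_measurable (restrict_space borel (sphere 0 1))"
    by (rule borel_measurable_continuous_on_restrict[OF F])
  have cont: "continuous_on UNIV (\<lambda>t. F (cis t))"
    by (rule continuous_on_compose2[OF F]) (auto intro!: continuous_intros)
  then have m: "(\<lambda>t. F (cis t)) \<in> borel_measurable borel"
    by (rule borel_measurable_continuous_onI)
  have "(LINT \<zeta>|circle_measure. F \<zeta>) = (LINT t|uniform_measure lborel {0..<2*pi}. F (cis t))"
    unfolding circle_measure_def using Fm measurable_cis_circle by (rule integral_distr[rotated])
  also have "\<dots> = (LINT t|lborel. (indicator {0..<2 * pi} t / (2 * pi)) *\<^sub>R F (cis t))"
    unfolding uniform_measure_interval using m by (intro integral_density) auto
  also have "\<dots> = (LINT t|lborel. (indicator {0..2 * pi} t *\<^sub>R F (cis t)) / (2*pi))"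
  proof (rule integral_cong_AE)
    \<comment> \<open>\<open>circle_measure\<close> lives on the half-open interval, the Henstock
      integral on the closed one; they differ by a null set.\<close>
    have "AE t in lborel. t \<noteq> 2*pi" by (rule AE_lborel_singleton)
    then show "AE t in lborel. (indicator {0..<2 * pi} t / (2 * pi)) *\<^sub>R F (cis t) =
        (indicator {0..2 * pi} t *\<^sub>R F (cis t)) / (2*pi)"
      by eventually_elim (auto simp: indicator_def scaleR_conv_of_real)
  qed (use m in auto)
  also have "\<dots> = (LINT t:{0..2*pi}|lborel. F (cis t)) / (2*pi)"
    by (simp add: set_lebesgue_integral_def)
  also have "(LINT t:{0..2*pi}|lborel. F (cis t)) = integral {0..2*pi} (\<lambda>t. F (cis t))"
    by (intro set_borel_integral_eq_integral(2) borel_integrable_atLeastAtMost'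
        continuous_on_subset[OF cont]) auto
  finally show ?thesis .
qed

text \<open>Cauchy's formula on the circle of radius \<open>r\<close>, with
  \<open>u = r * \<zeta>\<close>: since \<zeta> is unimodular, \<open>1 / \<zeta>\<close> becomes
  \<open>cnj \<zeta>\<close>. In this form the kernel expands into a geometric series in
  \<open>cnj \<zeta>\<close>, which produces Fourier coefficients.\<close>

lemma circle_cauchy:
  assumes g: "g holomorphic_on ball 0 1" and r: "0 < r" "r < 1" and z: "cmod z < r"
  shows "(LINT \<zeta>|circle_measure. g (r * \<zeta>) / (1 - z / r * cnj \<zeta>)) = g z"
proof -
  have nz: "1 - z / r * cnj \<zeta> \<noteq> 0" if "\<zeta> \<in> sphere 0 1" for \<zeta> :: complex
  proof
    assume "1 - z / r * cnj \<zeta> = 0"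
    then have "cmod (z / r * cnj \<zeta>) = 1" by (metis eq_iff_diff_eq_0 norm_one)
    with that z r show False by (simp add: norm_mult norm_divide)
  qed
  have gc: "continuous_on (ball 0 1) g" using g by (rule holomorphic_on_imp_continuous_on)
  have c: "continuous_on (sphere 0 1) (\<lambda>\<zeta>::complex. g (r * \<zeta>) / (1 - z / r * cnj \<zeta>))"
    using r nz by (intro continuous_intros continuous_on_compose2[OF gc]) (auto simp: norm_mult)
  have "((\<lambda>u. g u / (u - z)) has_contour_integral (2 * of_real pi * \<i> * g z)) (circlepath 0 r)"
    using r z by (intro Cauchy_integral_circlepath holomorphic_on_subset[OF g] continuous_on_subset[OF gc]) auto
  then have "((\<lambda>t. g (0 + r * cis t) / (0 + r * cis t - z) * r * \<i> * cis t) has_integral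
      (2 * of_real pi * \<i> * g z)) {0..2*pi}"
    unfolding circlepath_def by (subst (asm) has_contour_integral_part_circlepath_iff) auto
  also have "(\<lambda>t. g (0 + r * cis t) / (0 + r * cis t - z) * r * \<i> * cis t) =
    (\<lambda>t. \<i> * (g (r * cis t) / (1 - z / r * cnj (cis t))))"
  proof
    fix t
    have *: "r * cis t * (1 - z / r * cnj (cis t)) = r * cis t - z"
      using r by (simp add: algebra_simps cis_cnj cis_mult)
    moreover have "1 - z / r * cnj (cis t) \<noteq> 0" using nz[of "cis t"] by simp
    ultimately show "g (0 + r * cis t) / (0 + r * cis t - z) * r * \<i> * cis t =
       \<i> * (g (r * cis t) / (1 - z / r * cnj (cis t)))"
      using r by (simp add: frac_eq_eq flip: *)
  qed
  finally have "integral {0..2*pi} (\<lambda>t. \<i> * (g (r * cis t) / (1 - z / r * cnj (cis t)))) = 2 * of_real pi * \<i> * g z"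
    by (rule integral_unique)
  then have "\<i> * integral {0..2*pi} (\<lambda>t. g (r * cis t) / (1 - z / r * cnj (cis t))) = \<i> * (2 * of_real pi * g z)"
    by (simp only: integral_mult_right) (simp add: mult_ac)
  then have "integral {0..2*pi} (\<lambda>t. g (r * cis t) / (1 - z / r * cnj (cis t))) = 2 * of_real pi * g z"
    by simp
  with circle_integral[OF c] show ?thesis by simp
qed

lemma circle_monomials:
  "(LINT \<zeta>|circle_measure. \<zeta> ^ m * cnj \<zeta> ^ n) = (if m = n then 1 else 0)"
proof -
  \<comment> \<open>Cauchy's formula at the centre gives the value \<open>0 ^ k\<close>; the radius
    1/2 is arbitrary and its power cancels.\<close>
  have pos: "(LINT \<zeta>|circle_measure. \<zeta> ^ k) = (if k = 0 then 1 else 0)" for k :: nat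
    using circle_cauchy[of "\<lambda>z. z ^ k" "1/2" 0]
    by (auto simp: power_divide holomorphic_intros zero_power split: if_splits)
  have u: "\<zeta> * cnj \<zeta> = 1" if "\<zeta> \<in> space circle_measure" for \<zeta>
    using that by (simp add: complex_norm_square[symmetric])
  have ge: "(LINT \<zeta>|circle_measure. \<zeta> ^ (n + k) * cnj \<zeta> ^ n) = (if k = 0 then 1 else 0)" for n k :: nat
  proof -
    have "(LINT \<zeta>|circle_measure. \<zeta> ^ (n + k) * cnj \<zeta> ^ n) = (LINT \<zeta>|circle_measure. \<zeta> ^ k)"
    proof (intro Bochner_Integration.integral_cong refl)
      fix \<zeta> assume "\<zeta> \<in> space circle_measure"
      have "\<zeta> ^ (n + k) * cnj \<zeta> ^ n = \<zeta> ^ k * (\<zeta> * cnj \<zeta>) ^ n"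
        by (simp add: power_add power_mult_distrib)
      with u[OF \<open>\<zeta> \<in> _\<close>] show "\<zeta> ^ (n + k) * cnj \<zeta> ^ n = \<zeta> ^ k" by simp
    qed
    with pos show ?thesis by simp
  qed
  show ?thesis
  proof (cases "n \<le> m")
    case True
    with ge[of n "m - n"] show ?thesis by auto
  next
    case False
    have "(LINT \<zeta>|circle_measure. \<zeta> ^ m * cnj \<zeta> ^ n) =
      cnj (LINT \<zeta>|circle_measure. \<zeta> ^ n * cnj \<zeta> ^ m)"
      by (simp flip: Bochner_Integration.integral_cnj add: mult.commute)
    with ge[of m "n - m"] False show ?thesis by auto
  qed
qed

interpretation circle: finite_measure circle_measure by (rule finite_measure_circle)
interpretation circle2: pair_sigma_finite circle_measure circle_measure ..

lemma space_torus_measure [simp]: "space torus_measure = torus"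
  by (simp add: torus_measure_def torus_def space_pair_measure)

interpretation torus: finite_measure torus_measure
  unfolding torus_measure_def by (rule finite_measure_pair_measure) unfold_locales

lemma measurable_circle_ident: "(\<lambda>x. x) \<in> circle_measure \<rightarrow>\<^sub>M borel"
  by (simp add: measurable_ident measurable_restrict_space1 cong: measurable_cong_sets[OF sets_circle_measure refl])

lemma measurable_torus_ident: "(\<lambda>x. x) \<in> torus_measure \<rightarrow>\<^sub>M borel"
proof -
  have "(\<lambda>x. (fst x, snd x)) \<in> torus_measure \<rightarrow>\<^sub>M borel \<Otimes>\<^sub>M borel"
    unfolding torus_measure_def
    by (intro measurable_Pair measurable_compose[OF measurable_fst measurable_circle_ident]
        measurable_compose[OF measurable_snd measurable_circle_ident])
  then show ?thesis by (simp add: borel_prod)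
qed

text \<open>The identity is measurable into \<open>restrict_space borel torus\<close>, so continuity
  on the torus alone suffices. This matters because the dilations of a function on the bidisk are
  controlled only there.\<close>

lemma measurable_continuous_torus:
  fixes g :: "complex \<times> complex \<Rightarrow> 'b::topological_space"
  assumes "continuous_on torus g"
  shows "g \<in> borel_measurable torus_measure"
proof -
  have "(\<lambda>x. x) \<in> torus_measure \<rightarrow>\<^sub>M restrict_space borel torus"
    by (rule measurable_restrict_space2) (auto intro: measurable_torus_ident)
  from measurable_compose[OF this borel_measurable_continuous_on_restrict[OF assms]]
  show ?thesis by simp
qed

lemma compact_torus: "compact torus"
  unfolding torus_def by (intro compact_Times) auto

lemma bounded_continuous_torus:
  fixes g :: "complex \<times> complex \<Rightarrow> complex"
  assumes "continuous_on torus g"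
  obtains B where "\<And>\<zeta>. \<zeta> \<in> torus \<Longrightarrow> cmod (g \<zeta>) \<le> B"
  using compact_imp_bounded[OF compact_continuous_image[OF assms compact_torus]]
  by (auto simp: bounded_iff)

lemma integrable_continuous_torus:
  fixes g :: "complex \<times> complex \<Rightarrow> complex"
  assumes "continuous_on torus g"
  shows "integrable torus_measure g"
proof -
  obtain B where "\<And>\<zeta>. \<zeta> \<in> torus \<Longrightarrow> cmod (g \<zeta>) \<le> B" using bounded_continuous_torus[OF assms] by blast
  then show ?thesis
    by (intro torus.integrable_const_bound[where B=B] AE_I2 measurable_continuous_torus[OF assms]) auto
qed

lemma torus_iterated_integral:
  fixes g :: "complex \<times> complex \<Rightarrow> complex"
  assumes "continuous_on torus g"
  shows "(LINT \<zeta>|torus_measure. g \<zeta>) =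
    (LINT \<xi>|circle_measure. LINT \<eta>|circle_measure. g (\<xi>, \<eta>))"
  using circle2.integral_fst'[of g] integrable_continuous_torus[OF assms]
  by (simp add: torus_measure_def)

section \<open>Double power series\<close>

text \<open>Indexing by the pair itself lets all exponents be handled as one family. On the torus
  these functions are an orthonormal system of unimodular functions, and dilation by
  \<open>r\<close> multiplies each by a power of \<open>r\<close> with exponent
  \<open>tdeg p\<close>.\<close>

definition bimonom :: "nat \<times> nat \<Rightarrow> complex \<times> complex \<Rightarrow> complex" where
  "bimonom p z = fst z ^ fst p * snd z ^ snd p"

abbreviation tdeg :: "nat \<times> nat \<Rightarrow> nat" where
  "tdeg p \<equiv> fst p + snd p"

lemma has_bidisk_series_iff:
  "has_bidisk_series f a \<longleftrightarrow> (\<forall>z\<in>bidisk. ((\<lambda>p. a p * bimonom p z) has_sum f z) UNIV)"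
  by (simp add: has_bidisk_series_def bimonom_def case_prod_unfold mult.assoc)

lemma bimonom_scaleR: "bimonom p (r *\<^sub>R z) = of_real r ^ tdeg p * bimonom p z"
  by (simp add: bimonom_def scaleR_conv_of_real power_mult_distrib power_add)

lemma norm_bimonom_torus [simp]: "\<zeta> \<in> torus \<Longrightarrow> cmod (bimonom p \<zeta>) = 1"
  by (auto simp: bimonom_def torus_def norm_mult norm_power)

lemma scaleR_torus_in_bidisk: "\<zeta> \<in> torus \<Longrightarrow> 0 \<le> r \<Longrightarrow> r < 1 \<Longrightarrow> r *\<^sub>R \<zeta> \<in> bidisk"
  by (auto simp: torus_def bidisk_def)

lemma continuous_on_bimonom [continuous_intros]: "continuous_on S (bimonom p)"
  unfolding bimonom_def by (intro continuous_intros)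

lemma integral_bimonom:
  "(LINT \<zeta>|torus_measure. bimonom p \<zeta> * cnj (bimonom q \<zeta>)) = (if p = q then 1 else 0)"
proof -
  have "(LINT \<zeta>|torus_measure. bimonom p \<zeta> * cnj (bimonom q \<zeta>)) =
    (LINT \<xi>|circle_measure. LINT \<eta>|circle_measure.
      (\<xi> ^ fst p * cnj \<xi> ^ fst q) * (\<eta> ^ snd p * cnj \<eta> ^ snd q))"
    by (subst torus_iterated_integral) (auto intro!: continuous_intros simp: bimonom_def mult_ac)
  also have "\<dots> = (if p = q then 1 else 0)"
    by (simp add: circle_monomials prod_eq_iff)
  finally show ?thesis .
qed

text \<open>Enumerating the pairs by \<open>prod_decode\<close> reduces this to termwise integration
  of a sequence of functions; absolute convergence makes the order irrelevant.\<close>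

lemma integral_has_sum:
  fixes t :: "nat \<times> nat \<Rightarrow> 'a \<Rightarrow> complex"
  assumes int: "\<And>p. integrable M (t p)"
    and abs: "(\<lambda>p. LINT x|M. cmod (t p x)) summable_on UNIV"
    and sum: "\<And>x. x \<in> space M \<Longrightarrow> ((\<lambda>p. t p x) has_sum F x) UNIV"
  shows "integrable M F" and "((\<lambda>p. LINT x|M. t p x) has_sum (LINT x|M. F x)) UNIV"
proof -
  let ?t = "\<lambda>n. t (prod_decode n)"
  note re = has_sum_reindex_bij_betw[OF bij_prod_decode]
  have sums: "(\<lambda>n. ?t n x) sums F x" if "x \<in> space M" for x
    by (rule has_sum_imp_sums) (use re[of "\<lambda>p. t p x"] sum[OF that] in simp)
  have "summable (\<lambda>n. cmod (?t n x))" if "x \<in> space M" for x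
  proof -
    have "(\<lambda>n. ?t n x) summable_on UNIV"
      using re[of "\<lambda>p. t p x"] sum[OF that] by (auto simp: summable_on_def)
    then show ?thesis
      by (simp add: summable_on_iff_abs_summable_on_complex summable_on_imp_summable)
  qed
  then have 1: "AE x in M. summable (\<lambda>n. cmod (?t n x))" by (rule AE_I2)
  have "(\<lambda>n. LINT x|M. cmod (?t n x)) summable_on UNIV"
    using abs summable_on_reindex_bij_betw[OF bij_prod_decode, of "\<lambda>p. LINT x|M. cmod (t p x)"] by simp
  then have 2: "summable (\<lambda>n. LINT x|M. cmod (?t n x))" by (rule summable_on_imp_summable)
  have eq: "(\<Sum>n. ?t n x) = F x" if "x \<in> space M" for x
    using sums[OF that] by (simp add: sums_iff)
  show "integrable M F"
    using integrable_suminf[OF int 1 2] eq by (simp cong: Bochner_Integration.integrable_cong)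
  have "(\<lambda>n. LINT x|M. ?t n x) sums (LINT x|M. (\<Sum>n. ?t n x))"
    by (rule sums_integral[OF int 1 2])
  also have "(LINT x|M. (\<Sum>n. ?t n x)) = (LINT x|M. F x)"
    using eq by (intro Bochner_Integration.integral_cong) auto
  finally have s: "(\<lambda>n. LINT x|M. ?t n x) sums (LINT x|M. F x)" .
  \<comment> \<open>Absolute convergence of the integrals is what allows the return from
    \<open>sums\<close> to \<open>has_sum\<close>.\<close>
  have "summable (\<lambda>n. cmod (LINT x|M. ?t n x))"
    by (rule summable_comparison_test[OF _ 2]) (auto intro!: integral_norm_bound)
  from norm_summable_imp_has_sum[OF this s]
  show "((\<lambda>p. LINT x|M. t p x) has_sum (LINT x|M. F x)) UNIV"
    using re[of "\<lambda>p. LINT x|M. t p x"] by simp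
qed

text \<open>Unconditional convergence of complex numbers is absolute, and the factors
  \<open>bimonom p \<zeta>\<close> have modulus one. Convergence at a single point therefore bounds
  the series uniformly on the torus.\<close>

lemma abs_summable_at_torus:
  assumes "\<zeta> \<in> torus" "((\<lambda>p. c p * bimonom p \<zeta>) has_sum S) UNIV"
  shows "(\<lambda>p. cmod (c p)) summable_on UNIV"
proof -
  have "(\<lambda>p. cmod (c p * bimonom p \<zeta>)) summable_on UNIV"
    using has_sum_imp_summable[OF assms(2)] by (simp add: summable_on_iff_abs_summable_on_complex)
  with assms(1) show ?thesis by (simp add: norm_mult)
qed

lemma one_in_torus: "(1, 1) \<in> torus" by (simp add: torus_def)

text \<open>The terms are dominated in L1 by \<open>cmod (c p)\<close> times the norm of
  \<open>G\<close>. Mere integrability of \<open>G\<close> is assumed so that it may be a conjugated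
  L2 function as well as a monomial.\<close>

lemma torus_series_integral:
  assumes F: "\<And>\<zeta>. \<zeta> \<in> torus \<Longrightarrow> ((\<lambda>p. c p * bimonom p \<zeta>) has_sum F \<zeta>) UNIV"
    and G: "integrable torus_measure G"
  shows "integrable torus_measure (\<lambda>\<zeta>. F \<zeta> * G \<zeta>)"
    and "((\<lambda>p. c p * (LINT \<zeta>|torus_measure. bimonom p \<zeta> * G \<zeta>)) has_sum
           (LINT \<zeta>|torus_measure. F \<zeta> * G \<zeta>)) UNIV"
proof -
  have [measurable]: "bimonom p \<in> borel_measurable torus_measure" for p
    by (intro measurable_continuous_torus continuous_intros)
  have [measurable]: "G \<in> borel_measurable torus_measure" using G by simp
  have i1: "integrable torus_measure (\<lambda>\<zeta>. bimonom p \<zeta> * G \<zeta>)" for p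
    by (rule Bochner_Integration.integrable_bound[OF G]) (auto simp: norm_mult)
  then have i: "integrable torus_measure (\<lambda>\<zeta>. c p * bimonom p \<zeta> * G \<zeta>)" for p
    by (simp add: mult.assoc)
  have n: "(LINT \<zeta>|torus_measure. cmod (c p * bimonom p \<zeta> * G \<zeta>)) =
      cmod (c p) * (LINT \<zeta>|torus_measure. cmod (G \<zeta>))" for p
  proof -
    have "(LINT \<zeta>|torus_measure. cmod (c p * bimonom p \<zeta> * G \<zeta>)) =
      (LINT \<zeta>|torus_measure. cmod (c p) * cmod (G \<zeta>))"
      by (intro Bochner_Integration.integral_cong) (auto simp: norm_mult)
    then show ?thesis by simp
  qed
  have s: "(\<lambda>p. LINT \<zeta>|torus_measure. cmod (c p * bimonom p \<zeta> * G \<zeta>)) summable_on UNIV"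
    unfolding n by (intro summable_on_cmult_left abs_summable_at_torus[OF one_in_torus F[OF one_in_torus]])
  have e: "((\<lambda>p. c p * bimonom p \<zeta> * G \<zeta>) has_sum F \<zeta> * G \<zeta>) UNIV" if "\<zeta> \<in> space torus_measure" for \<zeta>
    using F that by (intro has_sum_cmult_left) auto
  from integral_has_sum[OF i s e]
  show "integrable torus_measure (\<lambda>\<zeta>. F \<zeta> * G \<zeta>)"
    and "((\<lambda>p. c p * (LINT \<zeta>|torus_measure. bimonom p \<zeta> * G \<zeta>)) has_sum
           (LINT \<zeta>|torus_measure. F \<zeta> * G \<zeta>)) UNIV"
    by (simp_all add: mult.assoc)
qed

lemma torus_coeff:
  assumes "\<And>\<zeta>. \<zeta> \<in> torus \<Longrightarrow> ((\<lambda>p. c p * bimonom p \<zeta>) has_sum F \<zeta>) UNIV"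
  shows "(LINT \<zeta>|torus_measure. F \<zeta> * cnj (bimonom q \<zeta>)) = c q"
proof -
  have "integrable torus_measure (\<lambda>\<zeta>. cnj (bimonom q \<zeta>))"
    by (intro integrable_continuous_torus continuous_intros)
  from torus_series_integral(2)[OF assms this]
  have "((\<lambda>p. if p = q then c p else 0) has_sum (LINT \<zeta>|torus_measure. F \<zeta> * cnj (bimonom q \<zeta>))) UNIV"
    by (simp add: integral_bimonom if_distrib cong: if_cong)
  moreover have "((\<lambda>p. if p = q then c p else 0) has_sum c q) UNIV"
    by (rule has_sum_finite_neutralI[of "{q}"]) auto
  ultimately show ?thesis by (rule has_sum_unique)
qed

lemma has_sum_on_torus:
  assumes "has_bidisk_series f a" "0 \<le> r" "r < 1" "\<zeta> \<in> torus"
  shows "((\<lambda>p. (a p * of_real r ^ tdeg p) * bimonom p \<zeta>) has_sum f (r *\<^sub>R \<zeta>)) UNIV"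
  using assms scaleR_torus_in_bidisk[of \<zeta> r]
  by (auto simp: has_bidisk_series_iff bimonom_scaleR mult_ac)

lemma dilation_coeff:
  assumes "has_bidisk_series f a" "0 \<le> r" "r < 1"
  shows "(LINT \<zeta>|torus_measure. f (r *\<^sub>R \<zeta>) * cnj (bimonom p \<zeta>)) = a p * of_real r ^ tdeg p"
  by (rule torus_coeff[OF has_sum_on_torus[OF assms]])

text \<open>The values on one dilated torus already determine the coefficients, so the description
  in \<open>bidisk_coeff\<close> has a single candidate. The radius 1/2 is an arbitrary
  choice.\<close>

lemma bidisk_coeff_eq:
  assumes "has_bidisk_series f a"
  shows "bidisk_coeff f = a"
  unfolding bidisk_coeff_def
proof (rule the_equality[where P = "has_bidisk_series f"])
  fix b assume "has_bidisk_series f b"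
  show "b = a"
  proof
    fix p
    show "b p = a p"
      using dilation_coeff[OF \<open>has_bidisk_series f b\<close>, of "1/2" p] dilation_coeff[OF assms, of "1/2" p] by simp
  qed
qed fact

lemma torus_parseval:
  assumes F: "\<And>\<zeta>. \<zeta> \<in> torus \<Longrightarrow> ((\<lambda>p. c p * bimonom p \<zeta>) has_sum F \<zeta>) UNIV"
    and G: "\<And>\<zeta>. \<zeta> \<in> torus \<Longrightarrow> ((\<lambda>p. d p * bimonom p \<zeta>) has_sum G \<zeta>) UNIV"
  shows "((\<lambda>p. c p * cnj (d p)) has_sum (LINT \<zeta>|torus_measure. F \<zeta> * cnj (G \<zeta>))) UNIV"
    and "integrable torus_measure (\<lambda>\<zeta>. F \<zeta> * cnj (G \<zeta>))"
proof -
  have i: "integrable torus_measure (\<lambda>\<zeta>. cnj (G \<zeta>))"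
    using torus_series_integral(1)[OF G, of "\<lambda>_. 1"] by simp
  have "(LINT \<zeta>|torus_measure. bimonom p \<zeta> * cnj (G \<zeta>)) = cnj (d p)" for p
    by (subst torus_coeff[OF G, symmetric]) (simp_all flip: Bochner_Integration.integral_cnj add: mult.commute)
  then show "((\<lambda>p. c p * cnj (d p)) has_sum (LINT \<zeta>|torus_measure. F \<zeta> * cnj (G \<zeta>))) UNIV"
    using torus_series_integral(2)[OF F i] by simp
  show "integrable torus_measure (\<lambda>\<zeta>. F \<zeta> * cnj (G \<zeta>))"
    by (rule torus_series_integral(1)[OF F i])
qed

lemma torus_parseval_norm:
  assumes F: "\<And>\<zeta>. \<zeta> \<in> torus \<Longrightarrow> ((\<lambda>p. c p * bimonom p \<zeta>) has_sum F \<zeta>) UNIV"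
  shows "((\<lambda>p. (cmod (c p))\<^sup>2) has_sum (LINT \<zeta>|torus_measure. (cmod (F \<zeta>))\<^sup>2)) UNIV"
    and "integrable torus_measure (\<lambda>\<zeta>. (cmod (F \<zeta>))\<^sup>2)"
proof -
  note P = torus_parseval[OF F F, folded complex_norm_square]
  have "((\<lambda>p. complex_of_real ((cmod (c p))\<^sup>2)) has_sum
     complex_of_real (LINT \<zeta>|torus_measure. (cmod (F \<zeta>))\<^sup>2)) UNIV"
    using P(1) by (simp only: of_real_power flip: integral_complex_of_real)
  then show "((\<lambda>p. (cmod (c p))\<^sup>2) has_sum (LINT \<zeta>|torus_measure. (cmod (F \<zeta>))\<^sup>2)) UNIV"
    by (simp only: has_sum_of_real_iff)
  show "integrable torus_measure (\<lambda>\<zeta>. (cmod (F \<zeta>))\<^sup>2)"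
    using integrable_Re[OF P(2)] by simp
qed

section \<open>Double power series of holomorphic functions on the bidisk\<close>

lemma summable_bimonom:
  assumes x: "0 \<le> x" "x < (1::real)" and y: "0 \<le> y" "y < 1"
  shows "(\<lambda>p::nat\<times>nat. x ^ fst p * y ^ snd p) summable_on UNIV"
proof -
  have g: "((\<lambda>n. u ^ n) has_sum (1 / (1 - u))) UNIV" if "0 \<le> u" "u < 1" for u :: real
    using that geometric_sums[of u] by (intro sums_nonneg_imp_has_sum) auto
  have "(\<lambda>p::nat\<times>nat. x ^ fst p * y ^ snd p) summable_on Sigma UNIV (\<lambda>_. UNIV)"
  proof (rule summable_on_SigmaI)
    show "((\<lambda>l. x ^ fst (k, l) * y ^ snd (k, l)) has_sum x ^ k * (1 / (1 - y))) UNIV" for k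
      using has_sum_cmult_right[OF g[OF y]] by simp
    show "(\<lambda>k. x ^ k * (1 / (1 - y))) summable_on UNIV"
      using g[OF x] by (intro summable_on_cmult_left) (auto simp: summable_on_def)
  qed (use x y in auto)
  then show ?thesis by simp
qed

lemma has_sum_bimonom_kernel:
  assumes z: "z \<in> bidisk"
  shows "((\<lambda>p. bimonom p z) has_sum 1 / ((1 - fst z) * (1 - snd z))) UNIV"
proof -
  obtain x y where [simp]: "z = (x, y)" by force
  have xy: "cmod x < 1" "cmod y < 1" using z by (auto simp: bidisk_def)
  have g: "((\<lambda>n. u ^ n) has_sum (1 / (1 - u))) UNIV" if "cmod u < 1" for u :: complex
    using that geometric_sums[of u] summable_geometric[of "cmod u"]
    by (intro norm_summable_imp_has_sum) (auto simp: norm_power)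
  have "((\<lambda>p::nat\<times>nat. x ^ fst p * y ^ snd p) has_sum (1 / (1 - x)) * (1 / (1 - y))) (Sigma UNIV (\<lambda>_. UNIV))"
  proof (rule has_sum_SigmaI)
    show "((\<lambda>l. x ^ fst (k, l) * y ^ snd (k, l)) has_sum x ^ k * (1 / (1 - y))) UNIV" for k
      using has_sum_cmult_right[OF g[OF xy(2)]] by simp
    show "((\<lambda>k. x ^ k * (1 / (1 - y))) has_sum (1 / (1 - x)) * (1 / (1 - y))) UNIV"
      using g[OF xy(1)] by (intro has_sum_cmult_left)
    have "(\<lambda>p::nat\<times>nat. cmod (x ^ fst p * y ^ snd p)) summable_on UNIV"
      using summable_bimonom[of "cmod x" "cmod y"] xy by (simp add: norm_mult norm_power)
    then show "(\<lambda>p::nat\<times>nat. x ^ fst p * y ^ snd p) summable_on Sigma UNIV (\<lambda>_. UNIV)"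
      by (simp add: abs_summable_summable)
  qed
  then show ?thesis by (simp add: bimonom_def)
qed

lemma holomorphic_on_bidisk_continuous:
  "holomorphic_on_bidisk f \<Longrightarrow> continuous_on bidisk f"
  unfolding holomorphic_on_bidisk_def
  by (intro continuous_at_imp_continuous_on ballI) (blast intro: has_derivative_continuous)

lemma continuous_dilation:
  assumes "continuous_on bidisk f" "0 \<le> r" "r < 1"
  shows "continuous_on torus (\<lambda>\<zeta>. f (r *\<^sub>R \<zeta>))"
  using assms by (intro continuous_on_compose2[OF assms(1)] continuous_intros) (auto intro: scaleR_torus_in_bidisk simp del: scaleR_Pair)

text \<open>The derivative in \<open>holomorphic_on_bidisk\<close> is complex linear in each
  coordinate, so it restricts to the coordinate lines. Separate holomorphy is the form in which the
  one-variable Cauchy formula can be iterated.\<close>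

lemma holomorphic_on_bidisk_slices:
  assumes "holomorphic_on_bidisk f"
  shows "cmod w < 1 \<Longrightarrow> (\<lambda>u. f (u, w)) holomorphic_on ball 0 1"
    and "cmod w < 1 \<Longrightarrow> (\<lambda>u. f (w, u)) holomorphic_on ball 0 1"
proof -
  show "(\<lambda>u. f (u, w)) holomorphic_on ball 0 1" if "cmod w < 1"
  proof (rule holomorphic_onI)
    fix u :: complex assume "u \<in> ball 0 1"
    then have "(u, w) \<in> bidisk" using that by (simp add: bidisk_def)
    then obtain a b where f: "(f has_derivative (\<lambda>h. a * fst h + b * snd h)) (at (u, w))"
      using assms unfolding holomorphic_on_bidisk_def by blast
    have slice: "((\<lambda>u. (u, w)) has_derivative (\<lambda>h. (h, 0))) (at u)"
      by (intro has_derivative_Pair has_derivative_ident has_derivative_const)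
    have "((\<lambda>u. f (u, w)) has_derivative (\<lambda>h. a * h)) (at u)"
      using has_derivative_compose[OF slice f] by simp
    then have "((\<lambda>u. f (u, w)) has_field_derivative a) (at u)"
      by (simp add: has_field_derivative_def)
    then show "(\<lambda>u. f (u, w)) field_differentiable at u within ball 0 1"
      using field_differentiable_at_within field_differentiable_def by blast
  qed
  show "(\<lambda>u. f (w, u)) holomorphic_on ball 0 1" if "cmod w < 1"
  proof (rule holomorphic_onI)
    fix u :: complex assume "u \<in> ball 0 1"
    then have "(w, u) \<in> bidisk" using that by (simp add: bidisk_def)
    then obtain a b where f: "(f has_derivative (\<lambda>h. a * fst h + b * snd h)) (at (w, u))"
      using assms unfolding holomorphic_on_bidisk_def by blast
    have slice: "((\<lambda>u. (w, u)) has_derivative (\<lambda>h. (0, h))) (at u)"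
      by (intro has_derivative_Pair has_derivative_ident has_derivative_const)
    have "((\<lambda>u. f (w, u)) has_derivative (\<lambda>h. b * h)) (at u)"
      using has_derivative_compose[OF slice f] by simp
    then have "((\<lambda>u. f (w, u)) has_field_derivative b) (at u)"
      by (simp add: has_field_derivative_def)
    then show "(\<lambda>u. f (w, u)) field_differentiable at u within ball 0 1"
      using field_differentiable_at_within field_differentiable_def by blast
  qed
qed

lemma dilated_kernel_in_bidisk:
  assumes "0 < r" "cmod (fst z) < r" "cmod (snd z) < r" "\<zeta> \<in> torus"
  shows "(fst z / of_real r * cnj (fst \<zeta>), snd z / of_real r * cnj (snd \<zeta>)) \<in> bidisk"
  using assms by (auto simp: bidisk_def torus_def norm_mult norm_divide)

lemma bidisk_cauchy:
  assumes f: "holomorphic_on_bidisk f" and r: "0 < r" "r < 1"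
    and z: "cmod (fst z) < r" "cmod (snd z) < r"
  shows "(LINT \<zeta>|torus_measure. f (r *\<^sub>R \<zeta>) /
     ((1 - fst z / r * cnj (fst \<zeta>)) * (1 - snd z / r * cnj (snd \<zeta>)))) = f z"
proof -
  have "continuous_on torus (\<lambda>\<zeta>. f (r *\<^sub>R \<zeta>) /
     ((1 - fst z / r * cnj (fst \<zeta>)) * (1 - snd z / r * cnj (snd \<zeta>))))"
    using r dilated_kernel_in_bidisk[OF r(1) z]
    by (intro continuous_intros continuous_dilation holomorphic_on_bidisk_continuous f)
       (fastforce simp: bidisk_def)+
  \<comment> \<open>Rearranging the fraction lets the factor in the outer variable leave the inner
    integral.\<close>
  moreover have swap: "u / (v * w) = u / w / v" for u v w :: complex by simp
  ultimately have "(LINT \<zeta>|torus_measure. f (r *\<^sub>R \<zeta>) /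
     ((1 - fst z / r * cnj (fst \<zeta>)) * (1 - snd z / r * cnj (snd \<zeta>)))) =
    (LINT \<xi>|circle_measure. (LINT \<eta>|circle_measure. f (r * \<xi>, r * \<eta>) / (1 - snd z / r * cnj \<eta>)) /
       (1 - fst z / r * cnj \<xi>))"
    by (subst torus_iterated_integral) (simp_all only: swap fst_conv snd_conv scaleR_Pair scaleR_conv_of_real integral_divide_zero)
  also have "\<dots> = (LINT \<xi>|circle_measure. f (r * \<xi>, snd z) / (1 - fst z / r * cnj \<xi>))"
  proof (intro Bochner_Integration.integral_cong refl)
    fix \<xi> assume "\<xi> \<in> space circle_measure"
    then have "cmod (r * \<xi>) < 1" using r by (simp add: norm_mult)
    from circle_cauchy[OF holomorphic_on_bidisk_slices(2)[OF f this] r z(2)]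
    show "(LINT \<eta>|circle_measure. f (r * \<xi>, r * \<eta>) / (1 - snd z / r * cnj \<eta>)) / (1 - fst z / r * cnj \<xi>) =
       f (r * \<xi>, snd z) / (1 - fst z / r * cnj \<xi>)" by simp
  qed
  also have "\<dots> = f z"
    using circle_cauchy[OF holomorphic_on_bidisk_slices(1)[OF f, of "snd z"] r z(1)] z r by simp
  finally show ?thesis .
qed

text \<open>Expand the two Cauchy kernels geometrically and integrate term by term. The coefficients
  obtained still refer to \<open>r\<close>; \<open>holomorphic_imp_bidisk_series\<close> shows that
  they do not depend on it.\<close>

lemma local_bidisk_series:
  assumes f: "holomorphic_on_bidisk f" and r: "0 < r" "r < 1"
    and z: "cmod (fst z) < r" "cmod (snd z) < r"
  shows "((\<lambda>p. (LINT \<zeta>|torus_measure. f (r *\<^sub>R \<zeta>) * cnj (bimonom p \<zeta>)) / r ^ tdeg p * bimonom p z)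
     has_sum f z) UNIV"
proof -
  define t where "t p \<zeta> = bimonom p z / r ^ tdeg p * (f (r *\<^sub>R \<zeta>) * cnj (bimonom p \<zeta>))" for p \<zeta>
  have fc: "continuous_on torus (\<lambda>\<zeta>. f (r *\<^sub>R \<zeta>))"
    using r by (intro continuous_dilation holomorphic_on_bidisk_continuous f) auto
  have int: "integrable torus_measure (t p)" for p
    unfolding t_def by (intro integrable_continuous_torus continuous_intros fc)
  have n: "(LINT \<zeta>|torus_measure. cmod (t p \<zeta>)) =
      ((cmod (fst z) / r) ^ fst p * (cmod (snd z) / r) ^ snd p) * (LINT \<zeta>|torus_measure. cmod (f (r *\<^sub>R \<zeta>)))" for p
  proof -
    have "(LINT \<zeta>|torus_measure. cmod (t p \<zeta>)) =
      (LINT \<zeta>|torus_measure. cmod (bimonom p z) / r ^ tdeg p * cmod (f (r *\<^sub>R \<zeta>)))"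
      using r by (intro Bochner_Integration.integral_cong) (auto simp: t_def norm_mult norm_divide norm_power)
    then show ?thesis
      by (simp add: bimonom_def norm_mult norm_power power_divide power_add)
  qed
  have abs: "(\<lambda>p. LINT \<zeta>|torus_measure. cmod (t p \<zeta>)) summable_on UNIV"
    unfolding n using r z by (intro summable_on_cmult_left summable_bimonom) auto
  have sum: "((\<lambda>p. t p \<zeta>) has_sum f (r *\<^sub>R \<zeta>) /
     ((1 - fst z / r * cnj (fst \<zeta>)) * (1 - snd z / r * cnj (snd \<zeta>)))) UNIV"
    if "\<zeta> \<in> space torus_measure" for \<zeta>
  proof -
    \<comment> \<open>The product of the two Cauchy kernels is the double geometric series at this
      point, which lies in the bidisk because both coordinates of \<open>z\<close> are smaller than
      \<open>r\<close>.\<close>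
    let ?w = "(fst z / of_real r * cnj (fst \<zeta>), snd z / of_real r * cnj (snd \<zeta>))"
    have "?w \<in> bidisk" using that by (intro dilated_kernel_in_bidisk r z) auto
    from has_sum_cmult_right[OF has_sum_bimonom_kernel[OF this], of "f (r *\<^sub>R \<zeta>)"]
    show ?thesis
      by (simp add: t_def bimonom_def power_mult_distrib power_divide power_add mult_ac)
  qed
  from integral_has_sum(2)[OF int abs sum]
  show ?thesis
    unfolding bidisk_cauchy[OF f r z] by (simp add: t_def mult_ac)
qed

theorem holomorphic_imp_bidisk_series:
  assumes f: "holomorphic_on_bidisk f"
  shows "\<exists>a. has_bidisk_series f a"
proof -
  define A where "A r p = (LINT \<zeta>|torus_measure. f (r *\<^sub>R \<zeta>) * cnj (bimonom p \<zeta>)) / r ^ tdeg p" for r p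
  have loc: "((\<lambda>p. A r p * bimonom p z) has_sum f z) UNIV"
    if "0 < r" "r < 1" "cmod (fst z) < r" "cmod (snd z) < r" for r z
    using local_bidisk_series[OF f that] by (simp add: A_def)
  have A: "A r p = A (1/2) p" if r: "1/2 \<le> r" "r < 1" for r p
  proof -
    \<comment> \<open>The torus of radius 1/4 lies inside every polydisk of radius
      \<open>s \<ge> 1/2\<close>. The left-hand side does not mention \<open>s\<close>, so the
      coefficients for any two such radii agree.\<close>
    have "(LINT \<zeta>|torus_measure. f ((1/4) *\<^sub>R \<zeta>) * cnj (bimonom p \<zeta>)) = A s p * of_real (1/4) ^ tdeg p"
      if "1/2 \<le> s" "s < 1" for s
    proof (rule torus_coeff)
      fix \<zeta> :: "complex \<times> complex" assume "\<zeta> \<in> torus"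
      then show "((\<lambda>p. A s p * of_real (1/4) ^ tdeg p * bimonom p \<zeta>) has_sum f ((1/4) *\<^sub>R \<zeta>)) UNIV"
        using loc[of s "(1/4) *\<^sub>R \<zeta>"] that unfolding bimonom_scaleR by (auto simp: torus_def mult_ac)
    qed
    from this[OF r] this[of "1/2"] show ?thesis by simp
  qed
  have "((\<lambda>p. A (1/2) p * bimonom p z) has_sum f z) UNIV" if z: "z \<in> bidisk" for z
  proof -
    \<comment> \<open>The maximum with 1/2 keeps \<open>r\<close> in the range where the
      coefficients are known to be those of radius 1/2.\<close>
    obtain r where "max (1/2) (max (cmod (fst z)) (cmod (snd z))) < r" "r < 1"
      using dense[of "max (1/2) (max (cmod (fst z)) (cmod (snd z)))" 1] z by (auto simp: bidisk_def mem_Times_iff)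
    with loc[of r z] A[of r] show ?thesis by simp
  qed
  then show ?thesis unfolding has_bidisk_series_iff by blast
qed

section \<open>The Hardy space\<close>

lemma power_times_nat_bound:
  assumes "0 < r" "r < R"
  obtains K :: real where "0 \<le> K" "\<And>n. real n * r ^ (n - 1) \<le> K * R ^ n"
proof -
  have "(\<lambda>n. of_nat n * (r / R) ^ n) \<longlonglongrightarrow> 0"
    using assms by (intro powser_times_n_limit_0) auto
  then have "Bseq (\<lambda>n. of_nat n * (r / R) ^ n)"
    by (intro convergent_imp_Bseq convergentI)
  then obtain B where B: "B > 0" "\<And>n. norm (of_nat n * (r / R) ^ n) \<le> B"
    by (rule BseqE) blast
  show ?thesis
  proof (rule that[of "B / r"])
    fix n
    have "real n * r ^ n \<le> B * R ^ n"
      using B(2)[of n] assms by (simp add: power_divide field_simps)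
    then have "real n * r ^ (n - 1) * r \<le> B * R ^ n"
      by (cases n) (auto simp: mult_ac)
    with assms show "real n * r ^ (n - 1) \<le> B / r * R ^ n"
      by (simp add: field_simps)
  qed (use B assms in auto)
qed

text \<open>On the polydisk of radius \<open>r\<close> both series of partial derivatives are
  majorized by a constant times the series of moduli at radius \<open>R > r\<close>, so they
  converge uniformly and the sum may be differentiated term by term.\<close>

lemma bidisk_series_has_derivative:
  assumes f: "has_bidisk_series f a" and r: "0 < r" "r < 1"
    and z: "cmod (fst z) < r" "cmod (snd z) < r"
  shows "\<exists>c d. (f has_derivative (\<lambda>h. c * fst h + d * snd h)) (at z)"
proof -
  define S :: "(complex \<times> complex) set" where "S = ball 0 r \<times> ball 0 r"
  have S: "convex S" "open S" "z \<in> S" "S \<subseteq> bidisk"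
    using z r by (auto simp: S_def open_Times convex_Times bidisk_def mem_Times_iff)
  obtain R where R: "r < R" "R < 1" using dense r by blast
  \<comment> \<open>The factor that differentiation brings down is absorbed by enlarging the radius
    from \<open>r\<close> to \<open>R\<close>; one constant serves both variables.\<close>
  obtain K where K: "0 \<le> K" "\<And>n. real n * r ^ (n - 1) \<le> K * R ^ n"
    using power_times_nat_bound[OF r(1) R(1)] by blast
  define p where "p n = prod_decode n" for n
  define F where "F n x = a (p n) * bimonom (p n) x" for n x
  \<comment> \<open>For exponent 0 the truncated subtraction gives the wrong power, but the factor
    \<open>of_nat 0\<close> removes the term. The same holds for \<open>B\<close>.\<close>
  define A where "A n x = a (p n) * (of_nat (fst (p n)) * fst x ^ (fst (p n) - 1) * snd x ^ snd (p n))"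
    for n and x :: "complex \<times> complex"
  define B where "B n x = a (p n) * (fst x ^ fst (p n) * (of_nat (snd (p n)) * snd x ^ (snd (p n) - 1)))"
    for n and x :: "complex \<times> complex"
  define M where "M n = cmod (a (p n)) * (K * R ^ tdeg (p n))" for n
  have le: "real m * u ^ (m - 1) * v ^ n \<le> K * R ^ (m + n)"
    if "0 \<le> u" "u \<le> r" "0 \<le> v" "v \<le> r" for u v m n
  proof -
    have "real m * u ^ (m - 1) * v ^ n \<le> real m * r ^ (m - 1) * r ^ n"
      using that r by (intro mult_mono power_mono) auto
    also have "\<dots> \<le> (K * R ^ m) * R ^ n"
      using r R K(2)[of m] K(1) by (intro mult_mono[of "real m * r ^ (m - 1)"] power_mono) auto
    finally show ?thesis by (simp add: power_add)
  qed
  have MA: "cmod (A n x) \<le> M n" if "x \<in> S" for n x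
    using le[of "cmod (fst x)" "cmod (snd x)" "fst (p n)" "snd (p n)"] that
    by (auto simp: A_def M_def S_def norm_mult norm_power intro!: mult_left_mono)
  have MB: "cmod (B n x) \<le> M n" if "x \<in> S" for n x
    using le[of "cmod (snd x)" "cmod (fst x)" "snd (p n)" "fst (p n)"] that
    by (auto simp: B_def M_def S_def norm_mult norm_power mult.commute[of "cmod _ ^ fst (p n)"] add.commute
        intro!: mult_left_mono)
  \<comment> \<open>The series converges at the point \<open>(R, R)\<close> of the bidisk, hence
    absolutely there.\<close>
  have "(\<lambda>q. cmod (a q * of_real R ^ tdeg q)) summable_on UNIV"
    using has_sum_on_torus[OF f, of R "(1,1)"] r R
    by (intro abs_summable_at_torus[OF one_in_torus]) (auto simp: one_in_torus)
  then have "(\<lambda>q. K * cmod (a q * of_real R ^ tdeg q)) summable_on UNIV"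
    by (rule summable_on_cmult_right)
  then have "M summable_on UNIV"
    using summable_on_reindex_bij_betw[OF bij_prod_decode, of "\<lambda>q. K * cmod (a q * of_real R ^ tdeg q)"] r R
    by (simp add: M_def[abs_def] p_def norm_mult norm_power mult_ac)
  then have M: "summable M" by (rule summable_on_imp_summable)
  have uA: "uniform_limit S (\<lambda>n x. \<Sum>i<n. A i x) (\<lambda>x. \<Sum>i. A i x) sequentially"
    using MA M by (rule Weierstrass_m_test)
  have uB: "uniform_limit S (\<lambda>n x. \<Sum>i<n. B i x) (\<lambda>x. \<Sum>i. B i x) sequentially"
    using MB M by (rule Weierstrass_m_test)
  define G where "G x h = (\<Sum>i. A i x) * fst h + (\<Sum>i. B i x) * snd h" for x h
  have sF: "(\<lambda>n. F n x) sums f x" if "x \<in> S" for x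
    using f S that has_sum_reindex_bij_betw[OF bij_prod_decode, of "\<lambda>q. a q * bimonom q x"]
    by (intro has_sum_imp_sums) (auto simp: F_def p_def has_bidisk_series_iff)
  have "\<exists>g. \<forall>x\<in>S. (\<lambda>n. F n x) sums g x \<and> (g has_derivative G x) (at x within S)"
  proof (rule has_derivative_series[where x = z and f = F])
    show "convex S" "z \<in> S" "(\<lambda>n. F n z) sums f z" using S sF by auto
    fix n x
    show "(F n has_derivative (\<lambda>h. A n x * fst h + B n x * snd h)) (at x within S)"
      unfolding F_def bimonom_def A_def B_def
      by (rule derivative_eq_intros refl)+ (auto simp: algebra_simps)
  next
    fix e :: real assume e: "e > 0"
    have "\<forall>\<^sub>F n in sequentially. \<forall>x\<in>S. dist (\<Sum>i<n. A i x) (\<Sum>i. A i x) < e/2"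
      "\<forall>\<^sub>F n in sequentially. \<forall>x\<in>S. dist (\<Sum>i<n. B i x) (\<Sum>i. B i x) < e/2"
      using uniform_limitD[OF uA, of "e/2"] uniform_limitD[OF uB, of "e/2"] e by auto
    then show "\<forall>\<^sub>F n in sequentially. \<forall>x\<in>S. \<forall>h.
       norm ((\<Sum>i<n. A i x * fst h + B i x * snd h) - G x h) \<le> e * norm h"
    proof eventually_elim
      case (elim n)
      show ?case
      proof (intro ballI allI)
        fix x and h :: "complex \<times> complex" assume x: "x \<in> S"
        have "(\<Sum>i<n. A i x * fst h + B i x * snd h) - G x h =
          ((\<Sum>i<n. A i x) - (\<Sum>i. A i x)) * fst h + ((\<Sum>i<n. B i x) - (\<Sum>i. B i x)) * snd h"
          by (simp add: G_def sum.distrib left_diff_distrib flip: sum_distrib_right)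
        also have "norm \<dots> \<le> dist (\<Sum>i<n. A i x) (\<Sum>i. A i x) * norm (fst h) +
           dist (\<Sum>i<n. B i x) (\<Sum>i. B i x) * norm (snd h)"
          unfolding dist_norm norm_mult[symmetric] by (rule norm_triangle_ineq)
        also have "\<dots> \<le> e/2 * norm h + e/2 * norm h"
          using elim x e norm_fst_le[of "fst h" "snd h"] norm_snd_le[of "snd h" "fst h"]
          by (intro add_mono mult_mono) (auto intro: less_imp_le)
        finally show "norm ((\<Sum>i<n. A i x * fst h + B i x * snd h) - G x h) \<le> e * norm h" by simp
      qed
    qed
  qed
  then obtain g where g: "\<And>x. x \<in> S \<Longrightarrow> (\<lambda>n. F n x) sums g x"
      "\<And>x. x \<in> S \<Longrightarrow> (g has_derivative G x) (at x within S)" by blast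
  have "(g has_derivative G z) (at z)"
    using g(2)[OF S(3)] unfolding at_within_open[OF S(3,2)] .
  then have "(f has_derivative G z) (at z)"
    by (rule has_derivative_transform_within_open[OF _ S(2,3)]) (rule sums_unique2[OF g(1) sF])
  then show ?thesis unfolding G_def[abs_def] by (intro exI)
qed

theorem bidisk_series_imp_holomorphic:
  assumes "has_bidisk_series f a"
  shows "holomorphic_on_bidisk f"
  unfolding holomorphic_on_bidisk_def
proof
  fix z :: "complex \<times> complex" assume "z \<in> bidisk"
  then obtain r where "max 0 (max (cmod (fst z)) (cmod (snd z))) < r" "r < 1"
    using dense[of "max 0 (max (cmod (fst z)) (cmod (snd z)))" 1] by (auto simp: bidisk_def mem_Times_iff)
  then show "\<exists>c d. (f has_derivative (\<lambda>h. c * fst h + d * snd h)) (at z)"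
    by (intro bidisk_series_has_derivative[OF assms, of r]) auto
qed

section \<open>Square-summable coefficients and the inner product\<close>

abbreviation square_summable :: "(nat \<times> nat \<Rightarrow> complex) \<Rightarrow> bool" where
  "square_summable a \<equiv> (\<lambda>p. (cmod (a p))\<^sup>2) summable_on UNIV"

lemma norm_add_square_le: "(cmod (x + y))\<^sup>2 \<le> 2 * (cmod x)\<^sup>2 + 2 * (cmod y)\<^sup>2"
proof -
  have "(cmod (x + y))\<^sup>2 \<le> (cmod x + cmod y)\<^sup>2"
    by (intro power_mono norm_triangle_ineq) auto
  also have "\<dots> \<le> 2 * (cmod x)\<^sup>2 + 2 * (cmod y)\<^sup>2"
    using zero_le_power2[of "cmod x - cmod y"] by (simp add: power2_eq_square algebra_simps)
  finally show ?thesis .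
qed

lemma square_summable_add:
  assumes "square_summable a" "square_summable b"
  shows "square_summable (\<lambda>p. a p + b p)"
proof (rule summable_on_comparison_test)
  show "(\<lambda>p. 2 * (cmod (a p))\<^sup>2 + 2 * (cmod (b p))\<^sup>2) summable_on UNIV"
    using assms by (intro summable_on_add summable_on_cmult_right)
qed (auto intro: norm_add_square_le)

lemma square_summable_cmult: "square_summable a \<Longrightarrow> square_summable (\<lambda>p. c * a p)"
  by (simp add: norm_mult power_mult_distrib summable_on_cmult_right)

lemma square_summable_mult:
  assumes "square_summable a" "square_summable b"
  shows "(\<lambda>p. a p * cnj (b p)) summable_on UNIV"
  unfolding summable_on_iff_abs_summable_on_complex
  by (rule abs_summable_product) (use assms in \<open>simp_all add: norm_mult power2_eq_square\<close>)

text \<open>Each coefficient is at most the root of the square sum, and bounded coefficients are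
  dominated by a double geometric series at every point of the bidisk.\<close>

lemma square_summable_bidisk_series:
  assumes a: "square_summable a"
  shows "has_bidisk_series (\<lambda>z. if z \<in> bidisk then \<Sum>\<^sub>\<infinity>p. a p * bimonom p z else 0) a"
  unfolding has_bidisk_series_iff
proof
  fix z :: "complex \<times> complex" assume z: "z \<in> bidisk"
  define C where "C = sqrt (\<Sum>\<^sub>\<infinity>p. (cmod (a p))\<^sup>2)"
  have C: "cmod (a p) \<le> C" for p
    using finite_sum_le_infsum[OF a, of "{p}"] unfolding C_def by (intro real_le_rsqrt) auto
  have "(\<lambda>p. cmod (a p * bimonom p z)) summable_on UNIV"
  proof (rule Infinite_Sum.abs_summable_on_comparison_test')
    show "(\<lambda>p. C * (cmod (fst z) ^ fst p * cmod (snd z) ^ snd p)) summable_on UNIV"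
      using z by (intro summable_on_cmult_right summable_bimonom) (auto simp: bidisk_def mem_Times_iff)
    show "cmod (a p * bimonom p z) \<le> C * (cmod (fst z) ^ fst p * cmod (snd z) ^ snd p)" for p
      using C by (simp add: bimonom_def norm_mult norm_power mult_right_mono)
  qed
  then have "(\<lambda>p. a p * bimonom p z) summable_on UNIV"
    by (rule abs_summable_summable)
  then show "((\<lambda>p. a p * bimonom p z) has_sum
      (if z \<in> bidisk then \<Sum>\<^sub>\<infinity>p. a p * bimonom p z else 0)) UNIV"
    using z by simp
qed

lemma hardy2_exists:
  assumes "square_summable a"
  obtains f where "f \<in> hardy2" "has_bidisk_series f a" "bidisk_coeff f = a"
proof -
  note s = square_summable_bidisk_series[OF assms]
  show ?thesis
    by (rule that[OF _ s bidisk_coeff_eq[OF s]]) (use assms s in \<open>auto simp: hardy2_def\<close>)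
qed

lemma hardy2D:
  assumes "f \<in> hardy2"
  shows "has_bidisk_series f (bidisk_coeff f)" "square_summable (bidisk_coeff f)"
    "z \<notin> bidisk \<Longrightarrow> f z = 0" "holomorphic_on_bidisk f"
proof -
  obtain a where a: "has_bidisk_series f a" "square_summable a" using assms by (auto simp: hardy2_def)
  then have "bidisk_coeff f = a" by (intro bidisk_coeff_eq)
  with a show "has_bidisk_series f (bidisk_coeff f)" "square_summable (bidisk_coeff f)" by auto
  show "z \<notin> bidisk \<Longrightarrow> f z = 0" using assms unfolding hardy2_def by blast
  show "holomorphic_on_bidisk f" by (rule bidisk_series_imp_holomorphic) fact
qed

lemma hardy2I:
  assumes "has_bidisk_series f a" "square_summable a" "\<And>z. z \<notin> bidisk \<Longrightarrow> f z = 0"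
  shows "f \<in> hardy2"
  using assms by (auto simp: hardy2_def)

text \<open>Off the bidisk both functions are 0 by normalization, so the coefficients decide
  equality of total functions.\<close>

lemma hardy2_eqI:
  assumes "f \<in> hardy2" "g \<in> hardy2" "bidisk_coeff f = bidisk_coeff g"
  shows "f = g"
proof
  fix z
  show "f z = g z"
    using hardy2D(1)[OF assms(1)] hardy2D(1)[OF assms(2)] hardy2D(3)[OF assms(1)] hardy2D(3)[OF assms(2)] assms(3)
    by (cases "z \<in> bidisk") (auto simp: has_bidisk_series_iff intro: has_sum_unique)
qed

lemma has_bidisk_series_add:
  "has_bidisk_series f a \<Longrightarrow> has_bidisk_series g b \<Longrightarrow>
   has_bidisk_series (\<lambda>z. f z + g z) (\<lambda>p. a p + b p)"
  by (auto simp: has_bidisk_series_iff distrib_right intro!: has_sum_add)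

lemma has_bidisk_series_cmult:
  "has_bidisk_series f a \<Longrightarrow> has_bidisk_series (\<lambda>z. c * f z) (\<lambda>p. c * a p)"
  by (auto simp: has_bidisk_series_iff mult.assoc intro!: has_sum_cmult_right)

lemma hardy2_add:
  assumes "f \<in> hardy2" "g \<in> hardy2"
  shows "(\<lambda>z. f z + g z) \<in> hardy2"
    and "bidisk_coeff (\<lambda>z. f z + g z) = (\<lambda>p. bidisk_coeff f p + bidisk_coeff g p)"
proof -
  note s = has_bidisk_series_add[OF hardy2D(1)[OF assms(1)] hardy2D(1)[OF assms(2)]]
  show "(\<lambda>z. f z + g z) \<in> hardy2"
    using s by (rule hardy2I) (use assms in \<open>auto intro: square_summable_add hardy2D simp: hardy2D\<close>)
  show "bidisk_coeff (\<lambda>z. f z + g z) = (\<lambda>p. bidisk_coeff f p + bidisk_coeff g p)"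
    using s by (rule bidisk_coeff_eq)
qed

lemma hardy2_cmult:
  assumes "f \<in> hardy2"
  shows "(\<lambda>z. c * f z) \<in> hardy2"
    and "bidisk_coeff (\<lambda>z. c * f z) = (\<lambda>p. c * bidisk_coeff f p)"
proof -
  note s = has_bidisk_series_cmult[OF hardy2D(1)[OF assms], of c]
  show "(\<lambda>z. c * f z) \<in> hardy2"
    using s by (rule hardy2I) (use assms in \<open>auto intro: square_summable_cmult hardy2D simp: hardy2D\<close>)
  show "bidisk_coeff (\<lambda>z. c * f z) = (\<lambda>p. c * bidisk_coeff f p)"
    using s by (rule bidisk_coeff_eq)
qed

lemma hardy2_diff:
  assumes "f \<in> hardy2" "g \<in> hardy2"
  shows "(\<lambda>z. f z - g z) \<in> hardy2"
    and "bidisk_coeff (\<lambda>z. f z - g z) = (\<lambda>p. bidisk_coeff f p - bidisk_coeff g p)"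
  using hardy2_add[OF assms(1) hardy2_cmult(1)[OF assms(2), of "-1"]] hardy2_cmult(2)[OF assms(2), of "-1"]
  by simp_all

lemma hardy2_zero: "(\<lambda>z. 0) \<in> hardy2"
  by (rule hardy2I[of _ "\<lambda>_. 0"]) (auto simp: has_bidisk_series_iff)

lemma hardy_inner_has_sum:
  assumes "f \<in> hardy2" "g \<in> hardy2"
  shows "((\<lambda>p. bidisk_coeff f p * cnj (bidisk_coeff g p)) has_sum hardy_inner f g) UNIV"
  unfolding hardy_inner_def using square_summable_mult assms by (intro has_sum_infsum) (auto intro: hardy2D)

lemma hardy_inner_eqI:
  assumes "f \<in> hardy2" "g \<in> hardy2"
    and "((\<lambda>p. bidisk_coeff f p * cnj (bidisk_coeff g p)) has_sum s) UNIV"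
  shows "hardy_inner f g = s"
  using hardy_inner_has_sum[OF assms(1,2)] assms(3) by (rule has_sum_unique)

lemma hardy_inner_add_left:
  assumes "f \<in> hardy2" "g \<in> hardy2" "h \<in> hardy2"
  shows "hardy_inner (\<lambda>z. f z + g z) h = hardy_inner f h + hardy_inner g h"
  using hardy_inner_has_sum[OF assms(1,3)] hardy_inner_has_sum[OF assms(2,3)]
  by (intro hardy_inner_eqI hardy2_add assms)
     (simp add: hardy2_add(2)[OF assms(1,2)] distrib_right has_sum_add)

lemma hardy_inner_cmult_left:
  assumes "f \<in> hardy2" "h \<in> hardy2"
  shows "hardy_inner (\<lambda>z. c * f z) h = c * hardy_inner f h"
  using hardy_inner_has_sum[OF assms]
  by (intro hardy_inner_eqI hardy2_cmult assms)
     (simp add: hardy2_cmult(2)[OF assms(1)] mult.assoc has_sum_cmult_right)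

lemma hardy_inner_commute:
  assumes "f \<in> hardy2" "g \<in> hardy2"
  shows "hardy_inner g f = cnj (hardy_inner f g)"
  using hardy_inner_has_sum[OF assms, THEN has_sum_cnj_iff[THEN iffD2]]
  by (intro hardy_inner_eqI assms) (simp add: mult.commute)

lemma hardy_inner_diff_left:
  assumes "f \<in> hardy2" "g \<in> hardy2" "h \<in> hardy2"
  shows "hardy_inner (\<lambda>z. f z - g z) h = hardy_inner f h - hardy_inner g h"
  using hardy_inner_add_left[OF assms(1) hardy2_cmult(1)[OF assms(2), of "-1"] assms(3)]
    hardy_inner_cmult_left[OF assms(2,3), of "-1"] by simp

lemma hardy_inner_add_right:
  assumes "f \<in> hardy2" "g \<in> hardy2" "h \<in> hardy2"
  shows "hardy_inner h (\<lambda>z. f z + g z) = hardy_inner h f + hardy_inner h g"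
  using hardy_inner_add_left[OF assms] hardy_inner_commute[OF hardy2_add(1)[OF assms(1,2)] assms(3)]
    hardy_inner_commute[OF assms(1,3)] hardy_inner_commute[OF assms(2,3)] by simp

lemma hardy_inner_self_has_sum:
  assumes "f \<in> hardy2"
  shows "((\<lambda>p. (cmod (bidisk_coeff f p))\<^sup>2) has_sum Re (hardy_inner f f)) UNIV"
  using has_sum_Re[OF hardy_inner_has_sum[OF assms assms]]
  by (simp add: complex_mult_cnj cmod_power2)

lemma hardy_inner_self_eq_0:
  assumes "f \<in> hardy2" "hardy_inner f f = 0"
  shows "f = (\<lambda>z. 0)"
proof (rule hardy2_eqI[OF assms(1) hardy2_zero])
  have "(cmod (bidisk_coeff f p))\<^sup>2 = 0" for p
    using nonneg_has_sum_le_0D[OF hardy_inner_self_has_sum[OF assms(1)], of p] assms(2) by simp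
  moreover have "bidisk_coeff (\<lambda>z. 0) = (\<lambda>_. 0)"
    by (rule bidisk_coeff_eq) (auto simp: has_bidisk_series_iff)
  ultimately show "bidisk_coeff f = bidisk_coeff (\<lambda>z. 0)" by auto
qed

lemma hardy_inner_disjoint_support:
  assumes "\<And>p. bidisk_coeff f p = 0 \<or> bidisk_coeff g p = 0"
  shows "hardy_inner f g = 0"
proof -
  have "(\<lambda>p. bidisk_coeff f p * cnj (bidisk_coeff g p)) = (\<lambda>_. 0)" using assms by force
  then show ?thesis unfolding hardy_inner_def by simp
qed

section \<open>Integral means of dilations and bounded multipliers\<close>

lemma parseval_dilation_norm:
  assumes f: "has_bidisk_series f a" and r: "0 \<le> r" "r < 1"
  shows "((\<lambda>p. (cmod (a p))\<^sup>2 * r ^ (2 * tdeg p)) has_sum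
     (LINT \<zeta>|torus_measure. (cmod (f (r *\<^sub>R \<zeta>)))\<^sup>2)) UNIV"
    and "integrable torus_measure (\<lambda>\<zeta>. (cmod (f (r *\<^sub>R \<zeta>)))\<^sup>2)"
proof -
  note P = torus_parseval_norm[OF has_sum_on_torus[OF f r]]
  have "(cmod (a p * of_real r ^ tdeg p))\<^sup>2 = (cmod (a p))\<^sup>2 * r ^ (2 * tdeg p)" for p
    using r by (simp only: norm_mult norm_power norm_of_real power_mult_distrib power_even_eq abs_of_nonneg)
  with P(1) show "((\<lambda>p. (cmod (a p))\<^sup>2 * r ^ (2 * tdeg p)) has_sum
     (LINT \<zeta>|torus_measure. (cmod (f (r *\<^sub>R \<zeta>)))\<^sup>2)) UNIV"
    by simp
qed (rule torus_parseval_norm(2)[OF has_sum_on_torus[OF f r]])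

text \<open>By Parseval, each finite sum of squared coefficients, weighted by powers of
  \<open>r\<close>, is at most an integral mean and hence at most \<open>C\<close>. Letting
  \<open>r\<close> tend to 1 in the finite sum removes the weights.\<close>

lemma hardy2_bounded_means:
  assumes hol: "holomorphic_on_bidisk f" and off: "\<And>z. z \<notin> bidisk \<Longrightarrow> f z = 0"
    and bd: "\<And>r. 0 \<le> r \<Longrightarrow> r < 1 \<Longrightarrow> (LINT \<zeta>|torus_measure. (cmod (f (r *\<^sub>R \<zeta>)))\<^sup>2) \<le> C"
  shows "f \<in> hardy2"
proof -
  obtain a where a: "has_bidisk_series f a" using holomorphic_imp_bidisk_series[OF hol] by blast
  have fin: "(\<Sum>p\<in>F. (cmod (a p))\<^sup>2) \<le> C" if F: "finite F" for F
  proof (rule tendsto_upperbound)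
    have "((\<lambda>r. \<Sum>p\<in>F. (cmod (a p))\<^sup>2 * r ^ (2 * tdeg p)) \<longlongrightarrow> (\<Sum>p\<in>F. (cmod (a p))\<^sup>2 * 1 ^ (2 * tdeg p))) (at_left (1::real))"
      by (intro tendsto_intros)
    then show "((\<lambda>r. \<Sum>p\<in>F. (cmod (a p))\<^sup>2 * r ^ (2 * tdeg p)) \<longlongrightarrow> (\<Sum>p\<in>F. (cmod (a p))\<^sup>2)) (at_left (1::real))"
      by simp
    have "\<forall>\<^sub>F r in at_left (1::real). r \<in> {0<..<1}"
      by (rule eventually_at_leftI[of 0]) auto
    then show "\<forall>\<^sub>F r in at_left (1::real). (\<Sum>p\<in>F. (cmod (a p))\<^sup>2 * r ^ (2 * tdeg p)) \<le> C"
    proof eventually_elim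
      case (elim r)
      then have "(\<Sum>p\<in>F. (cmod (a p))\<^sup>2 * r ^ (2 * tdeg p)) \<le> (LINT \<zeta>|torus_measure. (cmod (f (r *\<^sub>R \<zeta>)))\<^sup>2)"
        by (intro finite_sum_le_has_sum[OF parseval_dilation_norm(1)[OF a] F]) auto
      also have "\<dots> \<le> C" using elim by (intro bd) auto
      finally show ?case .
    qed
  qed simp
  have "square_summable a"
    by (rule nonneg_bdd_above_summable_on) (auto intro!: bdd_aboveI2[of _ _ C] fin)
  with a off show ?thesis by (intro hardy2I)
qed

text \<open>The coefficients of a product are convolutions and hard to estimate. The integral means
  of the dilations are easy: pointwise they cost a factor \<open>B\<^sup>2\<close>, and those of
  \<open>f\<close> are bounded by its norm.\<close>

lemma hardy2_mult_bounded:
  assumes psi: "holomorphic_on_bidisk \<psi>" "\<And>z. z \<in> bidisk \<Longrightarrow> cmod (\<psi> z) \<le> B" and f: "f \<in> hardy2"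
  shows "(\<lambda>z. \<psi> z * f z) \<in> hardy2"
proof (rule hardy2_bounded_means)
  note fD = hardy2D[OF f]
  show hol: "holomorphic_on_bidisk (\<lambda>z. \<psi> z * f z)"
    unfolding holomorphic_on_bidisk_def
  proof
    fix z assume z: "z \<in> bidisk"
    obtain a b where 1: "(\<psi> has_derivative (\<lambda>h. a * fst h + b * snd h)) (at z)"
      using psi(1) z unfolding holomorphic_on_bidisk_def by blast
    obtain c d where 2: "(f has_derivative (\<lambda>h. c * fst h + d * snd h)) (at z)"
      using fD(4) z unfolding holomorphic_on_bidisk_def by blast
    have "((\<lambda>z. \<psi> z * f z) has_derivative
        (\<lambda>h. (\<psi> z * c + a * f z) * fst h + (\<psi> z * d + b * f z) * snd h)) (at z)"
      by (rule has_derivative_eq_rhs[OF has_derivative_mult[OF 1 2]]) (auto simp: algebra_simps)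
    then show "\<exists>a b. ((\<lambda>z. \<psi> z * f z) has_derivative (\<lambda>h. a * fst h + b * snd h)) (at z)" by blast
  qed
  show "\<psi> z * f z = 0" if "z \<notin> bidisk" for z using fD(3)[OF that] by simp
  fix r :: real assume r: "0 \<le> r" "r < 1"
  \<comment> \<open>Parseval for this series supplies the integrability of the squared dilation of
    the product.\<close>
  obtain a where a: "has_bidisk_series (\<lambda>z. \<psi> z * f z) a" using holomorphic_imp_bidisk_series[OF hol] by blast
  have "(LINT \<zeta>|torus_measure. (cmod (\<psi> (r *\<^sub>R \<zeta>) * f (r *\<^sub>R \<zeta>)))\<^sup>2) \<le>
    (LINT \<zeta>|torus_measure. B\<^sup>2 * (cmod (f (r *\<^sub>R \<zeta>)))\<^sup>2)"
  proof (rule integral_mono)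
    show "integrable torus_measure (\<lambda>\<zeta>. (cmod (\<psi> (r *\<^sub>R \<zeta>) * f (r *\<^sub>R \<zeta>)))\<^sup>2)"
      using parseval_dilation_norm(2)[OF a r] .
    show "integrable torus_measure (\<lambda>\<zeta>. B\<^sup>2 * (cmod (f (r *\<^sub>R \<zeta>)))\<^sup>2)"
      using parseval_dilation_norm(2)[OF fD(1) r] by simp
    show "(cmod (\<psi> (r *\<^sub>R \<zeta>) * f (r *\<^sub>R \<zeta>)))\<^sup>2 \<le> B\<^sup>2 * (cmod (f (r *\<^sub>R \<zeta>)))\<^sup>2"
      if "\<zeta> \<in> space torus_measure" for \<zeta>
      using psi(2)[OF scaleR_torus_in_bidisk[of \<zeta> r]] that r
      by (auto simp: norm_mult power_mult_distrib intro!: mult_right_mono power_mono)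
  qed
  also have "\<dots> = B\<^sup>2 * (LINT \<zeta>|torus_measure. (cmod (f (r *\<^sub>R \<zeta>)))\<^sup>2)" by simp
  also have "\<dots> \<le> B\<^sup>2 * Re (hardy_inner f f)"
  proof (rule mult_left_mono)
    show "(LINT \<zeta>|torus_measure. (cmod (f (r *\<^sub>R \<zeta>)))\<^sup>2) \<le> Re (hardy_inner f f)"
      by (rule has_sum_mono[OF parseval_dilation_norm(1)[OF fD(1) r] hardy_inner_self_has_sum[OF f]])
         (use r in \<open>auto intro!: mult_left_le power_le_one\<close>)
  qed simp
  finally show "(LINT \<zeta>|torus_measure. (cmod (\<psi> (r *\<^sub>R \<zeta>) * f (r *\<^sub>R \<zeta>)))\<^sup>2) \<le> B\<^sup>2 * Re (hardy_inner f f)" .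
qed

section \<open>Multiplication by \<open>z\<^sub>1\<close> and functions of \<open>z\<^sub>2\<close>
  alone\<close>

lemma has_bidisk_series_mult_fst:
  assumes "has_bidisk_series f a"
  shows "has_bidisk_series (\<lambda>z. fst z * f z) (\<lambda>p. if fst p = 0 then 0 else a (fst p - 1, snd p))"
  unfolding has_bidisk_series_iff
proof
  fix z :: "complex \<times> complex" assume "z \<in> bidisk"
  then have "((\<lambda>p. fst z * (a p * bimonom p z)) has_sum fst z * f z) UNIV"
    using assms by (intro has_sum_cmult_right) (auto simp: has_bidisk_series_iff)
  \<comment> \<open>Raising the first exponent by one is a bijection onto the pairs with positive
    first entry; on the remaining pairs the new coefficient is 0.\<close>
  also have "?this \<longleftrightarrow> ((\<lambda>p. (if fst p = 0 then 0 else a (fst p - 1, snd p)) * bimonom p z) has_sum fst z * f z)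
      {p. fst p \<noteq> 0}"
    by (rule has_sum_reindex_bij_witness[of _ "\<lambda>p. (fst p - 1, snd p)" "\<lambda>p. (Suc (fst p), snd p)"])
       (auto simp: bimonom_def)
  also have "\<dots> \<longleftrightarrow> ((\<lambda>p. (if fst p = 0 then 0 else a (fst p - 1, snd p)) * bimonom p z) has_sum fst z * f z) UNIV"
    by (rule has_sum_cong_neutral) auto
  finally show "((\<lambda>p. (if fst p = 0 then 0 else a (fst p - 1, snd p)) * bimonom p z) has_sum fst z * f z) UNIV" .
qed

lemma has_bidisk_series_snd_iff:
  assumes "\<And>p. fst p \<noteq> 0 \<Longrightarrow> a p = 0"
  shows "((\<lambda>p. a p * bimonom p z) has_sum s) UNIV \<longleftrightarrow> ((\<lambda>n. a (0, n) * snd z ^ n) has_sum s) UNIV"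
proof -
  have "((\<lambda>n. a (0, n) * snd z ^ n) has_sum s) UNIV \<longleftrightarrow> ((\<lambda>p. a p * bimonom p z) has_sum s) {p. fst p = 0}"
    by (rule has_sum_reindex_bij_witness[of _ snd "\<lambda>n. (0, n)"]) (auto simp: bimonom_def)
  also have "\<dots> \<longleftrightarrow> ((\<lambda>p. a p * bimonom p z) has_sum s) UNIV"
    using assms by (intro has_sum_cong_neutral) auto
  finally show ?thesis by simp
qed

lemma summable_snd_iff:
  fixes u :: "nat \<times> nat \<Rightarrow> real"
  assumes "\<And>p. 0 \<le> u p" "\<And>p. fst p \<noteq> 0 \<Longrightarrow> u p = 0"
  shows "u summable_on UNIV \<longleftrightarrow> summable (\<lambda>n. u (0, n))"
proof -
  have "(\<lambda>n. u (0, n)) summable_on UNIV \<longleftrightarrow> u summable_on {p. fst p = 0}"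
    by (rule summable_on_reindex_bij_witness[of _ snd "\<lambda>n. (0, n)"]) auto
  also have "\<dots> \<longleftrightarrow> u summable_on UNIV"
    using assms by (intro summable_on_cong_neutral) auto
  finally show ?thesis using assms by (simp add: summable_on_UNIV_nonneg_real_iff)
qed

text \<open>With this condition on coefficients, closure under linear operations and orthogonality
  to multiples of \<open>z\<^sub>1\<close> can be read off.\<close>

lemma hardy_z2_iff:
  "f \<in> hardy_z2 \<longleftrightarrow> f \<in> hardy2 \<and> (\<forall>p. fst p \<noteq> 0 \<longrightarrow> bidisk_coeff f p = 0)"
proof
  assume "f \<in> hardy_z2"
  then obtain g b where f: "f = (\<lambda>z. if z \<in> bidisk then g (snd z) else 0)"
    and b: "summable (\<lambda>n. (cmod (b n))\<^sup>2)" and g: "\<And>w. w \<in> ball 0 1 \<Longrightarrow> (\<lambda>n. b n * w ^ n) sums g w"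
    by (auto simp: hardy_z2_def hardy_disk_def)
  define a :: "nat \<times> nat \<Rightarrow> complex" where "a p = (if fst p = 0 then b (snd p) else 0)" for p
  have s: "has_bidisk_series f a"
    unfolding has_bidisk_series_iff
  proof
    fix z assume z: "z \<in> bidisk"
    then have w: "snd z \<in> ball 0 1" by (auto simp: bidisk_def)
    \<comment> \<open>\<open>hardy_disk\<close> only provides convergence in the order of exponents.
      Convergence at a point of larger modulus makes it absolute at \<open>snd z\<close>, as
      \<open>has_sum\<close> requires.\<close>
    obtain s where s: "cmod (snd z) < s" "s < 1" using dense[of "cmod (snd z)" 1] w by auto
    then have "of_real s \<in> ball (0::complex) 1"
      using norm_ge_zero[of "snd z"] by (simp del: norm_ge_zero)
    then have "summable (\<lambda>n. b n * of_real s ^ n)" using g by (blast intro: sums_summable)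
    then have "summable (\<lambda>n. cmod (b n * snd z ^ n))"
      by (rule powser_insidea) (use s norm_ge_zero[of "snd z"] in auto)
    then have "((\<lambda>n. b n * snd z ^ n) has_sum f z) UNIV"
      using g[OF w] z by (intro norm_summable_imp_has_sum) (auto simp: f)
    then show "((\<lambda>p. a p * bimonom p z) has_sum f z) UNIV"
      by (subst has_bidisk_series_snd_iff) (auto simp: a_def)
  qed
  moreover have "square_summable a"
    using b by (subst summable_snd_iff) (auto simp: a_def)
  ultimately have "f \<in> hardy2" by (rule hardy2I) (auto simp: f)
  then show "f \<in> hardy2 \<and> (\<forall>p. fst p \<noteq> 0 \<longrightarrow> bidisk_coeff f p = 0)"
    using bidisk_coeff_eq[OF s] by (auto simp: a_def)
next
  assume "f \<in> hardy2 \<and> (\<forall>p. fst p \<noteq> 0 \<longrightarrow> bidisk_coeff f p = 0)"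
  then have f: "f \<in> hardy2" and 0: "\<forall>p. fst p \<noteq> 0 \<longrightarrow> bidisk_coeff f p = 0" by auto
  note fD = hardy2D[OF f]
  have s: "((\<lambda>n. bidisk_coeff f (0, n) * snd z ^ n) has_sum f z) UNIV" if "z \<in> bidisk" for z
    using fD(1) that 0 by (subst has_bidisk_series_snd_iff[symmetric]) (auto simp: has_bidisk_series_iff)
  have "(\<lambda>w. f (0, w)) \<in> hardy_disk"
    unfolding hardy_disk_def
  proof (intro CollectI exI conjI ballI)
    show "summable (\<lambda>n. (cmod (bidisk_coeff f (0, n)))\<^sup>2)"
      using fD(2) 0 by (subst summable_snd_iff[symmetric]) auto
    show "(\<lambda>n. bidisk_coeff f (0, n) * w ^ n) sums f (0, w)" if "w \<in> ball 0 1" for w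
      using s[of "(0, w)"] that by (intro has_sum_imp_sums) (auto simp: bidisk_def)
  qed
  moreover have "f = (\<lambda>z. if z \<in> bidisk then f (0, snd z) else 0)"
  proof
    fix z
    show "f z = (if z \<in> bidisk then f (0, snd z) else 0)"
      using s[of z] s[of "(0, snd z)"] fD(3) by (auto simp: bidisk_def intro: has_sum_unique)
  qed
  ultimately show "f \<in> hardy_z2"
    unfolding hardy_z2_def by (intro CollectI exI[of _ "\<lambda>w. f (0, w)"]) simp
qed

lemma hardy2_mult_fst:
  assumes "f \<in> hardy2"
  shows "(\<lambda>z. fst z * f z) \<in> hardy2"
    and "bidisk_coeff (\<lambda>z. fst z * f z) = (\<lambda>p. if fst p = 0 then 0 else bidisk_coeff f (fst p - 1, snd p))"
proof -
  note s = has_bidisk_series_mult_fst[OF hardy2D(1)[OF assms]]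
  show "(\<lambda>z. fst z * f z) \<in> hardy2"
  proof (rule hardy2_mult_bounded[OF _ _ assms])
    show "holomorphic_on_bidisk fst"
      unfolding holomorphic_on_bidisk_def
      by (intro ballI exI[of _ 1] exI[of _ 0]) (auto intro!: derivative_eq_intros)
    show "cmod (fst z) \<le> 1" if "z \<in> bidisk" for z using that by (auto simp: bidisk_def)
  qed
  show "bidisk_coeff (\<lambda>z. fst z * f z) = (\<lambda>p. if fst p = 0 then 0 else bidisk_coeff f (fst p - 1, snd p))"
    by (rule bidisk_coeff_eq[OF s])
qed

lemma hardy_inner_z2_mult_fst:
  assumes "f \<in> hardy_z2" "h \<in> hardy2"
  shows "hardy_inner f (\<lambda>z. fst z * h z) = 0"
  using assms by (intro hardy_inner_disjoint_support) (auto simp: hardy_z2_iff hardy2_mult_fst(2))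

text \<open>This is \<open>f = f (0, z\<^sub>2) + z\<^sub>1 B\<^sub>1 f\<close>, with the backward
  shift \<open>B\<^sub>1\<close>. Selecting and shifting coefficients puts both parts in
  \<open>H\<^sup>2\<close> at once and needs no separate care at \<open>z\<^sub>1 = 0\<close>. It is
  used both to show that a function depends on \<open>z\<^sub>2\<close> only and to divide \<phi> by
  \<open>z\<^sub>1\<close>.\<close>

lemma hardy2_split_fst:
  assumes "f \<in> hardy2"
  obtains f0 g where "f0 \<in> hardy_z2" "g \<in> hardy2" "f = (\<lambda>z. f0 z + fst z * g z)"
proof -
  let ?a = "bidisk_coeff f"
  have a: "square_summable ?a" by (rule hardy2D(2)[OF assms])
  have "square_summable (\<lambda>p. if fst p = 0 then ?a p else 0)"
    by (rule summable_on_comparison_test[OF a]) auto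
  then obtain f0 where f0: "f0 \<in> hardy2" "bidisk_coeff f0 = (\<lambda>p. if fst p = 0 then ?a p else 0)"
    by (rule hardy2_exists)
  have "inj (\<lambda>p::nat\<times>nat. (Suc (fst p), snd p))" by (auto simp: inj_def prod_eq_iff)
  moreover have "(\<lambda>p. (cmod (?a p))\<^sup>2) summable_on range (\<lambda>p. (Suc (fst p), snd p))"
    by (rule summable_on_subset_banach[OF a]) auto
  ultimately have "square_summable (\<lambda>p. ?a (Suc (fst p), snd p))"
    by (simp add: summable_on_reindex o_def)
  then obtain g where g: "g \<in> hardy2" "bidisk_coeff g = (\<lambda>p. ?a (Suc (fst p), snd p))"
    by (rule hardy2_exists)
  show ?thesis
  proof (rule that)
    show "f0 \<in> hardy_z2" using f0 by (auto simp: hardy_z2_iff)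
    show "g \<in> hardy2" by fact
    note m = hardy2_mult_fst[OF g(1)]
    show "f = (\<lambda>z. f0 z + fst z * g z)"
      by (rule hardy2_eqI[OF assms hardy2_add(1)[OF f0(1) m(1)]])
         (auto simp: hardy2_add(2)[OF f0(1) m(1)] m(2) f0(2) g(2) fun_eq_iff)
  qed
qed

section \<open>Boundary values\<close>

lemma L2_measurable: "g \<in> L2 M \<Longrightarrow> g \<in> borel_measurable M"
  by (simp add: L2_def)

lemma L2_iff_nn_integral:
  "g \<in> L2 M \<longleftrightarrow> g \<in> borel_measurable M \<and> (\<integral>\<^sup>+x. ennreal ((cmod (g x))\<^sup>2) \<partial>M) < \<infinity>"
  by (auto simp: L2_def integrable_iff_bounded)

lemma nn_integral_L2:
  assumes "g \<in> L2 M"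
  shows "(\<integral>\<^sup>+x. ennreal ((cmod (g x))\<^sup>2) \<partial>M) = ennreal (LINT x|M. (cmod (g x))\<^sup>2)"
  using assms by (intro nn_integral_eq_integral) (auto simp: L2_def)

text \<open>A substitute for the triangle inequality that avoids square roots of extended reals; the
  constant 2 is harmless where the right-hand side tends to 0 or only has to be finite.\<close>

lemma nn_integral_square_add_le:
  assumes [measurable]: "u \<in> borel_measurable M" "v \<in> borel_measurable M"
  shows "(\<integral>\<^sup>+x. ennreal ((cmod (u x + v x))\<^sup>2) \<partial>M) \<le>
    2 * (\<integral>\<^sup>+x. ennreal ((cmod (u x))\<^sup>2) \<partial>M) + 2 * (\<integral>\<^sup>+x. ennreal ((cmod (v x))\<^sup>2) \<partial>M)"
proof -
  have "(\<integral>\<^sup>+x. ennreal ((cmod (u x + v x))\<^sup>2) \<partial>M) \<le>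
    (\<integral>\<^sup>+x. 2 * ennreal ((cmod (u x))\<^sup>2) + 2 * ennreal ((cmod (v x))\<^sup>2) \<partial>M)"
  proof (rule nn_integral_mono)
    fix x
    have "2 * ennreal ((cmod (u x))\<^sup>2) + 2 * ennreal ((cmod (v x))\<^sup>2) =
      ennreal (2 * (cmod (u x))\<^sup>2 + 2 * (cmod (v x))\<^sup>2)"
      by (simp add: ennreal_mult)
    then show "ennreal ((cmod (u x + v x))\<^sup>2) \<le> 2 * ennreal ((cmod (u x))\<^sup>2) + 2 * ennreal ((cmod (v x))\<^sup>2)"
      using norm_add_square_le by (simp only: ennreal_leI)
  qed
  then show ?thesis by (simp add: nn_integral_add nn_integral_cmult)
qed

lemma L2_add: "u \<in> L2 M \<Longrightarrow> v \<in> L2 M \<Longrightarrow> (\<lambda>x. u x + v x) \<in> L2 M"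
  using nn_integral_square_add_le[of u M v]
  by (auto simp: L2_iff_nn_integral ennreal_mult_less_top intro: le_less_trans)

lemma L2_cmult: "u \<in> L2 M \<Longrightarrow> (\<lambda>x. c * u x) \<in> L2 M"
  by (auto simp: L2_def norm_mult power_mult_distrib)

lemma L2_diff: "u \<in> L2 M \<Longrightarrow> v \<in> L2 M \<Longrightarrow> (\<lambda>x. u x - v x) \<in> L2 M"
  using L2_add[OF _ L2_cmult[of v M "-1"], of u] by simp

lemma borel_measurable_cnj [measurable]: "cnj \<in> borel_measurable borel"
  by (intro borel_measurable_continuous_onI continuous_intros)

lemma integrable_L2_mult:
  assumes "u \<in> L2 M" "v \<in> L2 M"
  shows "integrable M (\<lambda>x. u x * cnj (v x))"
proof -
  note [measurable] = assms[THEN L2_measurable]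
  show ?thesis
  proof (rule Bochner_Integration.integrable_bound)
  show "integrable M (\<lambda>x. (cmod (u x))\<^sup>2 + (cmod (v x))\<^sup>2)" using assms by (auto simp: L2_def)
  show "AE x in M. norm (u x * cnj (v x)) \<le> norm ((cmod (u x))\<^sup>2 + (cmod (v x))\<^sup>2)"
  proof (rule AE_I2)
    fix x
    have "cmod (u x) * cmod (v x) \<le> 2 * (cmod (u x) * cmod (v x))" by simp
    also have "\<dots> \<le> (cmod (u x))\<^sup>2 + (cmod (v x))\<^sup>2"
      using sum_squares_bound[of "cmod (u x)" "cmod (v x)"] by simp
    finally show "norm (u x * cnj (v x)) \<le> norm ((cmod (u x))\<^sup>2 + (cmod (v x))\<^sup>2)"
      by (simp add: norm_mult)
  qed
  qed measurable
qed

lemma Cauchy_Schwarz_L2: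
  assumes "u \<in> L2 M" "v \<in> L2 M"
  shows "(cmod (LINT x|M. u x * cnj (v x)))\<^sup>2 \<le> (LINT x|M. (cmod (u x))\<^sup>2) * (LINT x|M. (cmod (v x))\<^sup>2)"
proof -
  have [measurable]: "u \<in> borel_measurable M" "v \<in> borel_measurable M"
    using assms by (auto dest: L2_measurable)
  have nn: "0 \<le> (LINT x|M. (cmod (w x))\<^sup>2)" for w by (rule Bochner_Integration.integral_nonneg) auto
  have "ennreal ((cmod (LINT x|M. u x * cnj (v x)))\<^sup>2) \<le> (ennreal (LINT x|M. cmod (u x * cnj (v x))))\<^sup>2"
    by (simp add: ennreal_power power_mono)
  also have "ennreal (LINT x|M. cmod (u x * cnj (v x))) = (\<integral>\<^sup>+x. ennreal (cmod (u x)) * ennreal (cmod (v x)) \<partial>M)"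
    using integrable_L2_mult[OF assms]
    by (subst nn_integral_eq_integral[OF integrable_norm, symmetric]) (auto simp: norm_mult ennreal_mult')
  also have "(\<dots>)\<^sup>2 \<le> (\<integral>\<^sup>+x. ennreal (cmod (u x)) ^ 2 \<partial>M) * (\<integral>\<^sup>+x. ennreal (cmod (v x)) ^ 2 \<partial>M)"
    by (rule Cauchy_Schwarz_nn_integral) measurable
  also have "\<dots> = ennreal ((LINT x|M. (cmod (u x))\<^sup>2) * (LINT x|M. (cmod (v x))\<^sup>2))"
    using nn by (simp add: ennreal_power nn_integral_L2 assms ennreal_mult)
  finally show ?thesis using nn by simp
qed

text \<open>On a finite measure space the L2 bounds on the increments yield summable L1 bounds.
  Hence the sum of the moduli of the increments is finite almost everywhere, and the telescoping
  series converges there.\<close>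

lemma (in finite_measure) fast_L2_AE_convergent:
  fixes s :: "nat \<Rightarrow> 'a \<Rightarrow> complex"
  assumes [measurable]: "\<And>n. s n \<in> borel_measurable M"
    and K: "0 \<le> K" "\<And>n. (\<integral>\<^sup>+x. ennreal ((cmod (s (Suc n) x - s n x))\<^sup>2) \<partial>M) \<le> ennreal (K * (1/4) ^ n)"
  shows "AE x in M. convergent (\<lambda>n. s n x)"
proof -
  define d where "d n x = cmod (s (Suc n) x - s n x)" for n x
  have [measurable]: "d n \<in> borel_measurable M" for n unfolding d_def by measurable
  have le: "(\<integral>\<^sup>+x. ennreal (d n x) \<partial>M) \<le> ennreal ((measure M (space M) + K) * (1/2) ^ n)" for n
  proof -
    \<comment> \<open>From \<open>t \<le> 1 + t\<^sup>2\<close> with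
      \<open>t = 2 ^ n * d n x\<close>. The weight \<open>2 ^ n\<close> balances the two terms:
      after integration both are of order \<open>(1/2) ^ n\<close>.\<close>
    have "d n x \<le> (1/2) ^ n + 2 ^ n * (d n x)\<^sup>2" for x
    proof -
      define t where "t = 2 ^ n * d n x"
      have t: "0 \<le> t" by (simp add: t_def d_def)
      have "t \<le> 1 + t\<^sup>2"
        using sum_squares_bound[of 1 t] t by simp
      then have "(1/2) ^ n * t \<le> (1/2) ^ n * (1 + t\<^sup>2)" by (intro mult_left_mono) auto
      then show ?thesis
        by (simp add: t_def power_divide power2_eq_square field_simps)
    qed
    then have "(\<integral>\<^sup>+x. ennreal (d n x) \<partial>M) \<le> (\<integral>\<^sup>+x. ennreal ((1/2) ^ n) + ennreal (2 ^ n) * ennreal ((d n x)\<^sup>2) \<partial>M)"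
      by (intro nn_integral_mono) (simp flip: ennreal_plus ennreal_mult add: ennreal_leI)
    also have "\<dots> = ennreal ((1/2) ^ n) * emeasure M (space M) + ennreal (2 ^ n) * (\<integral>\<^sup>+x. ennreal ((d n x)\<^sup>2) \<partial>M)"
      by (simp add: nn_integral_add nn_integral_cmult)
    also have "\<dots> \<le> ennreal ((1/2) ^ n) * emeasure M (space M) + ennreal (2 ^ n) * ennreal (K * (1/4) ^ n)"
      unfolding d_def by (intro add_left_mono mult_left_mono K) auto
    also have "\<dots> = ennreal ((measure M (space M) + K) * (1/2) ^ n)"
      using K(1) by (simp add: emeasure_eq_measure flip: ennreal_plus ennreal_mult)
        (simp add: power_divide field_simps flip: power_mult_distrib)
    finally show ?thesis .
  qed
  have "(\<integral>\<^sup>+x. (\<Sum>n. ennreal (d n x)) \<partial>M) = (\<Sum>n. \<integral>\<^sup>+x. ennreal (d n x) \<partial>M)"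
    by (intro nn_integral_suminf) measurable
  also have "\<dots> \<le> (\<Sum>n. ennreal ((measure M (space M) + K) * (1/2) ^ n))"
    by (intro suminf_le le) auto
  also have "\<dots> < \<infinity>"
  proof -
    have "summable (\<lambda>n. (measure M (space M) + K) * (1/2) ^ n)"
      by (intro summable_mult summable_geometric) auto
    then show ?thesis using K(1) by (simp add: suminf_ennreal2 less_top)
  qed
  finally have "AE x in M. (\<Sum>n. ennreal (d n x)) \<noteq> \<infinity>"
    by (intro nn_integral_noteq_infinite) auto
  then show ?thesis
  proof eventually_elim
    case (elim x)
    then have "summable (\<lambda>n. d n x)"
      by (intro summable_suminf_not_top) (auto simp: d_def)
    then have "summable (\<lambda>n. s (Suc n) x - s n x)"
      unfolding d_def by (rule summable_norm_cancel)
    then have "convergent (\<lambda>n. \<Sum>i<n. s (Suc i) x - s i x)"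
      by (simp add: summable_iff_convergent)
    also have "(\<lambda>n. \<Sum>i<n. s (Suc i) x - s i x) = (\<lambda>n. s n x - s 0 x)"
      by (simp add: sum_lessThan_telescope[of "\<lambda>n. s n x"])
    finally have "convergent (\<lambda>n. (s n x - s 0 x) + s 0 x)"
      by (intro convergent_add convergent_const)
    then show ?case by simp
  qed
qed

text \<open>Dominated convergence for sums (Tannery's theorem), applied along sequences tending to 1
  after enumerating the pairs. The multipliers used later are \<open>r ^ tdeg p\<close>, with limit
  1, and \<open>(1 - r ^ tdeg p)\<^sup>2\<close>, with limit 0.\<close>

lemma tendsto_infsum_at_left_1:
  fixes c :: "nat \<times> nat \<Rightarrow> complex" and k :: "nat \<times> nat \<Rightarrow> real \<Rightarrow> real"
  assumes c: "c summable_on UNIV"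
    and bd: "\<And>p r. 0 < r \<Longrightarrow> r < 1 \<Longrightarrow> \<bar>k p r\<bar> \<le> 1"
    and lim: "\<And>p. ((\<lambda>r. k p r) \<longlongrightarrow> l p) (at_left 1)"
  shows "((\<lambda>r. \<Sum>\<^sub>\<infinity>p. c p * of_real (k p r)) \<longlongrightarrow> (\<Sum>\<^sub>\<infinity>p. c p * of_real (l p))) (at_left 1)"
proof (rule tendsto_at_left_sequentially[of 0])
  fix S :: "nat \<Rightarrow> real" assume S: "\<And>n. S n < 1" "\<And>n. 0 < S n" "S \<longlonglongrightarrow> 1"
  let ?d = prod_decode
  have ac: "(\<lambda>p. cmod (c p)) summable_on UNIV"
    using c unfolding summable_on_iff_abs_summable_on_complex .
  have inf: "(\<Sum>n. c (?d n) * of_real (w (?d n))) = (\<Sum>\<^sub>\<infinity>p. c p * of_real (w p))"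
    if "\<And>p. \<bar>w p\<bar> \<le> 1" for w
  proof -
    have "(\<lambda>p. cmod (c p * of_real (w p))) summable_on UNIV"
      using that by (intro Infinite_Sum.abs_summable_on_comparison_test'[OF ac])
        (auto simp: norm_mult intro: mult_left_le)
    then have "(\<lambda>p. c p * of_real (w p)) summable_on UNIV"
      unfolding summable_on_iff_abs_summable_on_complex .
    then have "((\<lambda>p. c p * of_real (w p)) has_sum (\<Sum>\<^sub>\<infinity>p. c p * of_real (w p))) UNIV" by simp
    then have "((\<lambda>n. c (?d n) * of_real (w (?d n))) has_sum (\<Sum>\<^sub>\<infinity>p. c p * of_real (w p))) UNIV"
      using has_sum_reindex_bij_betw[OF bij_prod_decode, of "\<lambda>p. c p * of_real (w p)"] by simp
    then show ?thesis by (intro sums_unique[symmetric] has_sum_imp_sums)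
  qed
  have "filterlim S (at_left 1) sequentially"
    using S by (intro tendsto_imp_filterlim_at_left) auto
  then have limS: "(\<lambda>n. k p (S n)) \<longlonglongrightarrow> l p" for p using lim by (rule filterlim_compose[rotated])
  have l: "\<bar>l p\<bar> \<le> 1" for p
    by (rule tendsto_upperbound[OF tendsto_rabs[OF limS]]) (use bd S in auto)
  have "(\<lambda>n. cmod (c (?d n))) summable_on UNIV"
    using ac summable_on_reindex_bij_betw[OF bij_prod_decode, of "\<lambda>p. cmod (c p)"] by simp
  then have sm: "summable (\<lambda>n. cmod (c (?d n)))" by (rule summable_on_imp_summable)
  have "(\<lambda>m. \<Sum>n. c (?d n) * of_real (k (?d n) (S m))) \<longlonglongrightarrow> (\<Sum>n. c (?d n) * of_real (l (?d n)))"
  proof (rule tannerys_theorem[THEN conjunct2, THEN conjunct2])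
    show "(\<lambda>m. c (?d n) * of_real (k (?d n) (S m))) \<longlonglongrightarrow> c (?d n) * of_real (l (?d n))" for n
      by (intro tendsto_intros limS)
    show "\<forall>\<^sub>F (n, m) in at_top \<times>\<^sub>F at_top. cmod (c (?d n) * of_real (k (?d n) (S m))) \<le> cmod (c (?d n))"
      by (intro always_eventually) (simp add: norm_mult mult_left_le bd S case_prod_beta)
  qed (use sm in auto)
  then show "(\<lambda>m. \<Sum>\<^sub>\<infinity>p. c p * of_real (k p (S m))) \<longlonglongrightarrow> (\<Sum>\<^sub>\<infinity>p. c p * of_real (l p))"
    using inf[of "\<lambda>p. k p (S _)"] inf[of l] l bd S by simp
qed simp

text \<open>The property behind the choice in \<open>boundary_value\<close>, as a relation. Sums and
  products of boundary functions satisfy it although they need not be the functions that were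
  chosen.\<close>

definition L2_boundary :: "(complex \<times> complex \<Rightarrow> complex) \<Rightarrow> (complex \<times> complex \<Rightarrow> complex) \<Rightarrow> bool" where
  "L2_boundary f g \<longleftrightarrow> g \<in> L2 torus_measure \<and>
     ((\<lambda>r. \<integral>\<^sup>+ \<zeta>. ennreal ((cmod (f (r *\<^sub>R \<zeta>) - g \<zeta>))\<^sup>2) \<partial>torus_measure) \<longlongrightarrow> 0) (at_left 1)"

lemma boundary_value_eq: "boundary_value f = (SOME g. L2_boundary f g)"
  by (simp add: boundary_value_def L2_boundary_def)

lemma L2_boundary_boundary_value: "L2_boundary f g \<Longrightarrow> L2_boundary f (boundary_value f)"
  unfolding boundary_value_eq by (rule someI[of "L2_boundary f"])

lemma eventually_at_left_unit: "\<forall>\<^sub>F r in at_left (1::real). 0 < r \<and> r < 1"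
  by (rule eventually_at_leftI[of 0]) auto

text \<open>Only values on dilated tori of radius in (0, 1) enter. The conclusion equates the
  predicates themselves, so the choice in \<open>boundary_value\<close> picks the same function for
  both, not merely one equal almost everywhere.\<close>

lemma L2_boundary_cong:
  assumes "\<And>r \<zeta>. 0 < r \<Longrightarrow> r < 1 \<Longrightarrow> \<zeta> \<in> torus \<Longrightarrow> f (r *\<^sub>R \<zeta>) = f' (r *\<^sub>R \<zeta>)"
  shows "L2_boundary f = L2_boundary f'"
proof
  fix g
  have "((\<lambda>r. \<integral>\<^sup>+ \<zeta>. ennreal ((cmod (f (r *\<^sub>R \<zeta>) - g \<zeta>))\<^sup>2) \<partial>torus_measure) \<longlongrightarrow> 0) (at_left 1) \<longleftrightarrow>
    ((\<lambda>r. \<integral>\<^sup>+ \<zeta>. ennreal ((cmod (f' (r *\<^sub>R \<zeta>) - g \<zeta>))\<^sup>2) \<partial>torus_measure) \<longlongrightarrow> 0) (at_left 1)"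
    by (rule tendsto_cong[OF eventually_mono[OF eventually_at_left_unit]])
       (auto intro!: nn_integral_cong simp: assms simp del: scaleR_Pair)
  then show "L2_boundary f g = L2_boundary f' g" by (simp add: L2_boundary_def)
qed

lemma measurable_dilation:
  assumes "holomorphic_on_bidisk f" "0 < r" "r < 1"
  shows "(\<lambda>\<zeta>. f (r *\<^sub>R \<zeta>)) \<in> borel_measurable torus_measure"
  using assms by (intro measurable_continuous_torus continuous_dilation holomorphic_on_bidisk_continuous) auto

lemma tendsto_zero_ennreal_squeeze:
  fixes f g :: "'a \<Rightarrow> ennreal"
  assumes "(g \<longlongrightarrow> 0) F" "\<forall>\<^sub>F x in F. f x \<le> g x"
  shows "(f \<longlongrightarrow> 0) F"
  by (rule tendsto_sandwich[OF _ assms(2) tendsto_const assms(1)]) auto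

lemma L2_boundary_add:
  assumes f: "holomorphic_on_bidisk f" "L2_boundary f u" and g: "holomorphic_on_bidisk g" "L2_boundary g v"
  shows "L2_boundary (\<lambda>z. f z + g z) (\<lambda>\<zeta>. u \<zeta> + v \<zeta>)"
proof -
  have L: "u \<in> L2 torus_measure" "v \<in> L2 torus_measure" using assms by (auto simp: L2_boundary_def)
  let ?N = "\<lambda>w. \<integral>\<^sup>+ \<zeta>. ennreal ((cmod (w \<zeta>))\<^sup>2) \<partial>torus_measure"
  have "((\<lambda>r. 2 * ?N (\<lambda>\<zeta>. f (r *\<^sub>R \<zeta>) - u \<zeta>) + 2 * ?N (\<lambda>\<zeta>. g (r *\<^sub>R \<zeta>) - v \<zeta>)) \<longlongrightarrow> 2 * 0 + 2 * 0) (at_left 1)"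
    using assms by (intro tendsto_add ennreal_tendsto_cmult) (auto simp: L2_boundary_def)
  then have "((\<lambda>r. 2 * ?N (\<lambda>\<zeta>. f (r *\<^sub>R \<zeta>) - u \<zeta>) + 2 * ?N (\<lambda>\<zeta>. g (r *\<^sub>R \<zeta>) - v \<zeta>)) \<longlongrightarrow> 0) (at_left 1)"
    by simp
  then have "((\<lambda>r. ?N (\<lambda>\<zeta>. (f (r *\<^sub>R \<zeta>) + g (r *\<^sub>R \<zeta>)) - (u \<zeta> + v \<zeta>))) \<longlongrightarrow> 0) (at_left 1)"
  proof (rule tendsto_zero_ennreal_squeeze)
    show "\<forall>\<^sub>F r in at_left 1. ?N (\<lambda>\<zeta>. (f (r *\<^sub>R \<zeta>) + g (r *\<^sub>R \<zeta>)) - (u \<zeta> + v \<zeta>)) \<le>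
      2 * ?N (\<lambda>\<zeta>. f (r *\<^sub>R \<zeta>) - u \<zeta>) + 2 * ?N (\<lambda>\<zeta>. g (r *\<^sub>R \<zeta>) - v \<zeta>)"
      using eventually_at_left_unit
    proof eventually_elim
      case (elim r)
      have "(\<lambda>\<zeta>. f (r *\<^sub>R \<zeta>) - u \<zeta>) \<in> borel_measurable torus_measure"
        "(\<lambda>\<zeta>. g (r *\<^sub>R \<zeta>) - v \<zeta>) \<in> borel_measurable torus_measure"
        using elim f(1) g(1) L[THEN L2_measurable] by (auto intro!: borel_measurable_diff measurable_dilation)
      from nn_integral_square_add_le[OF this] show ?case by (simp add: algebra_simps)
    qed
  qed
  then show ?thesis by (simp add: L2_boundary_def L2_add L)
qed

text \<open>The squared distance of \<open>u\<close> and \<open>v\<close> is at most a quantity that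
  tends to 0 as \<open>r\<close> tends to 1, and it does not depend on \<open>r\<close>.\<close>

lemma L2_boundary_unique:
  assumes f: "holomorphic_on_bidisk f" and u: "L2_boundary f u" and v: "L2_boundary f v"
  shows "AE \<zeta> in torus_measure. u \<zeta> = v \<zeta>"
proof -
  have L: "u \<in> L2 torus_measure" "v \<in> L2 torus_measure" using assms by (auto simp: L2_boundary_def)
  let ?N = "\<lambda>w. \<integral>\<^sup>+ \<zeta>. ennreal ((cmod (w \<zeta>))\<^sup>2) \<partial>torus_measure"
  have "((\<lambda>r. 2 * ?N (\<lambda>\<zeta>. f (r *\<^sub>R \<zeta>) - v \<zeta>) + 2 * ?N (\<lambda>\<zeta>. f (r *\<^sub>R \<zeta>) - u \<zeta>)) \<longlongrightarrow> 2 * 0 + 2 * 0) (at_left 1)"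
    using assms by (intro tendsto_add ennreal_tendsto_cmult) (auto simp: L2_boundary_def)
  then have "((\<lambda>r. 2 * ?N (\<lambda>\<zeta>. f (r *\<^sub>R \<zeta>) - v \<zeta>) + 2 * ?N (\<lambda>\<zeta>. f (r *\<^sub>R \<zeta>) - u \<zeta>)) \<longlongrightarrow> 0) (at_left 1)"
    by simp
  then have "((\<lambda>r::real. ?N (\<lambda>\<zeta>. u \<zeta> - v \<zeta>)) \<longlongrightarrow> 0) (at_left 1)"
  proof (rule tendsto_zero_ennreal_squeeze)
    show "\<forall>\<^sub>F r in at_left 1. ?N (\<lambda>\<zeta>. u \<zeta> - v \<zeta>) \<le>
      2 * ?N (\<lambda>\<zeta>. f (r *\<^sub>R \<zeta>) - v \<zeta>) + 2 * ?N (\<lambda>\<zeta>. f (r *\<^sub>R \<zeta>) - u \<zeta>)"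
      using eventually_at_left_unit
    proof eventually_elim
      case (elim r)
      have "(\<lambda>\<zeta>. f (r *\<^sub>R \<zeta>) - v \<zeta>) \<in> borel_measurable torus_measure"
        "(\<lambda>\<zeta>. - (f (r *\<^sub>R \<zeta>) - u \<zeta>)) \<in> borel_measurable torus_measure"
        using elim f L[THEN L2_measurable] by (auto intro!: borel_measurable_diff measurable_dilation borel_measurable_uminus)
      from nn_integral_square_add_le[OF this] show ?case
        by (simp only: norm_minus_cancel) (simp add: algebra_simps)
    qed
  qed
  then have "?N (\<lambda>\<zeta>. u \<zeta> - v \<zeta>) = 0"
    by (rule tendsto_unique[OF _ tendsto_const, rotated]) simp
  moreover have "(\<lambda>\<zeta>. ennreal ((cmod (u \<zeta> - v \<zeta>))\<^sup>2)) \<in> borel_measurable torus_measure"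
    using L[THEN L2_measurable] by measurable
  ultimately show ?thesis by (simp add: nn_integral_0_iff_AE)
qed

lemma hardy2_dilation_L2:
  assumes "f \<in> hardy2" "0 < r" "r < 1"
  shows "(\<lambda>\<zeta>. f (r *\<^sub>R \<zeta>)) \<in> L2 torus_measure"
  using assms parseval_dilation_norm(2)[OF hardy2D(1)[OF assms(1)], of r]
  by (auto simp: L2_def intro: measurable_dilation hardy2D)

text \<open>\<open>f\<^sub>r \<rightarrow> f\<close> in coefficients gives an \<open>L\<^sup>2\<close> Cauchy family; a rapidly converging subsequence
  converges almost everywhere, and Fatou's lemma bounds the distance to its limit.\<close>

theorem hardy2_L2_boundary:
  assumes f: "f \<in> hardy2"
  shows "L2_boundary f (boundary_value f)"
proof -
  note fD = hardy2D[OF f]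
  define a where "a = bidisk_coeff f"
  have a: "has_bidisk_series f a" "square_summable a" using fD by (auto simp: a_def)
  let ?N = "\<lambda>w. \<integral>\<^sup>+ \<zeta>. ennreal ((cmod (w \<zeta>))\<^sup>2) \<partial>torus_measure"
  \<comment> \<open>The squared distance, read in coefficients, between the dilation by
    \<open>r\<close> and the expected boundary function.\<close>
  define \<delta> where "\<delta> r = (\<Sum>\<^sub>\<infinity>p. (cmod (a p))\<^sup>2 * (1 - r ^ tdeg p)\<^sup>2)" for r
  have k: "\<bar>(1 - r ^ m)\<^sup>2\<bar> \<le> 1" if "0 < r" "r < 1" for r :: real and m
    using that by (simp add: power_le_one abs_square_le_1 abs_le_iff)
  have \<delta>_sum: "(\<lambda>p. (cmod (a p))\<^sup>2 * (1 - r ^ tdeg p)\<^sup>2) summable_on UNIV" if "0 < r" "r < 1" for r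
    by (rule summable_on_comparison_test[OF a(2)]) (use k[OF that] in \<open>auto intro: mult_left_le\<close>)
  have \<delta>_pos: "0 \<le> \<delta> r" for r unfolding \<delta>_def by (intro infsum_nonneg) auto
  have "((\<lambda>r. \<Sum>\<^sub>\<infinity>p. of_real ((cmod (a p))\<^sup>2) * of_real ((1 - r ^ tdeg p)\<^sup>2)) \<longlongrightarrow>
      (\<Sum>\<^sub>\<infinity>p. complex_of_real ((cmod (a p))\<^sup>2) * of_real 0)) (at_left 1)"
  proof (rule tendsto_infsum_at_left_1)
    show "(\<lambda>p. complex_of_real ((cmod (a p))\<^sup>2)) summable_on UNIV"
      using a(2) by (rule summable_on_of_real)
    show "((\<lambda>r. (1 - r ^ tdeg p)\<^sup>2) \<longlongrightarrow> 0) (at_left (1::real))" for p :: "nat \<times> nat"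
    proof -
      have "((\<lambda>r::real. (1 - r ^ tdeg p)\<^sup>2) \<longlongrightarrow> (1 - 1 ^ tdeg p)\<^sup>2) (at_left 1)" by (intro tendsto_intros)
      then show ?thesis by (simp only: power_one diff_self zero_power2)
    qed
  qed (rule k)
  moreover have "\<forall>\<^sub>F r in at_left 1. (\<Sum>\<^sub>\<infinity>p. of_real ((cmod (a p))\<^sup>2) * of_real ((1 - r ^ tdeg p)\<^sup>2)) =
      complex_of_real (\<delta> r)"
    using eventually_at_left_unit
  proof eventually_elim
    case (elim r)
    then have "((\<lambda>p. complex_of_real ((cmod (a p))\<^sup>2 * (1 - r ^ tdeg p)\<^sup>2)) has_sum of_real (\<delta> r)) UNIV"
      unfolding \<delta>_def by (intro has_sum_of_real has_sum_infsum \<delta>_sum) auto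
    then show ?case by (intro infsumI) (simp only: of_real_mult)
  qed
  ultimately have "((\<lambda>r. of_real (\<delta> r)) \<longlongrightarrow>
      (\<Sum>\<^sub>\<infinity>p. complex_of_real ((cmod (a p))\<^sup>2) * of_real 0)) (at_left 1)"
    by (rule Lim_transform_eventually)
  then have "((\<lambda>r. of_real (\<delta> r)) \<longlongrightarrow> complex_of_real 0) (at_left 1)" by simp
  then have \<delta>0: "(\<delta> \<longlongrightarrow> 0) (at_left 1)" by (simp only: tendsto_of_real_iff)
  have dist: "?N (\<lambda>\<zeta>. f (r *\<^sub>R \<zeta>) - f (s *\<^sub>R \<zeta>)) \<le> ennreal (\<delta> r + \<delta> s)"
    if r: "0 < r" "r < 1" and s: "0 < s" "s < 1" for r s
  proof -
    define c where "c p = a p * of_real r ^ tdeg p - a p * of_real s ^ tdeg p" for p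
    have c: "((\<lambda>p. c p * bimonom p \<zeta>) has_sum (f (r *\<^sub>R \<zeta>) - f (s *\<^sub>R \<zeta>))) UNIV" if "\<zeta> \<in> torus" for \<zeta>
      using has_sum_add[OF has_sum_on_torus[OF a(1) _ r(2) that] has_sum_uminusI[OF has_sum_on_torus[OF a(1) _ s(2) that]]] r s
      by (simp add: c_def left_diff_distrib)
    note P = torus_parseval_norm[OF c]
    have "(LINT \<zeta>|torus_measure. (cmod (f (r *\<^sub>R \<zeta>) - f (s *\<^sub>R \<zeta>)))\<^sup>2) \<le> \<delta> r + \<delta> s"
    proof (rule has_sum_mono[OF P(1)])
      show "((\<lambda>p. (cmod (a p))\<^sup>2 * (1 - r ^ tdeg p)\<^sup>2 + (cmod (a p))\<^sup>2 * (1 - s ^ tdeg p)\<^sup>2) has_sum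
          (\<delta> r + \<delta> s)) UNIV"
        unfolding \<delta>_def using \<delta>_sum r s by (intro has_sum_add has_sum_infsum) auto
      fix p
      define x where "x = r ^ tdeg p"
      define y where "y = s ^ tdeg p"
      have xy: "0 \<le> x" "x \<le> 1" "0 \<le> y" "y \<le> 1" using r s by (auto simp: x_def y_def power_le_one)
      \<comment> \<open>Both \<open>1 - x\<close> and \<open>1 - y\<close> are nonnegative, so the
        mixed term has a favourable sign and no factor 2 is lost.\<close>
      have "(x - y)\<^sup>2 \<le> (1 - x)\<^sup>2 + (1 - y)\<^sup>2"
      proof -
        have "0 \<le> (1 - x) * (1 - y)" using xy by simp
        moreover have "(1 - x)\<^sup>2 + (1 - y)\<^sup>2 - (x - y)\<^sup>2 = 2 * ((1 - x) * (1 - y))"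
          by (simp add: power2_eq_square algebra_simps)
        ultimately show ?thesis by linarith
      qed
      then have "(cmod (a p))\<^sup>2 * (x - y)\<^sup>2 \<le> (cmod (a p))\<^sup>2 * ((1 - x)\<^sup>2 + (1 - y)\<^sup>2)"
        by (intro mult_left_mono) auto
      moreover have "(cmod (c p))\<^sup>2 = (cmod (a p))\<^sup>2 * (x - y)\<^sup>2"
      proof -
        have "c p = a p * of_real (x - y)" by (simp add: c_def x_def y_def algebra_simps)
        then show ?thesis by (simp only: norm_mult power_mult_distrib norm_of_real power2_abs)
      qed
      ultimately show "(cmod (c p))\<^sup>2 \<le>
        (cmod (a p))\<^sup>2 * (1 - r ^ tdeg p)\<^sup>2 + (cmod (a p))\<^sup>2 * (1 - s ^ tdeg p)\<^sup>2"
        by (simp add: x_def y_def distrib_left)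
    qed
    moreover have "?N (\<lambda>\<zeta>. f (r *\<^sub>R \<zeta>) - f (s *\<^sub>R \<zeta>)) =
        ennreal (LINT \<zeta>|torus_measure. (cmod (f (r *\<^sub>R \<zeta>) - f (s *\<^sub>R \<zeta>)))\<^sup>2)"
      using P(2) by (intro nn_integral_eq_integral) auto
    ultimately show ?thesis by (simp add: ennreal_leI)
  qed
  \<comment> \<open>The rate \<open>(1/4) ^ n\<close> is the one in
    \<open>fast_L2_AE_convergent\<close>; two consecutive radii together give its constant
    2.\<close>
  have "\<exists>r. 0 < r \<and> r < 1 \<and> \<delta> r < (1/4) ^ n" for n :: nat
  proof -
    have "\<forall>\<^sub>F r in at_left 1. \<delta> r < (1/4) ^ n" using \<delta>0 by (rule order_tendstoD) simp
    with eventually_at_left_unit have "\<forall>\<^sub>F r in at_left 1. 0 < r \<and> r < 1 \<and> \<delta> r < (1/4) ^ n"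
      by eventually_elim auto
    then show ?thesis by (rule eventually_happens'[rotated]) simp
  qed
  then obtain R where R: "\<And>n. 0 < R n" "\<And>n. R n < 1" "\<And>n. \<delta> (R n) < (1/4) ^ n" by metis
  define s where "s n \<zeta> = f (R n *\<^sub>R \<zeta>)" for n \<zeta>
  have sm [measurable]: "s n \<in> borel_measurable torus_measure" for n
    unfolding s_def[abs_def] using R fD(4) by (intro measurable_dilation)
  have "AE \<zeta> in torus_measure. convergent (\<lambda>n. s n \<zeta>)"
  proof (rule torus.fast_L2_AE_convergent[OF sm, of 2])
    fix n
    have "?N (\<lambda>\<zeta>. s (Suc n) \<zeta> - s n \<zeta>) \<le> ennreal (\<delta> (R (Suc n)) + \<delta> (R n))"
      unfolding s_def using R by (intro dist)
    also have "\<dots> \<le> ennreal (2 * (1/4) ^ n)"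
      using R(3)[of n] R(3)[of "Suc n", unfolded power_Suc] zero_le_power[of "1/4::real" n]
      by (intro ennreal_leI) linarith
    finally show "?N (\<lambda>\<zeta>. s (Suc n) \<zeta> - s n \<zeta>) \<le> ennreal (2 * (1/4) ^ n)" .
  qed simp
  \<comment> \<open>\<open>lim\<close> is unspecified where the sequence diverges; that set is null,
    and \<open>g\<close> is measurable all the same.\<close>
  define g where "g \<zeta> = lim (\<lambda>n. s n \<zeta>)" for \<zeta>
  have gm [measurable]: "g \<in> borel_measurable torus_measure" unfolding g_def by measurable
  have g: "AE \<zeta> in torus_measure. (\<lambda>n. s n \<zeta>) \<longlonglongrightarrow> g \<zeta>"
    using \<open>AE \<zeta> in torus_measure. convergent (\<lambda>n. s n \<zeta>)\<close>
    by eventually_elim (simp add: g_def convergent_LIMSEQ_iff)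
  have \<delta>R: "(\<lambda>n. \<delta> (R n)) \<longlonglongrightarrow> 0"
  proof (rule tendsto_sandwich[OF _ _ tendsto_const])
    show "(\<lambda>n. (1/4) ^ n :: real) \<longlonglongrightarrow> 0" by (intro LIMSEQ_realpow_zero) auto
  qed (use R(3) \<delta>_pos in \<open>auto intro!: always_eventually less_imp_le\<close>)
  have le: "?N (\<lambda>\<zeta>. f (r *\<^sub>R \<zeta>) - g \<zeta>) \<le> ennreal (\<delta> r)" if r: "0 < r" "r < 1" for r
  proof -
    have [measurable]: "(\<lambda>\<zeta>. f (r *\<^sub>R \<zeta>)) \<in> borel_measurable torus_measure"
      using r fD(4) by (intro measurable_dilation)
    have "?N (\<lambda>\<zeta>. f (r *\<^sub>R \<zeta>) - g \<zeta>) = (\<integral>\<^sup>+ \<zeta>. liminf (\<lambda>n. ennreal ((cmod (f (r *\<^sub>R \<zeta>) - s n \<zeta>))\<^sup>2)) \<partial>torus_measure)"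
    proof (rule nn_integral_cong_AE)
      show "AE \<zeta> in torus_measure. ennreal ((cmod (f (r *\<^sub>R \<zeta>) - g \<zeta>))\<^sup>2) =
         liminf (\<lambda>n. ennreal ((cmod (f (r *\<^sub>R \<zeta>) - s n \<zeta>))\<^sup>2))"
        using g
      proof eventually_elim
        case (elim \<zeta>)
        then have "(\<lambda>n. ennreal ((cmod (f (r *\<^sub>R \<zeta>) - s n \<zeta>))\<^sup>2)) \<longlonglongrightarrow> ennreal ((cmod (f (r *\<^sub>R \<zeta>) - g \<zeta>))\<^sup>2)"
          by (intro tendsto_ennrealI tendsto_intros)
        then show ?case by (intro lim_imp_Liminf[symmetric]) auto
      qed
    qed
    also have "\<dots> \<le> liminf (\<lambda>n. ?N (\<lambda>\<zeta>. f (r *\<^sub>R \<zeta>) - s n \<zeta>))"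
      by (rule nn_integral_liminf) measurable
    also have "\<dots> \<le> liminf (\<lambda>n. ennreal (\<delta> r + \<delta> (R n)))"
      unfolding s_def using r R by (intro Liminf_mono always_eventually allI dist)
    also have "\<dots> = ennreal (\<delta> r + 0)"
      by (intro lim_imp_Liminf tendsto_ennrealI tendsto_intros \<delta>R) auto
    finally show ?thesis by simp
  qed
  have "L2_boundary f g"
    unfolding L2_boundary_def
  proof
    \<comment> \<open>One fixed dilation in L2 at finite L2 distance from \<open>g\<close> puts
      \<open>g\<close> itself in L2; any radius in (0, 1) would do.\<close>
    have half: "(\<lambda>\<zeta>. f ((1/2) *\<^sub>R \<zeta>)) \<in> L2 torus_measure" by (rule hardy2_dilation_L2[OF f]) auto
    have "(\<lambda>\<zeta>. f ((1/2) *\<^sub>R \<zeta>) - g \<zeta>) \<in> L2 torus_measure"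
      unfolding L2_iff_nn_integral
    proof
      show "(\<lambda>\<zeta>. f ((1/2) *\<^sub>R \<zeta>) - g \<zeta>) \<in> borel_measurable torus_measure"
        using L2_measurable[OF half] by measurable
      show "?N (\<lambda>\<zeta>. f ((1/2) *\<^sub>R \<zeta>) - g \<zeta>) < \<infinity>"
        using le[of "1/2"] by (simp add: le_less_trans)
    qed
    from L2_diff[OF half this] show "g \<in> L2 torus_measure" by simp
    have "((\<lambda>r. ennreal (\<delta> r)) \<longlongrightarrow> 0) (at_left 1)"
      using tendsto_ennrealI[OF \<delta>0] by simp
    then show "((\<lambda>r. ?N (\<lambda>\<zeta>. f (r *\<^sub>R \<zeta>) - g \<zeta>)) \<longlongrightarrow> 0) (at_left 1)"
      by (rule tendsto_zero_ennreal_squeeze)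
         (rule eventually_mono[OF eventually_at_left_unit], use le in auto)
  qed
  then show ?thesis by (rule L2_boundary_boundary_value)
qed

lemma L2_boundary_real_tendsto:
  assumes f: "f \<in> hardy2" and u: "L2_boundary f u"
  shows "((\<lambda>r. LINT \<zeta>|torus_measure. (cmod (f (r *\<^sub>R \<zeta>) - u \<zeta>))\<^sup>2) \<longlongrightarrow> 0) (at_left 1)"
proof -
  have "((\<lambda>r. enn2real (\<integral>\<^sup>+ \<zeta>. ennreal ((cmod (f (r *\<^sub>R \<zeta>) - u \<zeta>))\<^sup>2) \<partial>torus_measure)) \<longlongrightarrow> enn2real 0) (at_left 1)"
    using u by (intro tendsto_enn2real) (auto simp: L2_boundary_def)
  moreover have "\<forall>\<^sub>F r in at_left 1.
      enn2real (\<integral>\<^sup>+ \<zeta>. ennreal ((cmod (f (r *\<^sub>R \<zeta>) - u \<zeta>))\<^sup>2) \<partial>torus_measure) =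
      (LINT \<zeta>|torus_measure. (cmod (f (r *\<^sub>R \<zeta>) - u \<zeta>))\<^sup>2)"
    using eventually_at_left_unit
  proof eventually_elim
    case (elim r)
    have "(\<lambda>\<zeta>. f (r *\<^sub>R \<zeta>) - u \<zeta>) \<in> L2 torus_measure"
      using elim f u by (intro L2_diff hardy2_dilation_L2) (auto simp: L2_boundary_def)
    from nn_integral_L2[OF this] show ?case by simp
  qed
  ultimately show ?thesis by (simp add: tendsto_cong)
qed

section \<open>Fourier coefficients and pairings of boundary functions\<close>

lemma L2_boundary_integral_tendsto:
  assumes f: "f \<in> hardy2" "L2_boundary f u" and w: "w \<in> L2 torus_measure"
  shows "((\<lambda>r. LINT \<zeta>|torus_measure. f (r *\<^sub>R \<zeta>) * cnj (w \<zeta>)) \<longlongrightarrow> (LINT \<zeta>|torus_measure. u \<zeta> * cnj (w \<zeta>))) (at_left 1)"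
proof (rule LIM_zero_cancel)
  let ?n = "\<lambda>v. LINT \<zeta>|torus_measure. (cmod (v \<zeta>))\<^sup>2"
  have u: "u \<in> L2 torus_measure" using f by (auto simp: L2_boundary_def)
  have "((\<lambda>r. sqrt (?n (\<lambda>\<zeta>. f (r *\<^sub>R \<zeta>) - u \<zeta>) * ?n w)) \<longlongrightarrow> sqrt (0 * ?n w)) (at_left 1)"
    by (intro tendsto_intros L2_boundary_real_tendsto f)
  then have 0: "((\<lambda>r. sqrt (?n (\<lambda>\<zeta>. f (r *\<^sub>R \<zeta>) - u \<zeta>) * ?n w)) \<longlongrightarrow> 0) (at_left 1)" by simp
  show "((\<lambda>r. (LINT \<zeta>|torus_measure. f (r *\<^sub>R \<zeta>) * cnj (w \<zeta>)) -
      (LINT \<zeta>|torus_measure. u \<zeta> * cnj (w \<zeta>))) \<longlongrightarrow> 0) (at_left 1)"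
  proof (rule Lim_null_comparison[OF _ 0])
    show "\<forall>\<^sub>F r in at_left 1. norm ((LINT \<zeta>|torus_measure. f (r *\<^sub>R \<zeta>) * cnj (w \<zeta>)) -
      (LINT \<zeta>|torus_measure. u \<zeta> * cnj (w \<zeta>))) \<le> sqrt (?n (\<lambda>\<zeta>. f (r *\<^sub>R \<zeta>) - u \<zeta>) * ?n w)"
      using eventually_at_left_unit
    proof eventually_elim
      case (elim r)
      then have fr: "(\<lambda>\<zeta>. f (r *\<^sub>R \<zeta>)) \<in> L2 torus_measure"
        using f by (auto intro: hardy2_dilation_L2)
      have "(LINT \<zeta>|torus_measure. f (r *\<^sub>R \<zeta>) * cnj (w \<zeta>)) - (LINT \<zeta>|torus_measure. u \<zeta> * cnj (w \<zeta>)) =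
        (LINT \<zeta>|torus_measure. (f (r *\<^sub>R \<zeta>) - u \<zeta>) * cnj (w \<zeta>))"
        using Bochner_Integration.integral_diff[OF integrable_L2_mult[OF fr w] integrable_L2_mult[OF u w]]
        by (simp add: left_diff_distrib)
      then show ?case
        using Cauchy_Schwarz_L2[OF L2_diff[OF fr u] w] by (simp add: real_le_rsqrt)
    qed
  qed
qed

lemma continuous_torus_L2:
  assumes "continuous_on torus g"
  shows "g \<in> L2 torus_measure"
  unfolding L2_def
proof (intro CollectI conjI measurable_continuous_torus[OF assms])
  have "integrable torus_measure (\<lambda>\<zeta>. complex_of_real ((cmod (g \<zeta>))\<^sup>2))"
    by (intro integrable_continuous_torus continuous_intros assms)
  from integrable_Re[OF this] show "integrable torus_measure (\<lambda>\<zeta>. (cmod (g \<zeta>))\<^sup>2)" by simp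
qed

text \<open>Only nonnegative exponents are indexed, so this records the component of
  \<open>w\<close> in \<open>H\<^sup>2\<close> and discards the rest of its Fourier
  expansion.\<close>

definition torus_fourier :: "(complex \<times> complex \<Rightarrow> complex) \<Rightarrow> nat \<times> nat \<Rightarrow> complex" where
  "torus_fourier w p = (LINT \<zeta>|torus_measure. w \<zeta> * cnj (bimonom p \<zeta>))"

lemma cnj_torus_fourier:
  "(LINT \<zeta>|torus_measure. bimonom p \<zeta> * cnj (w \<zeta>)) = cnj (torus_fourier w p)"
  unfolding torus_fourier_def by (simp flip: Bochner_Integration.integral_cnj add: mult.commute)

lemma integrable_cnj_L2:
  assumes "w \<in> L2 torus_measure"
  shows "integrable torus_measure (\<lambda>\<zeta>. cnj (w \<zeta>))"
  using integrable_L2_mult[OF continuous_torus_L2[of "\<lambda>_. 1"] assms] by simp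

text \<open>Test \<open>w\<close> against the trigonometric polynomial \<open>q\<close> formed from
  finitely many of its own coefficients. Both the pairing of \<open>q\<close> with \<open>w\<close>
  and the squared norm of \<open>q\<close> equal the finite sum \<open>S\<close>; Cauchy-Schwarz
  then bounds \<open>S\<^sup>2\<close> by \<open>S\<close> times the squared norm of
  \<open>w\<close>.\<close>

lemma torus_bessel:
  assumes w: "w \<in> L2 torus_measure"
  shows "square_summable (torus_fourier w)"
proof -
  let ?k = "torus_fourier w"
  have fin: "(\<Sum>p\<in>F. (cmod (?k p))\<^sup>2) \<le> (LINT \<zeta>|torus_measure. (cmod (w \<zeta>))\<^sup>2)" if F: "finite F" for F
  proof -
    define S where "S = (\<Sum>p\<in>F. (cmod (?k p))\<^sup>2)"
    define c where "c p = (if p \<in> F then ?k p else 0)" for p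
    define q where "q \<zeta> = (\<Sum>p\<in>F. ?k p * bimonom p \<zeta>)" for \<zeta>
    have q: "((\<lambda>p. c p * bimonom p \<zeta>) has_sum q \<zeta>) UNIV" for \<zeta>
      by (rule has_sum_finite_neutralI[of F]) (auto simp: F q_def c_def)
    have qL: "q \<in> L2 torus_measure"
      unfolding q_def by (intro continuous_torus_L2 continuous_intros)
    have s: "((\<lambda>p. (cmod (c p))\<^sup>2) has_sum S) UNIV"
      by (rule has_sum_finite_neutralI[of F]) (auto simp: F S_def c_def)
    have "((\<lambda>p. c p * cnj (?k p)) has_sum (LINT \<zeta>|torus_measure. q \<zeta> * cnj (w \<zeta>))) UNIV"
      using torus_series_integral(2)[OF q integrable_cnj_L2[OF w]] by (simp add: cnj_torus_fourier)
    also have "(\<lambda>p. c p * cnj (?k p)) = (\<lambda>p. complex_of_real ((cmod (c p))\<^sup>2))"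
      by (auto simp: c_def fun_eq_iff complex_norm_square[symmetric])
    finally have "(LINT \<zeta>|torus_measure. q \<zeta> * cnj (w \<zeta>)) = of_real S"
      using has_sum_of_real[OF s, where 'a = complex] by (rule has_sum_unique)
    moreover have "(LINT \<zeta>|torus_measure. (cmod (q \<zeta>))\<^sup>2) = S"
      using torus_parseval_norm(1)[OF q] s by (rule has_sum_unique)
    ultimately have "S * S \<le> S * (LINT \<zeta>|torus_measure. (cmod (w \<zeta>))\<^sup>2)"
      using Cauchy_Schwarz_L2[OF qL w] by (simp add: power2_eq_square)
    moreover have "0 \<le> (LINT \<zeta>|torus_measure. (cmod (w \<zeta>))\<^sup>2)"
      by (rule Bochner_Integration.integral_nonneg) simp
    moreover have "0 \<le> S" by (auto simp: S_def intro: sum_nonneg)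
    ultimately show ?thesis unfolding S_def[symmetric]
      by (cases "S = 0") auto
  qed
  show ?thesis
    by (rule nonneg_bdd_above_summable_on)
       (auto intro!: bdd_aboveI2[of _ _ "LINT \<zeta>|torus_measure. (cmod (w \<zeta>))\<^sup>2"] fin)
qed

text \<open>For \<open>r < 1\<close> the series of the dilation converges absolutely on the torus
  and may be integrated against \<open>w\<close> term by term. Both sides converge as
  \<open>r\<close> tends to 1: the sum by dominated convergence, the integral by L2 convergence of
  the dilations.\<close>

lemma hardy_fourier_infsum:
  assumes f: "f \<in> hardy2" "L2_boundary f u" and w: "w \<in> L2 torus_measure"
  shows "(\<Sum>\<^sub>\<infinity>p. bidisk_coeff f p * cnj (torus_fourier w p)) = (LINT \<zeta>|torus_measure. u \<zeta> * cnj (w \<zeta>))"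
proof -
  let ?c = "\<lambda>p. bidisk_coeff f p * cnj (torus_fourier w p)"
  have "((\<lambda>r. \<Sum>\<^sub>\<infinity>p. ?c p * of_real (r ^ tdeg p)) \<longlongrightarrow> (\<Sum>\<^sub>\<infinity>p. ?c p * of_real 1)) (at_left 1)"
  proof (rule tendsto_infsum_at_left_1)
    show "?c summable_on UNIV" using f w by (intro square_summable_mult hardy2D torus_bessel)
    show "((\<lambda>r. r ^ tdeg p) \<longlongrightarrow> 1) (at_left (1::real))" for p
    proof -
      have "((\<lambda>r::real. r ^ tdeg p) \<longlongrightarrow> 1 ^ tdeg p) (at_left 1)" by (intro tendsto_intros)
      then show ?thesis by simp
    qed
  qed (simp add: power_le_one)
  then have "((\<lambda>r. \<Sum>\<^sub>\<infinity>p. ?c p * of_real (r ^ tdeg p)) \<longlongrightarrow> infsum ?c UNIV) (at_left 1)" by simp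
  moreover have "\<forall>\<^sub>F r in at_left 1. (\<Sum>\<^sub>\<infinity>p. ?c p * of_real (r ^ tdeg p)) =
      (LINT \<zeta>|torus_measure. f (r *\<^sub>R \<zeta>) * cnj (w \<zeta>))"
    using eventually_at_left_unit
  proof eventually_elim
    case (elim r)
    have "((\<lambda>p. bidisk_coeff f p * of_real r ^ tdeg p * cnj (torus_fourier w p)) has_sum
        (LINT \<zeta>|torus_measure. f (r *\<^sub>R \<zeta>) * cnj (w \<zeta>))) UNIV"
      using elim torus_series_integral(2)[OF has_sum_on_torus[OF hardy2D(1)[OF f(1)], of r] integrable_cnj_L2[OF w]]
      by (simp add: cnj_torus_fourier)
    then show ?case by (intro infsumI) (simp add: mult_ac)
  qed
  ultimately have "((\<lambda>r. LINT \<zeta>|torus_measure. f (r *\<^sub>R \<zeta>) * cnj (w \<zeta>)) \<longlongrightarrow> infsum ?c UNIV) (at_left 1)"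
    by (rule Lim_transform_eventually)
  then show ?thesis
    using L2_boundary_integral_tendsto[OF f w] by (rule tendsto_unique[rotated]) simp
qed

text \<open>The dilations have Fourier coefficients \<open>bidisk_coeff f p * r ^ tdeg p\<close>;
  let \<open>r\<close> tend to 1.\<close>

lemma torus_fourier_boundary:
  assumes f: "f \<in> hardy2" "L2_boundary f u"
  shows "torus_fourier u = bidisk_coeff f"
proof
  fix p
  have "((\<lambda>r. LINT \<zeta>|torus_measure. f (r *\<^sub>R \<zeta>) * cnj (bimonom p \<zeta>)) \<longlongrightarrow> torus_fourier u p) (at_left 1)"
    unfolding torus_fourier_def
    by (intro L2_boundary_integral_tendsto f continuous_torus_L2 continuous_intros)
  moreover have "\<forall>\<^sub>F r in at_left 1. (LINT \<zeta>|torus_measure. f (r *\<^sub>R \<zeta>) * cnj (bimonom p \<zeta>)) =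
      bidisk_coeff f p * of_real r ^ tdeg p"
    using eventually_at_left_unit
    by eventually_elim (simp add: dilation_coeff[OF hardy2D(1)[OF f(1)]])
  ultimately have "((\<lambda>r. bidisk_coeff f p * of_real r ^ tdeg p) \<longlongrightarrow> torus_fourier u p) (at_left 1)"
    by (rule Lim_transform_eventually)
  moreover have "((\<lambda>r. bidisk_coeff f p * of_real r ^ tdeg p) \<longlongrightarrow> bidisk_coeff f p * of_real 1 ^ tdeg p) (at_left 1)"
    by (intro tendsto_intros)
  ultimately have "torus_fourier u p = bidisk_coeff f p * of_real 1 ^ tdeg p"
    by (rule tendsto_unique[rotated]) simp
  then show "torus_fourier u p = bidisk_coeff f p" by simp
qed

text \<open>The bridge between coefficients and the torus: in \<open>hardy_fourier_infsum\<close>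
  the function \<open>w\<close> is taken to be the boundary function of \<open>g\<close>.\<close>

theorem hardy_inner_eq_boundary_integral:
  assumes f: "f \<in> hardy2" "L2_boundary f u" and g: "g \<in> hardy2" "L2_boundary g v"
  shows "hardy_inner f g = (LINT \<zeta>|torus_measure. u \<zeta> * cnj (v \<zeta>))"
  unfolding hardy_inner_def torus_fourier_boundary[OF g, symmetric]
  using g by (intro hardy_fourier_infsum f) (simp add: L2_boundary_def)

text \<open>The function \<open>k\<close> is the orthogonal projection of \<open>w\<close> to
  \<open>H\<^sup>2\<close>, written down by its coefficients; Bessel's inequality makes them square
  summable.\<close>

lemma szego_projection:
  assumes "w \<in> L2 torus_measure"
  obtains k where "k \<in> hardy2"
    "\<And>h v. h \<in> hardy2 \<Longrightarrow> L2_boundary h v \<Longrightarrow>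
       hardy_inner h k = (LINT \<zeta>|torus_measure. v \<zeta> * cnj (w \<zeta>))"
proof -
  obtain k where "k \<in> hardy2" "bidisk_coeff k = torus_fourier w"
    using hardy2_exists[OF torus_bessel[OF assms]] by blast
  with hardy_fourier_infsum[OF _ _ assms] show ?thesis
    by (intro that[of k]) (auto simp: hardy_inner_def)
qed

section \<open>Boundary functions of inner functions\<close>

lemma inner_function_radial_limit:
  assumes "inner_function \<psi>"
  obtains c where "c \<in> borel_measurable torus_measure"
    "AE \<zeta> in torus_measure. cmod (c \<zeta>) = 1 \<and> ((\<lambda>r. \<psi> (r *\<^sub>R \<zeta>)) \<longlongrightarrow> c \<zeta>) (at_left 1)"
proof -
  \<comment> \<open>The shift by 2 keeps all radii strictly between 0 and 1.\<close>
  define q where "q n = 1 - 1 / real (n + 2)" for n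
  have q: "0 < q n" "q n < 1" for n by (auto simp: q_def field_simps)
  have "q \<longlonglongrightarrow> 1 - 0" unfolding q_def[abs_def] by (intro tendsto_diff tendsto_const LIMSEQ_ignore_initial_segment lim_1_over_n)
  then have qlim: "filterlim q (at_left 1) sequentially"
    using q by (intro tendsto_imp_filterlim_at_left) auto
  \<comment> \<open>The definition of inner functions yields a limit at almost every point but no
    measurable function of the point. A limit along one fixed sequence of radii is measurable and
    agrees with it almost everywhere.\<close>
  define c where "c \<zeta> = lim (\<lambda>n. \<psi> (q n *\<^sub>R \<zeta>))" for \<zeta>
  have hol: "holomorphic_on_bidisk \<psi>" using assms by (simp add: inner_function_def)
  have [measurable]: "(\<lambda>\<zeta>. \<psi> (q n *\<^sub>R \<zeta>)) \<in> borel_measurable torus_measure" for n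
    using hol q by (intro measurable_dilation)
  show ?thesis
  proof (rule that)
    show "c \<in> borel_measurable torus_measure" unfolding c_def by measurable
    have "AE \<zeta> in torus_measure. \<exists>b. cmod b = 1 \<and> (\<forall>M>1. (\<psi> \<longlongrightarrow> b) (at \<zeta> within stolz_region M \<zeta>))"
      using assms by (simp add: inner_function_def)
    then show "AE \<zeta> in torus_measure. cmod (c \<zeta>) = 1 \<and> ((\<lambda>r. \<psi> (r *\<^sub>R \<zeta>)) \<longlongrightarrow> c \<zeta>) (at_left 1)"
      using AE_space
    proof eventually_elim
      case (elim \<zeta>)
      \<comment> \<open>Any aperture above 1 would serve: a radial point has distance exactly
        \<open>1 - r\<close> in each coordinate, so it lies in the region by a strict
        inequality.\<close>
      then obtain b where b: "cmod b = 1" "(\<psi> \<longlongrightarrow> b) (at \<zeta> within stolz_region 2 \<zeta>)" by force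
      have \<zeta>: "cmod (fst \<zeta>) = 1" "cmod (snd \<zeta>) = 1" using elim by (auto simp: torus_def)
      have "filterlim (\<lambda>r::real. r *\<^sub>R \<zeta>) (at \<zeta> within stolz_region 2 \<zeta>) (at_left 1)"
        unfolding filterlim_at
      proof
        have "((\<lambda>r::real. r *\<^sub>R \<zeta>) \<longlongrightarrow> 1 *\<^sub>R \<zeta>) (at_left 1)" by (intro tendsto_intros)
        then show "((\<lambda>r::real. r *\<^sub>R \<zeta>) \<longlongrightarrow> \<zeta>) (at_left 1)" by simp
        show "\<forall>\<^sub>F r::real in at_left 1. r *\<^sub>R \<zeta> \<in> stolz_region 2 \<zeta> \<and> r *\<^sub>R \<zeta> \<noteq> \<zeta>"
          using eventually_at_left_unit
        proof eventually_elim
          case (elim r)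
          have d: "cmod (r *\<^sub>R w - w) = 1 - r" if "cmod w = 1" for w
          proof -
            have "r *\<^sub>R w - w = (r - 1) *\<^sub>R w" by (simp add: algebra_simps)
            then show ?thesis using that elim by (simp only: norm_scaleR) simp
          qed
          have "r *\<^sub>R \<zeta> \<noteq> \<zeta>" using d[OF \<zeta>(1)] elim by (auto simp: prod_eq_iff)
          then show ?case using elim \<zeta> d[OF \<zeta>(1)] d[OF \<zeta>(2)] by (auto simp: stolz_region_def)
        qed
      qed
      with b(2) have lim: "((\<lambda>r. \<psi> (r *\<^sub>R \<zeta>)) \<longlongrightarrow> b) (at_left 1)" by (rule filterlim_compose)
      then have "(\<lambda>n. \<psi> (q n *\<^sub>R \<zeta>)) \<longlonglongrightarrow> b" using qlim by (rule filterlim_compose)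
      then have "c \<zeta> = b" by (simp add: c_def limI)
      with b lim show ?case by simp
    qed
  qed
qed

lemma unimodular_mult_L2:
  assumes [measurable]: "c \<in> borel_measurable M" and c: "AE x in M. cmod (c x) = 1" and u: "u \<in> L2 M"
  shows "(\<lambda>x. c x * u x) \<in> L2 M"
proof -
  note [measurable] = L2_measurable[OF u]
  have "(\<integral>\<^sup>+x. ennreal ((cmod (c x * u x))\<^sup>2) \<partial>M) = (\<integral>\<^sup>+x. ennreal ((cmod (u x))\<^sup>2) \<partial>M)"
    using c by (intro nn_integral_cong_AE) (auto simp: norm_mult)
  then show ?thesis using u by (simp add: L2_iff_nn_integral)
qed

text \<open>With subscript \<open>r\<close> for dilation, \<open>\<psi>\<^sub>r f\<^sub>r - c u =
  \<psi>\<^sub>r (f\<^sub>r - u) + (\<psi>\<^sub>r - c) u\<close>. The first term is small by the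
  bound on \<psi>, the second by dominated convergence, which is why the limit is taken along
  sequences of radii.\<close>

lemma L2_boundary_mult:
  assumes psi: "holomorphic_on_bidisk \<psi>" "\<And>z. z \<in> bidisk \<Longrightarrow> cmod (\<psi> z) \<le> B"
    and c: "c \<in> borel_measurable torus_measure"
      "AE \<zeta> in torus_measure. cmod (c \<zeta>) = 1 \<and> ((\<lambda>r. \<psi> (r *\<^sub>R \<zeta>)) \<longlongrightarrow> c \<zeta>) (at_left 1)"
    and f: "holomorphic_on_bidisk f" "L2_boundary f u"
  shows "L2_boundary (\<lambda>z. \<psi> z * f z) (\<lambda>\<zeta>. c \<zeta> * u \<zeta>)"
proof -
  let ?N = "\<lambda>w. \<integral>\<^sup>+ \<zeta>. ennreal ((cmod (w \<zeta>))\<^sup>2) \<partial>torus_measure"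
  have u: "u \<in> L2 torus_measure" using f by (simp add: L2_boundary_def)
  note [measurable] = c(1) L2_measurable[OF u]
  have cu: "(\<lambda>\<zeta>. c \<zeta> * u \<zeta>) \<in> L2 torus_measure"
    using c u by (intro unimodular_mult_L2) auto
  have B: "0 \<le> B" by (rule order_trans[OF norm_ge_zero psi(2)[of "(0, 0)"]]) (simp add: bidisk_def)
  have "((\<lambda>r. ?N (\<lambda>\<zeta>. \<psi> (r *\<^sub>R \<zeta>) * f (r *\<^sub>R \<zeta>) - c \<zeta> * u \<zeta>)) \<longlongrightarrow> 0) (at_left 1)"
  proof (rule tendsto_at_left_sequentially[of 0])
    fix S :: "nat \<Rightarrow> real" assume S: "\<And>n. S n < 1" "\<And>n. 0 < S n" "S \<longlonglongrightarrow> 1"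
    have Sl: "filterlim S (at_left 1) sequentially"
      using S by (intro tendsto_imp_filterlim_at_left) auto
    have [measurable]: "(\<lambda>\<zeta>. \<psi> (S n *\<^sub>R \<zeta>)) \<in> borel_measurable torus_measure"
      "(\<lambda>\<zeta>. f (S n *\<^sub>R \<zeta>)) \<in> borel_measurable torus_measure" for n
      using S psi(1) f(1) by (auto intro: measurable_dilation)
    have bd: "cmod (\<psi> (S n *\<^sub>R \<zeta>)) \<le> B" if "\<zeta> \<in> torus" for n \<zeta>
      using that S by (intro psi(2) scaleR_torus_in_bidisk) (auto intro: less_imp_le)
    have 1: "(\<lambda>n. ?N (\<lambda>\<zeta>. f (S n *\<^sub>R \<zeta>) - u \<zeta>)) \<longlonglongrightarrow> 0"
      using f(2)[unfolded L2_boundary_def, THEN conjunct2] Sl by (rule filterlim_compose)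
    have "(\<lambda>n. \<integral>\<^sup>+ \<zeta>. ennreal ((cmod ((\<psi> (S n *\<^sub>R \<zeta>) - c \<zeta>) * u \<zeta>))\<^sup>2) \<partial>torus_measure) \<longlonglongrightarrow>
        (\<integral>\<^sup>+ \<zeta>. 0 \<partial>torus_measure)"
    \<comment> \<open>\<open>B + 1\<close> bounds
      \<open>\<psi> (S n *\<^sub>R \<zeta>) - c \<zeta>\<close> almost everywhere, since
      \<open>c\<close> is unimodular.\<close>
    proof (rule nn_integral_dominated_convergence[where w = "\<lambda>\<zeta>. ennreal ((B + 1)\<^sup>2) * ennreal ((cmod (u \<zeta>))\<^sup>2)"])
      show "AE \<zeta> in torus_measure. ennreal ((cmod ((\<psi> (S n *\<^sub>R \<zeta>) - c \<zeta>) * u \<zeta>))\<^sup>2) \<le>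
         ennreal ((B + 1)\<^sup>2) * ennreal ((cmod (u \<zeta>))\<^sup>2)" for n
        using c(2) AE_space
      proof eventually_elim
        case (elim \<zeta>)
        have "cmod (\<psi> (S n *\<^sub>R \<zeta>) - c \<zeta>) \<le> B + 1"
          using elim bd[of \<zeta> n] norm_triangle_ineq4[of "\<psi> (S n *\<^sub>R \<zeta>)" "c \<zeta>"] by simp
        then have "(cmod ((\<psi> (S n *\<^sub>R \<zeta>) - c \<zeta>) * u \<zeta>))\<^sup>2 \<le> (B + 1)\<^sup>2 * (cmod (u \<zeta>))\<^sup>2"
          by (simp add: norm_mult power_mult_distrib mult_right_mono power_mono)
        then show ?case by (simp flip: ennreal_mult add: ennreal_leI)
      qed
      show "(\<integral>\<^sup>+ \<zeta>. ennreal ((B + 1)\<^sup>2) * ennreal ((cmod (u \<zeta>))\<^sup>2) \<partial>torus_measure) < \<infinity>"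
        using u by (subst nn_integral_cmult) (auto simp: L2_iff_nn_integral ennreal_mult_less_top)
      show "AE \<zeta> in torus_measure. (\<lambda>n. ennreal ((cmod ((\<psi> (S n *\<^sub>R \<zeta>) - c \<zeta>) * u \<zeta>))\<^sup>2)) \<longlonglongrightarrow> 0"
        using c(2)
      proof eventually_elim
        case (elim \<zeta>)
        then have "(\<lambda>n. \<psi> (S n *\<^sub>R \<zeta>)) \<longlonglongrightarrow> c \<zeta>"
          by (intro filterlim_compose[OF conjunct2 Sl])
        then have "(\<lambda>n. ennreal ((cmod ((\<psi> (S n *\<^sub>R \<zeta>) - c \<zeta>) * u \<zeta>))\<^sup>2)) \<longlonglongrightarrow>
            ennreal ((cmod ((c \<zeta> - c \<zeta>) * u \<zeta>))\<^sup>2)"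
          by (intro tendsto_ennrealI tendsto_intros)
        then show ?case by simp
      qed
    qed measurable
    then have 2: "(\<lambda>n. ?N (\<lambda>\<zeta>. (\<psi> (S n *\<^sub>R \<zeta>) - c \<zeta>) * u \<zeta>)) \<longlonglongrightarrow> 0" by simp
    have "(\<lambda>n. 2 * (ennreal (B\<^sup>2) * ?N (\<lambda>\<zeta>. f (S n *\<^sub>R \<zeta>) - u \<zeta>)) +
       2 * ?N (\<lambda>\<zeta>. (\<psi> (S n *\<^sub>R \<zeta>) - c \<zeta>) * u \<zeta>)) \<longlonglongrightarrow> 2 * (ennreal (B\<^sup>2) * 0) + 2 * 0"
      by (intro tendsto_add ennreal_tendsto_cmult 1 2) auto
    then have "(\<lambda>n. 2 * (ennreal (B\<^sup>2) * ?N (\<lambda>\<zeta>. f (S n *\<^sub>R \<zeta>) - u \<zeta>)) +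
       2 * ?N (\<lambda>\<zeta>. (\<psi> (S n *\<^sub>R \<zeta>) - c \<zeta>) * u \<zeta>)) \<longlonglongrightarrow> 0" by simp
    then show "(\<lambda>n. ?N (\<lambda>\<zeta>. \<psi> (S n *\<^sub>R \<zeta>) * f (S n *\<^sub>R \<zeta>) - c \<zeta> * u \<zeta>)) \<longlonglongrightarrow> 0"
    proof (rule tendsto_zero_ennreal_squeeze, intro always_eventually allI)
      fix n
      have "?N (\<lambda>\<zeta>. \<psi> (S n *\<^sub>R \<zeta>) * f (S n *\<^sub>R \<zeta>) - c \<zeta> * u \<zeta>) =
        ?N (\<lambda>\<zeta>. \<psi> (S n *\<^sub>R \<zeta>) * (f (S n *\<^sub>R \<zeta>) - u \<zeta>) + (\<psi> (S n *\<^sub>R \<zeta>) - c \<zeta>) * u \<zeta>)"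
        by (simp add: algebra_simps)
      also have "\<dots> \<le> 2 * ?N (\<lambda>\<zeta>. \<psi> (S n *\<^sub>R \<zeta>) * (f (S n *\<^sub>R \<zeta>) - u \<zeta>)) +
         2 * ?N (\<lambda>\<zeta>. (\<psi> (S n *\<^sub>R \<zeta>) - c \<zeta>) * u \<zeta>)"
        by (rule nn_integral_square_add_le) measurable
      also have "?N (\<lambda>\<zeta>. \<psi> (S n *\<^sub>R \<zeta>) * (f (S n *\<^sub>R \<zeta>) - u \<zeta>)) \<le>
         (\<integral>\<^sup>+ \<zeta>. ennreal (B\<^sup>2) * ennreal ((cmod (f (S n *\<^sub>R \<zeta>) - u \<zeta>))\<^sup>2) \<partial>torus_measure)"
        using bd by (intro nn_integral_mono)
          (auto simp: norm_mult power_mult_distrib simp flip: ennreal_mult intro!: ennreal_leI mult_right_mono power_mono)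
      also have "\<dots> = ennreal (B\<^sup>2) * ?N (\<lambda>\<zeta>. f (S n *\<^sub>R \<zeta>) - u \<zeta>)"
        by (rule nn_integral_cmult) measurable
      finally show "?N (\<lambda>\<zeta>. \<psi> (S n *\<^sub>R \<zeta>) * f (S n *\<^sub>R \<zeta>) - c \<zeta> * u \<zeta>) \<le>
        2 * (ennreal (B\<^sup>2) * ?N (\<lambda>\<zeta>. f (S n *\<^sub>R \<zeta>) - u \<zeta>)) + 2 * ?N (\<lambda>\<zeta>. (\<psi> (S n *\<^sub>R \<zeta>) - c \<zeta>) * u \<zeta>)"
        by (simp add: add_mono mult_left_mono)
    qed
  qed simp
  with cu show ?thesis by (simp add: L2_boundary_def)
qed

section \<open>Inner functions and model spaces\<close>

lemma inner_function_hol: "inner_function \<psi> \<Longrightarrow> holomorphic_on_bidisk \<psi>"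
  by (simp add: inner_function_def)

lemma inner_function_bounded:
  assumes "inner_function \<psi>"
  obtains B where "\<And>z. z \<in> bidisk \<Longrightarrow> cmod (\<psi> z) \<le> B"
  using assms by (auto simp: inner_function_def bounded_iff)

lemma inner_mult_hardy2:
  assumes "inner_function \<psi>" "f \<in> hardy2"
  shows "(\<lambda>z. \<psi> z * f z) \<in> hardy2"
  using assms inner_function_bounded[OF assms(1)] by (metis hardy2_mult_bounded inner_function_hol)

text \<open>Packages what later arguments use of the radial limits: a measurable unimodular function
  that represents multiplication by \<psi> on boundary functions.\<close>

lemma inner_function_boundary:
  assumes "inner_function \<psi>"
  obtains c where "c \<in> borel_measurable torus_measure" "AE \<zeta> in torus_measure. cmod (c \<zeta>) = 1"
    "\<And>f u. holomorphic_on_bidisk f \<Longrightarrow> L2_boundary f u \<Longrightarrow> L2_boundary (\<lambda>z. \<psi> z * f z) (\<lambda>\<zeta>. c \<zeta> * u \<zeta>)"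
proof -
  obtain B where B: "\<And>z. z \<in> bidisk \<Longrightarrow> cmod (\<psi> z) \<le> B" using inner_function_bounded[OF assms] by blast
  obtain c where c: "c \<in> borel_measurable torus_measure"
    "AE \<zeta> in torus_measure. cmod (c \<zeta>) = 1 \<and> ((\<lambda>r. \<psi> (r *\<^sub>R \<zeta>)) \<longlongrightarrow> c \<zeta>) (at_left 1)"
    using inner_function_radial_limit[OF assms] by blast
  show ?thesis
  proof (rule that[OF c(1)])
    show "AE \<zeta> in torus_measure. cmod (c \<zeta>) = 1" using c(2) by eventually_elim simp
  qed (rule L2_boundary_mult[OF inner_function_hol[OF assms] B c])
qed

lemma hardy_inner_inner_mult:
  assumes psi: "inner_function \<psi>" and f: "f \<in> hardy2" and g: "g \<in> hardy2"
  shows "hardy_inner (\<lambda>z. \<psi> z * f z) (\<lambda>z. \<psi> z * g z) = hardy_inner f g"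
proof -
  obtain c where c [measurable]: "c \<in> borel_measurable torus_measure" and c1: "AE \<zeta> in torus_measure. cmod (c \<zeta>) = 1"
    and cb: "\<And>f u. holomorphic_on_bidisk f \<Longrightarrow> L2_boundary f u \<Longrightarrow> L2_boundary (\<lambda>z. \<psi> z * f z) (\<lambda>\<zeta>. c \<zeta> * u \<zeta>)"
    using inner_function_boundary[OF psi] by blast
  define u where "u = boundary_value f"
  define v where "v = boundary_value g"
  have u: "L2_boundary f u" and v: "L2_boundary g v"
    unfolding u_def v_def by (auto intro: hardy2_L2_boundary f g)
  then have [measurable]: "u \<in> borel_measurable torus_measure" "v \<in> borel_measurable torus_measure"
    by (auto simp: L2_boundary_def intro: L2_measurable)
  have "hardy_inner (\<lambda>z. \<psi> z * f z) (\<lambda>z. \<psi> z * g z) =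
     (LINT \<zeta>|torus_measure. (c \<zeta> * u \<zeta>) * cnj (c \<zeta> * v \<zeta>))"
    using f g by (intro hardy_inner_eq_boundary_integral inner_mult_hardy2 psi cb u v hardy2D)
  also have "\<dots> = (LINT \<zeta>|torus_measure. u \<zeta> * cnj (v \<zeta>))"
  proof (rule integral_cong_AE)
    show "AE \<zeta> in torus_measure. (c \<zeta> * u \<zeta>) * cnj (c \<zeta> * v \<zeta>) = u \<zeta> * cnj (v \<zeta>)"
      using c1
    proof eventually_elim
      case (elim \<zeta>)
      then have "c \<zeta> * cnj (c \<zeta>) = 1" by (simp flip: complex_norm_square)
      moreover have "(c \<zeta> * u \<zeta>) * cnj (c \<zeta> * v \<zeta>) = (c \<zeta> * cnj (c \<zeta>)) * (u \<zeta> * cnj (v \<zeta>))" by simp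
      ultimately show ?case by simp
    qed
  qed measurable
  also have "\<dots> = hardy_inner f g"
    by (rule hardy_inner_eq_boundary_integral[OF f u g v, symmetric])
  finally show ?thesis .
qed

text \<open>Turns invariance of \<open>hardy_inner\<close> under multiplication by
  \<open>z\<^sub>1\<close> into an instance of \<open>hardy_inner_inner_mult\<close>.\<close>

lemma inner_function_fst: "inner_function fst"
  unfolding inner_function_def
proof (intro conjI)
  show "holomorphic_on_bidisk fst"
    unfolding holomorphic_on_bidisk_def
    by (intro ballI exI[of _ 1] exI[of _ 0]) (auto intro!: derivative_eq_intros)
  show "bounded (fst ` bidisk :: complex set)"
    by (auto simp: bounded_iff bidisk_def intro!: exI[of _ 1])
  show "AE \<zeta> in torus_measure. \<exists>c. cmod c = 1 \<and> (\<forall>M>1. (fst \<longlongrightarrow> c) (at \<zeta> within stolz_region M \<zeta>))"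
    by (rule AE_I2, rule exI[of _ "fst _"]) (auto simp: torus_def intro!: tendsto_intros)
qed

section \<open>Projections onto model spaces\<close>

lemma model_spaceD:
  assumes "f \<in> model_space \<phi>"
  shows "f \<in> hardy2" "h \<in> hardy2 \<Longrightarrow> hardy_inner f (\<lambda>z. \<phi> z * h z) = 0"
  using assms by (auto simp: model_space_def)

lemma model_space_diff:
  assumes "inner_function \<phi>" "f \<in> model_space \<phi>" "g \<in> model_space \<phi>"
  shows "(\<lambda>z. f z - g z) \<in> model_space \<phi>"
  using assms unfolding model_space_def
  by (auto simp: hardy_inner_diff_left inner_mult_hardy2 hardy2_diff)

lemma model_space_add:
  assumes "inner_function \<phi>" "f \<in> model_space \<phi>" "g \<in> model_space \<phi>"
  shows "(\<lambda>z. f z + g z) \<in> model_space \<phi>"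
  using assms unfolding model_space_def
  by (auto simp: hardy_inner_add_left inner_mult_hardy2 hardy2_add)

lemma hardy_inner_diff_self_eq_0:
  assumes f: "f \<in> hardy2" and g: "g \<in> hardy2"
    and "hardy_inner (\<lambda>z. f z - g z) (\<lambda>z. f z - g z) = 0"
  shows "f = g"
  using hardy_inner_self_eq_0[OF hardy2_diff(1)[OF f g] assms(3)] by (auto simp: fun_eq_iff)

text \<open>Evaluates the projection on arguments whose splitting along
  \<open>K\<^sub>\<phi>\<close> and \<open>\<phi> H\<^sup>2\<close> is already visible. Both
  arguments of \<open>model_proj\<close> in \<open>U1\<close> can be brought to this form.\<close>

lemma model_proj_eq:
  assumes phi: "inner_function \<phi>" and G: "G \<in> model_space \<phi>" and H: "H \<in> hardy2"
  shows "model_proj \<phi> (\<lambda>z. G z + \<phi> z * H z) = G"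
  unfolding model_proj_def
proof (rule the_equality, intro conjI ballI G)
  note GH = model_spaceD(1)[OF G] inner_mult_hardy2[OF phi H]
  have orth: "hardy_inner (\<lambda>z. \<phi> z * H z) h = 0" if "h \<in> model_space \<phi>" for h
    using that model_spaceD[OF that] H hardy_inner_commute[OF _ GH(2), of h] by simp
  show "hardy_inner (\<lambda>z. G z + \<phi> z * H z - G z) h = 0" if "h \<in> model_space \<phi>" for h
    using orth[OF that] by simp
  fix g assume "g \<in> model_space \<phi> \<and> (\<forall>h\<in>model_space \<phi>. hardy_inner (\<lambda>z. G z + \<phi> z * H z - g z) h = 0)"
  then have g: "g \<in> model_space \<phi>" and 0: "\<And>h. h \<in> model_space \<phi> \<Longrightarrow> hardy_inner (\<lambda>z. G z + \<phi> z * H z - g z) h = 0"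
    by auto
  note gh = model_spaceD(1)[OF g]
  let ?d = "\<lambda>z. G z - g z"
  have d: "?d \<in> model_space \<phi>" by (rule model_space_diff[OF phi G g])
  \<comment> \<open>Testing the competitor \<open>g\<close> against \<open>G - g\<close>: the part
    \<open>\<phi> H\<close> is orthogonal to this difference, so its norm is 0.\<close>
  have "hardy_inner (\<lambda>z. (G z + \<phi> z * H z - g z) - \<phi> z * H z) ?d = 0"
    using 0[OF d] orth[OF d] GH gh
    by (subst hardy_inner_diff_left) (auto intro!: hardy2_diff hardy2_add model_spaceD[OF d])
  then have "hardy_inner ?d ?d = 0" by (simp add: algebra_simps)
  then show "g = G" using hardy_inner_diff_self_eq_0[OF GH(1) gh] by simp
qed

lemma hardy_z2_hardy2: "f \<in> hardy_z2 \<Longrightarrow> f \<in> hardy2"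
  by (simp add: hardy_z2_iff)

lemma hardy_z2_cmult: "f \<in> hardy_z2 \<Longrightarrow> (\<lambda>z. c * f z) \<in> hardy_z2"
  by (auto simp: hardy_z2_iff hardy2_cmult)

lemma hardy_z2_diff: "f \<in> hardy_z2 \<Longrightarrow> g \<in> hardy_z2 \<Longrightarrow> (\<lambda>z. f z - g z) \<in> hardy_z2"
  by (auto simp: hardy_z2_iff hardy2_diff)

section \<open>Model spaces for the factorization of \<phi> as
  \<open>z\<^sub>1 \<psi>\<close>\<close>

locale inner_factor =
  fixes \<phi> \<psi> :: "complex \<times> complex \<Rightarrow> complex"
  assumes phi: "inner_function \<phi>" and psi: "inner_function \<psi>"
    and factor: "\<And>z. z \<in> bidisk \<Longrightarrow> \<phi> z = fst z * \<psi> z"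
begin

text \<open>The factorization is known on the bidisk only; elsewhere \<open>h\<close> is 0. The two
  groupings, here and in \<open>phi_mult'\<close>, determine which factor can be cancelled in an
  inner product: \<open>z\<^sub>1\<close> when testing \<open>z\<^sub>1 f\<^sub>1\<close>, and
  \<psi> when testing \<open>\<psi> f\<^sub>2\<close>.\<close>

lemma phi_mult: "h \<in> hardy2 \<Longrightarrow> (\<lambda>z. \<phi> z * h z) = (\<lambda>z. fst z * (\<psi> z * h z))"
  using factor hardy2D(3) by (fastforce simp: fun_eq_iff)

lemma phi_mult': "h \<in> hardy2 \<Longrightarrow> (\<lambda>z. \<phi> z * h z) = (\<lambda>z. \<psi> z * (fst z * h z))"
  by (simp add: phi_mult mult_ac)

lemma model_space_psi_subset: "f \<in> model_space \<psi> \<Longrightarrow> f \<in> model_space \<phi>"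
  by (simp add: model_space_def phi_mult' hardy2_mult_fst)

lemma fst_mult_model_space:
  assumes "f \<in> model_space \<psi>"
  shows "(\<lambda>z. fst z * f z) \<in> model_space \<phi>"
  using assms
  by (simp add: model_space_def phi_mult hardy2_mult_fst inner_mult_hardy2[OF psi]
      hardy_inner_inner_mult[OF inner_function_fst])

lemma hardy_z2_model_space:
  assumes "f \<in> hardy_z2"
  shows "f \<in> model_space \<phi>"
  using assms
  by (simp add: model_space_def phi_mult hardy_z2_hardy2 hardy_inner_z2_mult_fst inner_mult_hardy2[OF psi])

lemma psi_mult_model_space:
  assumes "f \<in> hardy_z2"
  shows "(\<lambda>z. \<psi> z * f z) \<in> model_space \<phi>"
  using assms
  by (simp add: model_space_def phi_mult' hardy_z2_hardy2 hardy2_mult_fst inner_mult_hardy2[OF psi]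
      hardy_inner_inner_mult[OF psi] hardy_inner_z2_mult_fst)

text \<open>The second component is \<open>f\<^sub>2 = P (cnj \<psi> f)\<close>, where \<open>P\<close> projects \<open>L\<^sup>2\<close> onto \<open>H\<^sup>2\<close>;
  orthogonality of \<open>f\<close> to \<open>z\<^sub>1 \<psi> H\<^sup>2\<close> forces it to depend on \<open>z\<^sub>2\<close> only.\<close>

lemma model_space_decomposition:
  assumes f: "f \<in> model_space \<phi>"
  obtains f1 f2 where "f1 \<in> model_space \<psi>" "f2 \<in> hardy_z2" "f = (\<lambda>z. f1 z + \<psi> z * f2 z)"
proof -
  note fD = model_spaceD[OF f]
  obtain c where c [measurable]: "c \<in> borel_measurable torus_measure" and c1: "AE \<zeta> in torus_measure. cmod (c \<zeta>) = 1"
    and cb: "\<And>f u. holomorphic_on_bidisk f \<Longrightarrow> L2_boundary f u \<Longrightarrow> L2_boundary (\<lambda>z. \<psi> z * f z) (\<lambda>\<zeta>. c \<zeta> * u \<zeta>)"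
    using inner_function_boundary[OF psi] by blast
  define u where "u = boundary_value f"
  have u: "L2_boundary f u" unfolding u_def by (rule hardy2_L2_boundary[OF fD(1)])
  define w where "w \<zeta> = cnj (c \<zeta>) * u \<zeta>" for \<zeta>
  have "w \<in> L2 torus_measure"
    unfolding w_def using u c1 by (intro unimodular_mult_L2) (auto simp: L2_boundary_def)
  then obtain k where k: "k \<in> hardy2"
    and kw: "\<And>h v. h \<in> hardy2 \<Longrightarrow> L2_boundary h v \<Longrightarrow> hardy_inner h k = (LINT \<zeta>|torus_measure. v \<zeta> * cnj (w \<zeta>))"
    using szego_projection by blast
  \<comment> \<open>Thus \<open>k\<close> is the image of \<open>f\<close> under the adjoint of
    multiplication by \<psi>.\<close>
  have eq: "hardy_inner h k = hardy_inner (\<lambda>z. \<psi> z * h z) f" if h: "h \<in> hardy2" for h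
  proof -
    note v = hardy2_L2_boundary[OF h]
    have "hardy_inner (\<lambda>z. \<psi> z * h z) f = (LINT \<zeta>|torus_measure. (c \<zeta> * boundary_value h \<zeta>) * cnj (u \<zeta>))"
      using h fD(1) by (intro hardy_inner_eq_boundary_integral inner_mult_hardy2 psi cb v u hardy2D)
    then show ?thesis by (simp add: kw[OF h v] w_def mult_ac)
  qed
  obtain k0 k' where kk: "k0 \<in> hardy_z2" "k' \<in> hardy2" "k = (\<lambda>z. k0 z + fst z * k' z)"
    using hardy2_split_fst[OF k] by blast
  note z1k = hardy2_mult_fst(1)[OF kk(2)]
  \<comment> \<open>The part of \<open>k\<close> divisible by \<open>z\<^sub>1\<close> is tested
    against \<open>k\<close>. The result vanishes because \<open>f\<close> is orthogonal to
    \<open>\<phi> k'\<close>, and it equals the squared norm of that part because \<open>k0\<close>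
    is orthogonal to it.\<close>
  have "hardy_inner (\<lambda>z. fst z * k' z) k = hardy_inner (\<lambda>z. \<phi> z * k' z) f"
    by (simp add: eq z1k phi_mult'[OF kk(2)])
  also have "\<dots> = 0"
    using fD(2)[OF kk(2)] hardy_inner_commute[OF fD(1) inner_mult_hardy2[OF phi kk(2)]] by simp
  also have "hardy_inner (\<lambda>z. fst z * k' z) k =
      hardy_inner (\<lambda>z. fst z * k' z) k0 + hardy_inner (\<lambda>z. fst z * k' z) (\<lambda>z. fst z * k' z)"
    unfolding kk(3) by (rule hardy_inner_add_right[OF hardy_z2_hardy2[OF kk(1)] z1k z1k])
  also have "hardy_inner (\<lambda>z. fst z * k' z) k0 = 0"
    using hardy_inner_z2_mult_fst[OF kk(1,2)] hardy_inner_commute[OF hardy_z2_hardy2[OF kk(1)] z1k] by simp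
  finally have "(\<lambda>z. fst z * k' z) = (\<lambda>z. 0)"
    by (intro hardy_inner_self_eq_0 z1k) simp
  then have "k = k0" using kk(3) by (simp add: fun_eq_iff)
  with kk have kz: "k \<in> hardy_z2" by simp
  note pk = inner_mult_hardy2[OF psi k]
  show ?thesis
  proof (rule that[OF _ kz])
    show "(\<lambda>z. f z - \<psi> z * k z) \<in> model_space \<psi>"
      unfolding model_space_def
    proof (intro CollectI conjI ballI hardy2_diff fD(1) pk)
      fix h assume h: "h \<in> hardy2"
      note ph = inner_mult_hardy2[OF psi h]
      have "hardy_inner (\<lambda>z. f z - \<psi> z * k z) (\<lambda>z. \<psi> z * h z) =
        hardy_inner f (\<lambda>z. \<psi> z * h z) - hardy_inner k h"
        by (simp add: hardy_inner_diff_left[OF fD(1) pk ph] hardy_inner_inner_mult[OF psi k h])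
      also have "\<dots> = 0"
        using eq[OF h] hardy_inner_commute[OF h k] hardy_inner_commute[OF ph fD(1)] by simp
      finally show "hardy_inner (\<lambda>z. f z - \<psi> z * k z) (\<lambda>z. \<psi> z * h z) = 0" .
    qed
  qed simp
qed

theorem orthogonal_decomposition:
  "orthogonal_direct_sum (model_space \<phi>) (model_space \<psi>) ((\<lambda>g z. \<psi> z * g z) ` hardy_z2)"
  unfolding orthogonal_direct_sum_def
proof (intro conjI ballI set_eqI iffI)
  fix f assume "f \<in> model_space \<phi>"
  then obtain f1 f2 where "f1 \<in> model_space \<psi>" "f2 \<in> hardy_z2" "f = (\<lambda>z. f1 z + \<psi> z * f2 z)"
    using model_space_decomposition by blast
  then show "f \<in> {(\<lambda>z. f z + g z) |f g. f \<in> model_space \<psi> \<and> g \<in> (\<lambda>g z. \<psi> z * g z) ` hardy_z2}"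
    by (intro CollectI exI[of _ f1] exI[of _ "\<lambda>z. \<psi> z * f2 z"]) auto
next
  fix f assume "f \<in> {(\<lambda>z. f z + g z) |f g. f \<in> model_space \<psi> \<and> g \<in> (\<lambda>g z. \<psi> z * g z) ` hardy_z2}"
  then show "f \<in> model_space \<phi>"
    by (auto intro: model_space_add[OF phi model_space_psi_subset psi_mult_model_space])
next
  fix f g assume "f \<in> model_space \<psi>" "g \<in> (\<lambda>g z. \<psi> z * g z) ` hardy_z2"
  then show "hardy_inner f g = 0" by (auto intro: model_spaceD hardy_z2_hardy2)
qed

text \<open>Points of the dilated torus have nonzero first coordinate, so the branch of
  \<open>backward_shift1\<close> with the derivative is never met, and the denominator of
  \<open>theta1\<close> is 1 since \<phi> vanishes at \<open>z\<^sub>1 = 0\<close>.\<close>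

lemma boundary_value_theta1:
  assumes "\<forall>z2\<in>ball 0 1. \<phi> (0, z2) = 0"
  shows "boundary_value (theta1 \<phi> \<alpha>) = boundary_value (\<lambda>z. \<psi> z * cnj \<alpha>)"
proof -
  have "theta1 \<phi> \<alpha> (r *\<^sub>R \<zeta>) = \<psi> (r *\<^sub>R \<zeta>) * cnj \<alpha>" if r: "0 < r" "r < 1" and \<zeta>: "\<zeta> \<in> torus" for r \<zeta>
  proof -
    have z: "r *\<^sub>R \<zeta> \<in> bidisk" using r \<zeta> by (intro scaleR_torus_in_bidisk) auto
    moreover have "fst (r *\<^sub>R \<zeta>) \<noteq> 0" using r \<zeta> by (auto simp: torus_def)
    moreover have "\<phi> (0, snd (r *\<^sub>R \<zeta>)) = 0" using z assms by (auto simp: bidisk_def simp del: snd_scaleR scaleR_Pair)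
    ultimately show ?thesis
      using factor[OF z] by (simp add: theta1_def backward_shift1_def del: fst_scaleR snd_scaleR scaleR_Pair)
  qed
  then have "L2_boundary (theta1 \<phi> \<alpha>) = L2_boundary (\<lambda>z. \<psi> z * cnj \<alpha>)"
    by (rule L2_boundary_cong)
  then show ?thesis by (simp add: boundary_value_eq)
qed

lemma proj_z2_theta1:
  assumes zero: "\<forall>z2\<in>ball 0 1. \<phi> (0, z2) = 0"
    and f1: "f1 \<in> model_space \<psi>" and f2: "f2 \<in> hardy_z2"
  shows "proj_z2 (\<lambda>\<zeta>. cnj (boundary_value (theta1 \<phi> \<alpha>) \<zeta>) * boundary_value (\<lambda>z. f1 z + \<psi> z * f2 z) \<zeta>) =
    (\<lambda>z. \<alpha> * f2 z)"
proof -
  define g where "g \<zeta> = cnj (boundary_value (theta1 \<phi> \<alpha>) \<zeta>) * boundary_value (\<lambda>z. f1 z + \<psi> z * f2 z) \<zeta>" for \<zeta>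
  obtain c where c [measurable]: "c \<in> borel_measurable torus_measure" and c1: "AE \<zeta> in torus_measure. cmod (c \<zeta>) = 1"
    and cb: "\<And>f u. holomorphic_on_bidisk f \<Longrightarrow> L2_boundary f u \<Longrightarrow> L2_boundary (\<lambda>z. \<psi> z * f z) (\<lambda>\<zeta>. c \<zeta> * u \<zeta>)"
    using inner_function_boundary[OF psi] by blast
  note f1h = model_spaceD(1)[OF f1] and f2h = hardy_z2_hardy2[OF f2]
  note pf2 = inner_mult_hardy2[OF psi f2h]
  define f where "f z = f1 z + \<psi> z * f2 z" for z
  have fh: "f \<in> hardy2" unfolding f_def by (rule hardy2_add(1)[OF f1h pf2])
  note af2 = hardy_z2_cmult[OF f2, of \<alpha>]
  define u1 where "u1 = boundary_value f1"
  define u2 where "u2 = boundary_value f2"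
  have u1: "L2_boundary f1 u1" and u2: "L2_boundary f2 u2"
    unfolding u1_def u2_def by (auto intro: hardy2_L2_boundary f1h f2h)
  have uL: "u1 \<in> L2 torus_measure" "u2 \<in> L2 torus_measure" using u1 u2 by (auto simp: L2_boundary_def)
  \<comment> \<open>The constant is handled through \<open>L2_boundary\<close> and holomorphy, since
    it need not vanish off the bidisk as members of \<open>hardy2\<close> do.\<close>
  have "L2_boundary (\<lambda>z. cnj \<alpha>) (\<lambda>\<zeta>. cnj \<alpha>)"
    by (simp add: L2_boundary_def continuous_torus_L2)
  moreover have hc: "holomorphic_on_bidisk (\<lambda>z. cnj \<alpha>)"
    unfolding holomorphic_on_bidisk_def by (intro ballI exI[of _ 0]) simp
  ultimately have th: "L2_boundary (\<lambda>z. \<psi> z * cnj \<alpha>) (\<lambda>\<zeta>. c \<zeta> * cnj \<alpha>)" by (intro cb)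
  have hol: "holomorphic_on_bidisk (\<lambda>z. \<psi> z * cnj \<alpha>)"
    unfolding holomorphic_on_bidisk_def
  proof
    fix z assume "z \<in> bidisk"
    then obtain a b where "(\<psi> has_derivative (\<lambda>h. a * fst h + b * snd h)) (at z)"
      using inner_function_hol[OF psi] unfolding holomorphic_on_bidisk_def by blast
    from has_derivative_mult_left[OF this, of "cnj \<alpha>"]
    have "((\<lambda>z. \<psi> z * cnj \<alpha>) has_derivative (\<lambda>h. (a * cnj \<alpha>) * fst h + (b * cnj \<alpha>) * snd h)) (at z)"
      by (simp add: algebra_simps)
    then show "\<exists>a b. ((\<lambda>z. \<psi> z * cnj \<alpha>) has_derivative (\<lambda>h. a * fst h + b * snd h)) (at z)" by blast
  qed
  note thb = L2_boundary_boundary_value[OF th]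
  have AEth: "AE \<zeta> in torus_measure. boundary_value (theta1 \<phi> \<alpha>) \<zeta> = c \<zeta> * cnj \<alpha>"
    unfolding boundary_value_theta1[OF zero] by (rule L2_boundary_unique[OF hol thb th])
  have "L2_boundary f (\<lambda>\<zeta>. u1 \<zeta> + c \<zeta> * u2 \<zeta>)"
    unfolding f_def by (intro L2_boundary_add cb u1 u2 hardy2D(4)[OF f1h] hardy2D(4)[OF f2h] hardy2D(4)[OF pf2])
  then have AEf: "AE \<zeta> in torus_measure. boundary_value f \<zeta> = u1 \<zeta> + c \<zeta> * u2 \<zeta>"
    by (rule L2_boundary_unique[OF hardy2D(4)[OF fh] hardy2_L2_boundary[OF fh]])
  define w where "w \<zeta> = cnj (c \<zeta>) * u1 \<zeta>" for \<zeta>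
  have wL: "w \<in> L2 torus_measure"
    unfolding w_def using uL c1 by (intro unimodular_mult_L2) auto
  have AEg: "AE \<zeta> in torus_measure. g \<zeta> = \<alpha> * w \<zeta> + \<alpha> * u2 \<zeta>"
    using AEth AEf c1
  proof eventually_elim
    case (elim \<zeta>)
    then have "cnj (c \<zeta>) * c \<zeta> = 1" by (simp add: mult.commute flip: complex_norm_square)
    moreover have "g \<zeta> = \<alpha> * w \<zeta> + \<alpha> * (cnj (c \<zeta>) * c \<zeta>) * u2 \<zeta>"
      using elim by (simp add: g_def w_def f_def[symmetric] algebra_simps)
    ultimately show ?case by simp
  qed
  have "(\<lambda>\<zeta>. boundary_value (theta1 \<phi> \<alpha>) \<zeta>) \<in> borel_measurable torus_measure"
    unfolding boundary_value_theta1[OF zero] using thb by (auto simp: L2_boundary_def intro: L2_measurable)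
  moreover have "boundary_value f \<in> borel_measurable torus_measure"
    using hardy2_L2_boundary[OF fh] by (auto simp: L2_boundary_def intro: L2_measurable)
  ultimately have gm [measurable]: "g \<in> borel_measurable torus_measure"
    unfolding g_def f_def[symmetric] by measurable
  \<comment> \<open>Translates the integral condition in \<open>proj_z2\<close> into inner products,
    after which \<open>\<alpha> f\<^sub>2\<close> is visibly a solution and uniqueness follows by
    taking \<open>u\<close> to be the difference of two solutions.\<close>
  have key: "(LINT \<zeta>|torus_measure. (g \<zeta> - boundary_value h \<zeta>) * cnj (boundary_value u \<zeta>)) =
      hardy_inner (\<lambda>z. \<alpha> * f2 z) u - hardy_inner h u"
    if h: "h \<in> hardy_z2" and u: "u \<in> hardy_z2" for h u
  proof -
    note hh = hardy_z2_hardy2[OF h] and uh = hardy_z2_hardy2[OF u]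
    note hb = hardy2_L2_boundary[OF hh] and ub = hardy2_L2_boundary[OF uh]
    have L: "boundary_value h \<in> L2 torus_measure" "boundary_value u \<in> L2 torus_measure"
      using hb ub by (auto simp: L2_boundary_def)
    note [measurable] = L[THEN L2_measurable] uL[THEN L2_measurable] wL[THEN L2_measurable]
    note i = integrable_L2_mult[OF wL L(2)] integrable_L2_mult[OF uL(2) L(2)] integrable_L2_mult[OF L(1,2)]
    have "(LINT \<zeta>|torus_measure. (g \<zeta> - boundary_value h \<zeta>) * cnj (boundary_value u \<zeta>)) =
      (LINT \<zeta>|torus_measure. \<alpha> * (w \<zeta> * cnj (boundary_value u \<zeta>)) + \<alpha> * (u2 \<zeta> * cnj (boundary_value u \<zeta>))
         - boundary_value h \<zeta> * cnj (boundary_value u \<zeta>))"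
    proof (rule integral_cong_AE)
      show "AE \<zeta> in torus_measure. (g \<zeta> - boundary_value h \<zeta>) * cnj (boundary_value u \<zeta>) =
        \<alpha> * (w \<zeta> * cnj (boundary_value u \<zeta>)) + \<alpha> * (u2 \<zeta> * cnj (boundary_value u \<zeta>))
         - boundary_value h \<zeta> * cnj (boundary_value u \<zeta>)"
        using AEg by eventually_elim (simp add: algebra_simps)
    qed measurable
    also have "\<dots> = \<alpha> * (LINT \<zeta>|torus_measure. w \<zeta> * cnj (boundary_value u \<zeta>)) +
       \<alpha> * (LINT \<zeta>|torus_measure. u2 \<zeta> * cnj (boundary_value u \<zeta>)) -
       (LINT \<zeta>|torus_measure. boundary_value h \<zeta> * cnj (boundary_value u \<zeta>))"
      using i by simp
    \<comment> \<open>Moving the unimodular factor to the other side turns the pairing of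
      \<open>w\<close> with \<open>u\<close> into one of \<open>f1\<close> with
      \<open>\<psi> u\<close>.\<close>
    also have "(LINT \<zeta>|torus_measure. w \<zeta> * cnj (boundary_value u \<zeta>)) =
        (LINT \<zeta>|torus_measure. u1 \<zeta> * cnj (c \<zeta> * boundary_value u \<zeta>))"
      by (simp add: w_def mult_ac)
    also have "\<dots> = hardy_inner f1 (\<lambda>z. \<psi> z * u z)"
      by (intro hardy_inner_eq_boundary_integral[symmetric] f1h u1 inner_mult_hardy2 psi uh cb ub hardy2D(4)[OF uh])
    also have "\<dots> = 0" by (rule model_spaceD(2)[OF f1 uh])
    also have "(LINT \<zeta>|torus_measure. u2 \<zeta> * cnj (boundary_value u \<zeta>)) = hardy_inner f2 u"
      by (rule hardy_inner_eq_boundary_integral[OF f2h u2 uh ub, symmetric])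
    also have "(LINT \<zeta>|torus_measure. boundary_value h \<zeta> * cnj (boundary_value u \<zeta>)) = hardy_inner h u"
      by (rule hardy_inner_eq_boundary_integral[OF hh hb uh ub, symmetric])
    finally show ?thesis by (simp add: hardy_inner_cmult_left[OF f2h uh])
  qed
  have "proj_z2 g = (\<lambda>z. \<alpha> * f2 z)"
    unfolding proj_z2_def
  proof (rule the_equality)
    show "(\<lambda>z. \<alpha> * f2 z) \<in> hardy_z2 \<and> (\<forall>u\<in>hardy_z2.
        (LINT \<zeta>|torus_measure. (g \<zeta> - boundary_value (\<lambda>z. \<alpha> * f2 z) \<zeta>) * cnj (boundary_value u \<zeta>)) = 0)"
      using key[OF af2] af2 by simp
    fix h assume h: "h \<in> hardy_z2 \<and> (\<forall>u\<in>hardy_z2.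
        (LINT \<zeta>|torus_measure. (g \<zeta> - boundary_value h \<zeta>) * cnj (boundary_value u \<zeta>)) = 0)"
    then have hz: "h \<in> hardy_z2" by simp
    let ?d = "\<lambda>z. \<alpha> * f2 z - h z"
    have d: "?d \<in> hardy_z2" by (rule hardy_z2_diff[OF af2 hz])
    have "hardy_inner ?d ?d = 0"
      using key[OF hz d] h d
      by (simp add: hardy_inner_diff_left[OF hardy_z2_hardy2[OF af2] hardy_z2_hardy2[OF hz] hardy_z2_hardy2[OF d]])
    then show "h = (\<lambda>z. \<alpha> * f2 z)"
      using hardy_inner_diff_self_eq_0[OF hardy_z2_hardy2[OF af2] hardy_z2_hardy2[OF hz]] by simp
  qed
  then show ?thesis unfolding g_def .
qed

theorem U1_decomposition:
  assumes zero: "\<forall>z2\<in>ball 0 1. \<phi> (0, z2) = 0"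
    and f1: "f1 \<in> model_space \<psi>" and f2: "f2 \<in> hardy_z2"
  shows "U1 \<phi> \<alpha> (\<lambda>z. f1 z + \<psi> z * f2 z) = (\<lambda>z. fst z * f1 z + \<alpha> * f2 z)"
proof -
  note f2h = hardy_z2_hardy2[OF f2]
  have "(\<lambda>z. fst z * (f1 z + \<psi> z * f2 z)) = (\<lambda>z. fst z * f1 z + \<phi> z * f2 z)"
    by (simp add: fun_cong[OF phi_mult[OF f2h]] distrib_left)
  then have 1: "compressed_shift1 \<phi> (\<lambda>z. f1 z + \<psi> z * f2 z) = (\<lambda>z. fst z * f1 z)"
    unfolding compressed_shift1_def
    using model_proj_eq[OF phi fst_mult_model_space[OF f1] f2h] by simp
  have 2: "model_proj \<phi> (\<lambda>z. \<alpha> * f2 z) = (\<lambda>z. \<alpha> * f2 z)"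
    using model_proj_eq[OF phi hardy_z2_model_space[OF hardy_z2_cmult[OF f2]] hardy2_zero, of \<alpha>] by simp
  show ?thesis unfolding U1_def 1 proj_z2_theta1[OF zero f1 f2] 2 ..
qed

end

section \<open>Dividing an inner function by \<open>z\<^sub>1\<close>\<close>

lemma stolz_region_subset_bidisk:
  assumes "0 < M"
  shows "stolz_region M \<zeta> \<subseteq> bidisk"
proof
  fix z assume "z \<in> stolz_region M \<zeta>"
  then have "0 < M * (1 - cmod (fst z))" "0 < M * (1 - cmod (snd z))"
    unfolding stolz_region_def by (auto intro: le_less_trans[OF norm_ge_zero])
  with assms show "z \<in> bidisk" by (simp add: zero_less_mult_iff bidisk_def mem_Times_iff)
qed

lemma inner_function_divide_fst:
  assumes phi: "inner_function \<phi>" and zero: "\<forall>z2\<in>ball 0 1. \<phi> (0, z2) = 0"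
  shows "\<exists>\<psi>. inner_function \<psi> \<and> (\<forall>z\<in>bidisk. \<phi> z = fst z * \<psi> z)"
proof -
  \<comment> \<open>An inner function may have any values off the bidisk. Multiplying by this
    normalized constant 1 turns \<phi> into an element of \<open>hardy2\<close>, to which the
    splitting applies.\<close>
  define e :: "complex \<times> complex \<Rightarrow> complex" where "e z = (if z \<in> bidisk then 1 else 0)" for z
  have "e \<in> hardy2"
  proof (rule hardy2I)
    show "has_bidisk_series e (\<lambda>p. if p = (0, 0) then 1 else 0)"
      unfolding has_bidisk_series_iff
      by (intro ballI has_sum_finite_neutralI[of "{(0, 0)}"]) (auto simp: e_def bimonom_def)
    show "square_summable (\<lambda>p. if p = (0, 0) then 1 else 0)"
      by (rule summable_on_cong_neutral[THEN iffD1, OF _ _ _ summable_on_finite[of "{(0, 0)}"]]) auto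
  qed (simp add: e_def)
  from hardy2_split_fst[OF inner_mult_hardy2[OF phi this]]
  obtain f0 \<psi> where f0: "f0 \<in> hardy_z2" and psi: "\<psi> \<in> hardy2"
    and eq: "(\<lambda>z. \<phi> z * e z) = (\<lambda>z. f0 z + fst z * \<psi> z)" by blast
  have sum: "\<phi> z = f0 z + fst z * \<psi> z" if "z \<in> bidisk" for z
    using fun_cong[OF eq, of z] that by (simp add: e_def)
  obtain k where k: "f0 = (\<lambda>z. if z \<in> bidisk then k (snd z) else 0)"
    using f0 by (auto simp: hardy_z2_def)
  have fac: "\<phi> z = fst z * \<psi> z" if z: "z \<in> bidisk" for z
  proof -
    have "(0, snd z) \<in> bidisk" using z by (auto simp: bidisk_def)
    \<comment> \<open>At \<open>z\<^sub>1 = 0\<close> the splitting reduces to its part in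
      \<open>z\<^sub>2\<close>, which therefore vanishes identically.\<close>
    from sum[OF this] this zero have "k (snd z) = 0" by (auto simp: k bidisk_def)
    with sum[OF z] z show ?thesis by (simp add: k)
  qed
  have hol: "holomorphic_on_bidisk \<psi>" by (rule hardy2D(4)[OF psi])
  obtain B where B: "\<And>z. z \<in> bidisk \<Longrightarrow> cmod (\<phi> z) \<le> B" using inner_function_bounded[OF phi] by blast
  \<comment> \<open>Away from \<open>z\<^sub>1 = 0\<close> the quotient costs at most a factor 2;
    any other radius in (0, 1) would only change the constant.\<close>
  have out: "cmod (\<psi> z) \<le> 2 * B" if z: "z \<in> bidisk" and ge: "1/2 \<le> cmod (fst z)" for z
  proof -
    have "1/2 * cmod (\<psi> z) \<le> cmod (fst z) * cmod (\<psi> z)" using ge by (intro mult_right_mono) auto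
    also have "\<dots> \<le> B" using B[OF z] fac[OF z] by (simp add: norm_mult)
    finally show ?thesis by simp
  qed
  have bd: "cmod (\<psi> z) \<le> 2 * B" if z: "z \<in> bidisk" for z
  proof (cases "1/2 \<le> cmod (fst z)")
    case False
    let ?g = "\<lambda>u. \<psi> (u, snd z)"
    have g: "?g holomorphic_on ball 0 1"
      using z by (intro holomorphic_on_bidisk_slices[OF hol]) (auto simp: bidisk_def)
    have "cmod (?g (fst z)) \<le> 2 * B"
    \<comment> \<open>For small \<open>z\<^sub>1\<close> the bound is carried inward from the circle
      of radius 1/2, with \<open>z\<^sub>2\<close> fixed.\<close>
    proof (rule maximum_modulus_frontier[where S = "cball 0 (1/2)" and f = ?g])
      show "?g holomorphic_on interior (cball 0 (1/2))"
        by (rule holomorphic_on_subset[OF g]) auto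
      show "continuous_on (closure (cball 0 (1/2))) ?g"
        by (rule continuous_on_subset[OF holomorphic_on_imp_continuous_on[OF g]]) auto
      show "cmod (?g u) \<le> 2 * B" if "u \<in> frontier (cball 0 (1/2))" for u
        using that z by (intro out) (auto simp: bidisk_def)
      show "fst z \<in> cball 0 (1/2)" using False by simp
    qed simp
    then show ?thesis by simp
  qed (rule out[OF z])
  have "inner_function \<psi>"
    unfolding inner_function_def
  proof (intro conjI hol)
    show "bounded (\<psi> ` bidisk)" unfolding bounded_iff using bd by blast
    have "AE \<zeta> in torus_measure. \<exists>c. cmod c = 1 \<and> (\<forall>M>1. (\<phi> \<longlongrightarrow> c) (at \<zeta> within stolz_region M \<zeta>))"
      using phi by (simp add: inner_function_def)
    then show "AE \<zeta> in torus_measure. \<exists>c. cmod c = 1 \<and> (\<forall>M>1. (\<psi> \<longlongrightarrow> c) (at \<zeta> within stolz_region M \<zeta>))"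
      using AE_space
    proof eventually_elim
      case (elim \<zeta>)
      then obtain c where c: "cmod c = 1" "\<And>M. M > 1 \<Longrightarrow> (\<phi> \<longlongrightarrow> c) (at \<zeta> within stolz_region M \<zeta>)" by blast
      have \<zeta>: "cmod (fst \<zeta>) = 1" using elim by (auto simp: torus_def)
      then have nz: "fst \<zeta> \<noteq> 0" by auto
      show ?case
      proof (intro exI conjI allI impI)
        show "cmod (c / fst \<zeta>) = 1" using c \<zeta> by (simp add: norm_divide)
        fix M :: real assume M: "M > 1"
        let ?F = "at \<zeta> within stolz_region M \<zeta>"
        have 1: "((\<lambda>z. \<phi> z / fst z) \<longlongrightarrow> c / fst \<zeta>) ?F"
          by (intro tendsto_intros c M nz)
        have "(fst \<longlongrightarrow> fst \<zeta>) ?F" by (intro tendsto_intros)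
        then have "\<forall>\<^sub>F z in ?F. fst z \<noteq> 0" using nz by (rule tendsto_imp_eventually_ne)
        moreover have "\<forall>\<^sub>F z in ?F. z \<in> bidisk"
          using stolz_region_subset_bidisk[of M \<zeta>] M by (auto simp: eventually_at_filter intro!: always_eventually)
        ultimately have "\<forall>\<^sub>F z in ?F. \<phi> z / fst z = \<psi> z"
          \<comment> \<open>The factorization may be divided by \<open>z\<^sub>1\<close> here: the
            Stolz region lies in the bidisk, and near \<zeta> the first coordinate stays away from
            0.\<close>
          by eventually_elim (simp add: fac)
        with 1 show "(\<psi> \<longlongrightarrow> c / fst \<zeta>) ?F" by (rule Lim_transform_eventually)
      qed
    qed
  qed
  with fac show ?thesis by blast
qed

theorem corollary4p5:
  fixes \<phi> :: "complex \<times> complex \<Rightarrow> complex"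
    and \<alpha> :: complex
    and \<sigma> :: "(complex \<times> complex) measure"
    and J :: "(complex \<times> complex \<Rightarrow> complex) \<Rightarrow> complex \<times> complex \<Rightarrow> complex"
  assumes "inner_function \<phi>"
    and "\<not> \<phi> constant_on bidisk"
    and "cmod \<alpha> = 1"
    and "clark_measure \<phi> \<alpha> \<sigma>"
    and "clark_embedding \<phi> \<alpha> \<sigma> J"
    and "clark_embedding_surj \<phi> \<sigma> J"
    and "bounded (theta1 \<phi> \<alpha> ` bidisk)"
    and "\<forall>z2\<in>ball 0 1. \<phi> (0, z2) = 0"
  shows "(\<exists>\<psi>. inner_function \<psi> \<and> (\<forall>z\<in>bidisk. \<phi> z = fst z * \<psi> z)) \<and>
    (\<forall>\<psi>. inner_function \<psi> \<and> (\<forall>z\<in>bidisk. \<phi> z = fst z * \<psi> z) \<longrightarrow>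
       orthogonal_direct_sum (model_space \<phi>) (model_space \<psi>)
         ((\<lambda>g z. \<psi> z * g z) ` hardy_z2) \<and>
       (\<forall>f1\<in>model_space \<psi>. \<forall>f2\<in>hardy_z2.
          U1 \<phi> \<alpha> (\<lambda>z. f1 z + \<psi> z * f2 z) = (\<lambda>z. fst z * f1 z + \<alpha> * f2 z)))"
proof (intro conjI allI impI)
  show "\<exists>\<psi>. inner_function \<psi> \<and> (\<forall>z\<in>bidisk. \<phi> z = fst z * \<psi> z)"
    by (rule inner_function_divide_fst[OF assms(1,8)])
  fix \<psi> assume "inner_function \<psi> \<and> (\<forall>z\<in>bidisk. \<phi> z = fst z * \<psi> z)"
  then interpret inner_factor \<phi> \<psi> using assms(1) by unfold_locales auto
  show "orthogonal_direct_sum (model_space \<phi>) (model_space \<psi>) ((\<lambda>g z. \<psi> z * g z) ` hardy_z2)"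
    by (rule orthogonal_decomposition)
  show "\<forall>f1\<in>model_space \<psi>. \<forall>f2\<in>hardy_z2.
      U1 \<phi> \<alpha> (\<lambda>z. f1 z + \<psi> z * f2 z) = (\<lambda>z. fst z * f1 z + \<alpha> * f2 z)"
    by (intro ballI U1_decomposition assms(8))
qed

end
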